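(* Let $\mathcal{C}$ be a $\mathcal{V}\text{-}\mathsf{Cat}$-enriched autonomous category, and fix an interpretation in $\mathcal{C}$ of the ground types and operation symbols of a linear $\lambda$-calculus. If a $\mathcal{V}$-equation-in-context $\Gamma\rhd v=_q w:A$ is derivable using the equations of the linear $\lambda$-calculus and the $\mathcal{V}$-congruence rules listed below, then $a(\llbracket\Gamma\rhd v:A\rrbracket,\llbracket\Gamma\rhd w:A\rrbracket)\ge q$, where $a$ is the underlying function of the hom-$\mathcal{V}$-category $\mathcal{C}(\llbracket\Gamma\rrbracket,\llbracket A\rrbracket)$.
   Context: Standing assumptions on $\mathcal{V}$: $\mathcal{V}$ is a commutative unital quantale (complete lattice with commutative associative $\otimes$ distributing over arbitrary joins, unit $k$), integral ($k=\top$), whose underlying lattice is continuous (for all $x$, $x=\bigvee\{y\mid y\ll x\}$, where $y\ll x$ means: whenever $x\le\bigvee X$ there is a finite $A\subseteq X$ with $y\le\bigvee A$), with a fixed basis $B$ (a subset such that for each $x$, $B\cap\{y\mid y\ll x\}$ is directed with join $x$) that is closed under finite joins and $\otimes$ and contains $k$. Linear $\lambda$-calculus: given a class $G$ of ground types, types are $A::=X\in G\mid I\mid A\otimes A\mid A\multimap A$; given a class $\Sigma$ of operation symbols $f:A_1,\dots,A_n\to A$ ($n\ge1$). Contexts are lists of typed variables, each variable occurring at most once. A shuffle of $\Gamma_1,\dots,\Gamma_n$ is a permutation of their concatenation preserving the relative order inside each $\Gamma_i$. Terms: if $\Gamma_i\rhd v_i:A_i$, $f:A_1,\dots,A_n\to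 A\in\Sigma$ and $E$ is a shuffle of $\Gamma_1,\dots,\Gamma_n$, then $E\rhd f(v_1,\dots,v_n):A$; $x:A\rhd x:A$; $-\rhd\ast:I$; from $\Gamma\rhd v:I$, $\Delta\rhd w:A$: $E\rhd v\ \mathtt{to}\ \ast.\,w:A$; from $\Gamma\rhd v:A$, $\Delta\rhd w:B$: $E\rhd v\otimes w:A\otimes B$; from $\Gamma\rhd v:A\otimes B$, $\Delta,x:A,y:B\rhd w:C$: $E\rhd\mathtt{pm}\ v\ \mathtt{to}\ x\otimes y.\,w:C$; from $\Gamma,x:A\rhd v:B$: $\Gamma\rhd\lambda x:A.\,v:A\multimap B$; from $\Gamma\rhd v:A\multimap B$, $\Delta\rhd w:A$: $E\rhd v\,w:B$ (in each binary rule $E$ ranges over shuffles of $\Gamma,\Delta$). Every judgement has a unique derivation. Interpretation in an autonomous (symmetric monoidal closed) category: ground types and operation symbols are assigned objects and morphisms $\llbracket f\rrbracket:\llbracket A_1\rrbracket\otimes\dots\otimes\llbracket A_n\rrbracket\to\llbracket A\rrbracket$; types via $I,\otimes,\multimap$; a context $x_1:A_1,\dots,x_n:A_n$ as the left-nested tensor $\llbracket A_1\rrbracket\otimes\dots\otimes\llbracket A_n\rrbracket$ (empty context as $I$); judgements $\Gamma\rhd v:A$ as morphisms $\llbracket\Gamma\rrbracket\to\llbracket A\rrbracket$ by the standard inductive clauses (variables and $\ast$ as identities, $f(\vec v)$ as $\llbracket f\rrbracket$ after the tensor of the argument interpretations precomposed with canonical shuffle/split isomorphisms, $\lambda$ by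 currying, application by evaluation, $\mathtt{to}$ via the left unitor, $\mathtt{pm}$ via the canonical associativity/symmetry isomorphisms). A $\mathcal{V}$-equation-in-context is $\Gamma\rhd v=_q w:A$ with $q\in B$ and $\Gamma\rhd v:A$, $\Gamma\rhd w:A$; $\Gamma\rhd v=w:A$ abbreviates both $v=_\top w$ and $w=_\top v$. Equations of the linear $\lambda$-calculus: $\mathtt{pm}\ v\otimes w\ \mathtt{to}\ x\otimes y.\,u=u[v/x,w/y]$; $\mathtt{pm}\ v\ \mathtt{to}\ x\otimes y.\,u[x\otimes y/z]=u[v/z]$; $\ast\ \mathtt{to}\ \ast.\,v=v$; $v\ \mathtt{to}\ \ast.\,w[\ast/z]=w[v/z]$; $(\lambda x:A.\,v)\,w=v[w/x]$; $\lambda x:A.(v\,x)=v$; $u[v\ \mathtt{to}\ \ast.\,w/z]=v\ \mathtt{to}\ \ast.\,u[w/z]$; $u[\mathtt{pm}\ v\ \mathtt{to}\ x\otimes y.\,w/z]=\mathtt{pm}\ v\ \mathtt{to}\ x\otimes y.\,u[w/z]$. $\mathcal{V}$-congruence rules (contexts and types omitted): $v=_\top v$; from $v=_q w$ and $w=_r u$ infer $v=_{q\otimes r}u$; from $v=_q w$ and $r\le q$ infer $v=_r w$; if $v=_r w$ for all $r\ll q$ then $v=_q w$; from $v=_{q_i}w$ for all $i\le n$ infer $v=_{\bigvee_i q_i}w$ (including $n=0$, giving $v=_\bot w$); from $v_i=_{q_i}w_i$ infer $f(v_1,\dots,v_n)=_{\otimes_i q_i}f(w_1,\dots,w_n)$;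 from $v=_q w$, $v'=_r w'$ infer $v\otimes v'=_{q\otimes r}w\otimes w'$, $\mathtt{pm}\ v\ \mathtt{to}\ x\otimes y.\,v'=_{q\otimes r}\mathtt{pm}\ w\ \mathtt{to}\ x\otimes y.\,w'$, $v\ \mathtt{to}\ \ast.\,v'=_{q\otimes r}w\ \mathtt{to}\ \ast.\,w'$, $v\,v'=_{q\otimes r}w\,w'$ and $v[v'/x]=_{q\otimes r}w[w'/x]$; from $v=_q w$ infer $\lambda x:A.\,v=_q\lambda x:A.\,w$; from $\Gamma\rhd v=_q w:A$ and $\Delta$ a permutation of $\Gamma$ infer $\Delta\rhd v=_q w:A$. $\mathcal{V}$-categories, $\mathcal{V}$-functors and $\mathcal{V}\text{-}\mathsf{Cat}$: $(X,a)$ with $a:X\times X\to\mathcal{V}$, $k\le a(x,x)$, $a(x,y)\otimes a(y,z)\le a(x,z)$; $\mathcal{V}$-functors satisfy $a(x,y)\le b(fx,fy)$; $\mathcal{V}\text{-}\mathsf{Cat}$ is monoidal with $(X,a)\otimes(Y,b)=(X\times Y,a\otimes b)$, $(a\otimes b)((x,y),(x',y'))=a(x,x')\otimes b(y,y')$. A $\mathcal{V}\text{-}\mathsf{Cat}$-enriched autonomous category is an autonomous category $\mathcal{C}$ whose hom-sets are $\mathcal{V}$-categories such that composition $\mathcal{C}(X,Y)\otimes\mathcal{C}(Y,Z)\to\mathcal{C}(X,Z)$ is a $\mathcal{V}$-functor, the maps $\mathcal{C}(X,Y)\otimes\mathcal{C}(X',Y')\to\mathcal{C}(X\otimes X',Y\otimes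 Y')$ induced by $\otimes$ are $\mathcal{V}$-functors, and the adjunction $(-\otimes X)\dashv(X\multimap -)$ is enriched: both functors act by $\mathcal{V}$-functors on homs and the natural bijections $\mathcal{C}(Y\otimes X,Z)\cong\mathcal{C}(Y,X\multimap Z)$ are $\mathcal{V}$-isomorphisms. *)

theory Defs
  imports Main "HOL-Library.Multiset"
begin

section \<open>Quantales\<close>

text \<open>The tensor and the unit of a commutative unital quantale are written \<open>*\<close> and \<open>1\<close>.\<close>

class quantale = complete_lattice + comm_monoid_mult +
  assumes mult_Sup: "x * Sup A = Sup ((*) x ` A)"

definition way_below :: "'v::complete_lattice \<Rightarrow> 'v \<Rightarrow> bool" (infix "\<lless>" 50) where
  "y \<lless> x \<longleftrightarrow> (\<forall>X. x \<le> Sup X \<longrightarrow> (\<exists>A\<subseteq>X. finite A \<and> y \<le> Sup A))"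

definition directed :: "'v::order set \<Rightarrow> bool" where
  "directed D \<longleftrightarrow> D \<noteq> {} \<and> (\<forall>x\<in>D. \<forall>y\<in>D. \<exists>z\<in>D. x \<le> z \<and> y \<le> z)"

definition is_basis :: "'v::complete_lattice set \<Rightarrow> bool" where
  "is_basis B \<longleftrightarrow> (\<forall>x. directed (B \<inter> {y. y \<lless> x}) \<and> Sup (B \<inter> {y. y \<lless> x}) = x)"

section \<open>Categories enriched over generalised metric spaces\<close>

definition vcategory :: "'a set \<Rightarrow> ('a \<Rightarrow> 'a \<Rightarrow> 'v::quantale) \<Rightarrow> bool" where
  "vcategory X a \<longleftrightarrow>
     (\<forall>x\<in>X. 1 \<le> a x x) \<and> (\<forall>x\<in>X. \<forall>y\<in>X. \<forall>z\<in>X. a x y * a y z \<le> a x z)"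

definition vfunctor ::
  "'a set \<Rightarrow> ('a \<Rightarrow> 'a \<Rightarrow> 'v::quantale) \<Rightarrow> 'b set \<Rightarrow> ('b \<Rightarrow> 'b \<Rightarrow> 'v) \<Rightarrow> ('a \<Rightarrow> 'b) \<Rightarrow> bool" where
  "vfunctor X a Y b f \<longleftrightarrow> f ` X \<subseteq> Y \<and> (\<forall>x\<in>X. \<forall>y\<in>X. a x y \<le> b (f x) (f y))"

definition visomorphism ::
  "'a set \<Rightarrow> ('a \<Rightarrow> 'a \<Rightarrow> 'v::quantale) \<Rightarrow> 'b set \<Rightarrow> ('b \<Rightarrow> 'b \<Rightarrow> 'v) \<Rightarrow> ('a \<Rightarrow> 'b) \<Rightarrow> bool" where
  "visomorphism X a Y b f \<longleftrightarrow>
     bij_betw f X Y \<and> vfunctor X a Y b f \<and> vfunctor Y b X a (the_inv_into X f)"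

definition vtensor ::
  "('a \<Rightarrow> 'a \<Rightarrow> 'v::quantale) \<Rightarrow> ('b \<Rightarrow> 'b \<Rightarrow> 'v) \<Rightarrow> 'a \<times> 'b \<Rightarrow> 'a \<times> 'b \<Rightarrow> 'v" where
  "vtensor a b p q = a (fst p) (fst q) * b (snd p) (snd q)"

record ('o, 'm) category =
  Ob :: "'o set"
  Ar :: "'m set"
  src :: "'m \<Rightarrow> 'o"
  tgt :: "'m \<Rightarrow> 'o"
  idn :: "'o \<Rightarrow> 'm"
  cmp :: "'m \<Rightarrow> 'm \<Rightarrow> 'm" (infixr "\<cdot>\<index>" 65)

text \<open>
  Objects and morphisms below: \<open>assoc X Y Z : (X \<otimes> Y) \<otimes> Z \<rightarrow> X \<otimes> (Y \<otimes> Z)\<close>,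
  \<open>lun X : I \<otimes> X \<rightarrow> X\<close>, \<open>run X : X \<otimes> I \<rightarrow> X\<close>, \<open>sym X Y : X \<otimes> Y \<rightarrow> Y \<otimes> X\<close>;
  \<open>X \<multimap> Z\<close> is the internal hom, \<open>ihomm X f\<close> the action of \<open>X \<multimap> -\<close> on a morphism,
  and \<open>curry Y X\<close> maps morphisms \<open>Y \<otimes> X \<rightarrow> Z\<close> to morphisms \<open>Y \<rightarrow> X \<multimap> Z\<close>.
  The indices of \<open>curry\<close> are needed because \<open>Y\<close> and \<open>X\<close> need not be determined by \<open>Y \<otimes> X\<close>.
\<close>

record ('o, 'm) monoidal_category = "('o, 'm) category" +
  unit_ob :: "'o"
  tens :: "'o \<Rightarrow> 'o \<Rightarrow> 'o" (infixl "\<odot>\<index>" 70)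
  tensm :: "'m \<Rightarrow> 'm \<Rightarrow> 'm" (infixl "\<otimes>\<index>" 70)
  assoc :: "'o \<Rightarrow> 'o \<Rightarrow> 'o \<Rightarrow> 'm"
  lun :: "'o \<Rightarrow> 'm"
  run :: "'o \<Rightarrow> 'm"
  sym :: "'o \<Rightarrow> 'o \<Rightarrow> 'm"

record ('o, 'm) autonomous_category = "('o, 'm) monoidal_category" +
  ihom :: "'o \<Rightarrow> 'o \<Rightarrow> 'o" (infixr "\<multimap>\<index>" 67)
  ihomm :: "'o \<Rightarrow> 'm \<Rightarrow> 'm"
  curry :: "'o \<Rightarrow> 'o \<Rightarrow> 'm \<Rightarrow> 'm"

record ('o, 'm, 'v) vautonomous_category = "('o, 'm) autonomous_category" +
  dist :: "'m \<Rightarrow> 'm \<Rightarrow> 'v"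

definition hom :: "('o, 'm, 'x) category_scheme \<Rightarrow> 'o \<Rightarrow> 'o \<Rightarrow> 'm set" where
  "hom C X Y = {f \<in> Ar C. src C f = X \<and> tgt C f = Y}"

definition inverse_arrows :: "('o, 'm, 'x) category_scheme \<Rightarrow> 'm \<Rightarrow> 'm \<Rightarrow> bool" where
  "inverse_arrows C f g \<longleftrightarrow>
     f \<in> Ar C \<and> g \<in> hom C (tgt C f) (src C f) \<and>
     cmp C g f = idn C (src C f) \<and> cmp C f g = idn C (tgt C f)"

definition is_iso :: "('o, 'm, 'x) category_scheme \<Rightarrow> 'm \<Rightarrow> bool" where
  "is_iso C f \<longleftrightarrow> (\<exists>g. inverse_arrows C f g)"

definition inv_arrow :: "('o, 'm, 'x) category_scheme \<Rightarrow> 'm \<Rightarrow> 'm" where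
  "inv_arrow C f = (THE g. inverse_arrows C f g)"

locale category =
  fixes C :: "('o, 'm, 'x) category_scheme" (structure)
  assumes src_Ob: "f \<in> Ar C \<Longrightarrow> src C f \<in> Ob C"
    and tgt_Ob: "f \<in> Ar C \<Longrightarrow> tgt C f \<in> Ob C"
    and idn_hom: "X \<in> Ob C \<Longrightarrow> idn C X \<in> hom C X X"
    and cmp_hom: "\<lbrakk>f \<in> hom C X Y; g \<in> hom C Y Z\<rbrakk> \<Longrightarrow> g \<cdot> f \<in> hom C X Z"
    and cmp_idn: "f \<in> hom C X Y \<Longrightarrow> f \<cdot> idn C X = f"
    and idn_cmp: "f \<in> hom C X Y \<Longrightarrow> idn C Y \<cdot> f = f"
    and cmp_cmp: "\<lbrakk>f \<in> hom C W X; g \<in> hom C X Y; h \<in> hom C Y Z\<rbrakk> \<Longrightarrow> (h \<cdot> g) \<cdot> f = h \<cdot> (g \<cdot> f)"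

locale symmetric_monoidal_category = category C
  for C :: "('o, 'm, 'x) monoidal_category_scheme" (structure) +
  assumes unit_Ob: "unit_ob C \<in> Ob C"
    and tens_Ob: "\<lbrakk>X \<in> Ob C; Y \<in> Ob C\<rbrakk> \<Longrightarrow> X \<odot> Y \<in> Ob C"
    and tensm_hom: "\<lbrakk>f \<in> hom C X Y; g \<in> hom C X' Y'\<rbrakk> \<Longrightarrow> f \<otimes> g \<in> hom C (X \<odot> X') (Y \<odot> Y')"
    and tensm_idn: "\<lbrakk>X \<in> Ob C; Y \<in> Ob C\<rbrakk> \<Longrightarrow> idn C X \<otimes> idn C Y = idn C (X \<odot> Y)"
    and tensm_cmp:
      "\<lbrakk>f \<in> hom C X Y; g \<in> hom C Y Z; f' \<in> hom C X' Y'; g' \<in> hom C Y' Z'\<rbrakk>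
        \<Longrightarrow> (g \<cdot> f) \<otimes> (g' \<cdot> f') = (g \<otimes> g') \<cdot> (f \<otimes> f')"
    and assoc_hom:
      "\<lbrakk>X \<in> Ob C; Y \<in> Ob C; Z \<in> Ob C\<rbrakk> \<Longrightarrow> assoc C X Y Z \<in> hom C ((X \<odot> Y) \<odot> Z) (X \<odot> (Y \<odot> Z))"
    and assoc_iso: "\<lbrakk>X \<in> Ob C; Y \<in> Ob C; Z \<in> Ob C\<rbrakk> \<Longrightarrow> is_iso C (assoc C X Y Z)"
    and lun_hom: "X \<in> Ob C \<Longrightarrow> lun C X \<in> hom C (unit_ob C \<odot> X) X"
    and lun_iso: "X \<in> Ob C \<Longrightarrow> is_iso C (lun C X)"
    and run_hom: "X \<in> Ob C \<Longrightarrow> run C X \<in> hom C (X \<odot> unit_ob C) X"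
    and run_iso: "X \<in> Ob C \<Longrightarrow> is_iso C (run C X)"
    and sym_hom: "\<lbrakk>X \<in> Ob C; Y \<in> Ob C\<rbrakk> \<Longrightarrow> sym C X Y \<in> hom C (X \<odot> Y) (Y \<odot> X)"
    and assoc_natural:
      "\<lbrakk>f \<in> hom C X X'; g \<in> hom C Y Y'; h \<in> hom C Z Z'\<rbrakk>
        \<Longrightarrow> assoc C X' Y' Z' \<cdot> ((f \<otimes> g) \<otimes> h) = (f \<otimes> (g \<otimes> h)) \<cdot> assoc C X Y Z"
    and lun_natural: "f \<in> hom C X Y \<Longrightarrow> lun C Y \<cdot> (idn C (unit_ob C) \<otimes> f) = f \<cdot> lun C X"
    and run_natural: "f \<in> hom C X Y \<Longrightarrow> run C Y \<cdot> (f \<otimes> idn C (unit_ob C)) = f \<cdot> run C X"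
    and sym_natural:
      "\<lbrakk>f \<in> hom C X X'; g \<in> hom C Y Y'\<rbrakk> \<Longrightarrow> sym C X' Y' \<cdot> (f \<otimes> g) = (g \<otimes> f) \<cdot> sym C X Y"
    and pentagon:
      "\<lbrakk>W \<in> Ob C; X \<in> Ob C; Y \<in> Ob C; Z \<in> Ob C\<rbrakk>
        \<Longrightarrow> assoc C W X (Y \<odot> Z) \<cdot> assoc C (W \<odot> X) Y Z
          = (idn C W \<otimes> assoc C X Y Z) \<cdot> assoc C W (X \<odot> Y) Z \<cdot> (assoc C W X Y \<otimes> idn C Z)"
    and triangle:
      "\<lbrakk>X \<in> Ob C; Y \<in> Ob C\<rbrakk>
        \<Longrightarrow> (idn C X \<otimes> lun C Y) \<cdot> assoc C X (unit_ob C) Y = run C X \<otimes> idn C Y"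
    and hexagon:
      "\<lbrakk>X \<in> Ob C; Y \<in> Ob C; Z \<in> Ob C\<rbrakk>
        \<Longrightarrow> assoc C Y Z X \<cdot> sym C X (Y \<odot> Z) \<cdot> assoc C X Y Z
          = (idn C Y \<otimes> sym C X Z) \<cdot> assoc C Y X Z \<cdot> (sym C X Y \<otimes> idn C Z)"
    and sym_sym: "\<lbrakk>X \<in> Ob C; Y \<in> Ob C\<rbrakk> \<Longrightarrow> sym C Y X \<cdot> sym C X Y = idn C (X \<odot> Y)"

locale autonomous_category = symmetric_monoidal_category C
  for C :: "('o, 'm, 'x) autonomous_category_scheme" (structure) +
  assumes ihom_Ob: "\<lbrakk>X \<in> Ob C; Y \<in> Ob C\<rbrakk> \<Longrightarrow> X \<multimap> Y \<in> Ob C"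
    and ihomm_hom: "\<lbrakk>X \<in> Ob C; f \<in> hom C Y Z\<rbrakk> \<Longrightarrow> ihomm C X f \<in> hom C (X \<multimap> Y) (X \<multimap> Z)"
    and ihomm_idn: "\<lbrakk>X \<in> Ob C; Y \<in> Ob C\<rbrakk> \<Longrightarrow> ihomm C X (idn C Y) = idn C (X \<multimap> Y)"
    and ihomm_cmp:
      "\<lbrakk>X \<in> Ob C; f \<in> hom C W Y; g \<in> hom C Y Z\<rbrakk>
        \<Longrightarrow> ihomm C X (g \<cdot> f) = ihomm C X g \<cdot> ihomm C X f"
    and curry_bij:
      "\<lbrakk>X \<in> Ob C; Y \<in> Ob C; Z \<in> Ob C\<rbrakk>
        \<Longrightarrow> bij_betw (curry C Y X) (hom C (Y \<odot> X) Z) (hom C Y (X \<multimap> Z))"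
    and curry_natural_left:
      "\<lbrakk>X \<in> Ob C; g \<in> hom C Y' Y; f \<in> hom C (Y \<odot> X) Z\<rbrakk>
        \<Longrightarrow> curry C Y' X (f \<cdot> (g \<otimes> idn C X)) = curry C Y X f \<cdot> g"
    and curry_natural_right:
      "\<lbrakk>X \<in> Ob C; Y \<in> Ob C; f \<in> hom C (Y \<odot> X) Z; h \<in> hom C Z Z'\<rbrakk>
        \<Longrightarrow> curry C Y X (h \<cdot> f) = ihomm C X h \<cdot> curry C Y X f"

locale vcat_enriched_autonomous_category = autonomous_category C
  for C :: "('o, 'm, 'v::quantale, 'x) vautonomous_category_scheme" (structure) +
  assumes hom_vcategory: "\<lbrakk>X \<in> Ob C; Y \<in> Ob C\<rbrakk> \<Longrightarrow> vcategory (hom C X Y) (dist C)"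
    and cmp_vfunctor:
      "\<lbrakk>X \<in> Ob C; Y \<in> Ob C; Z \<in> Ob C\<rbrakk>
        \<Longrightarrow> vfunctor (hom C X Y \<times> hom C Y Z) (vtensor (dist C) (dist C))
              (hom C X Z) (dist C) (\<lambda>(f, g). g \<cdot> f)"
    and tensm_vfunctor:
      "\<lbrakk>X \<in> Ob C; Y \<in> Ob C; X' \<in> Ob C; Y' \<in> Ob C\<rbrakk>
        \<Longrightarrow> vfunctor (hom C X Y \<times> hom C X' Y') (vtensor (dist C) (dist C))
              (hom C (X \<odot> X') (Y \<odot> Y')) (dist C) (\<lambda>(f, g). f \<otimes> g)"
    and tens_right_vfunctor:
      "\<lbrakk>X \<in> Ob C; Y \<in> Ob C; Z \<in> Ob C\<rbrakk>
        \<Longrightarrow> vfunctor (hom C Y Z) (dist C) (hom C (Y \<odot> X) (Z \<odot> X)) (dist C) (\<lambda>f. f \<otimes> idn C X)"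
    and ihomm_vfunctor:
      "\<lbrakk>X \<in> Ob C; Y \<in> Ob C; Z \<in> Ob C\<rbrakk>
        \<Longrightarrow> vfunctor (hom C Y Z) (dist C) (hom C (X \<multimap> Y) (X \<multimap> Z)) (dist C) (ihomm C X)"
    and curry_visomorphism:
      "\<lbrakk>X \<in> Ob C; Y \<in> Ob C; Z \<in> Ob C\<rbrakk>
        \<Longrightarrow> visomorphism (hom C (Y \<odot> X) Z) (dist C) (hom C Y (X \<multimap> Z)) (dist C) (curry C Y X)"

definition ev :: "('o, 'm, 'x) autonomous_category_scheme \<Rightarrow> 'o \<Rightarrow> 'o \<Rightarrow> 'm" where
  "ev C X Z = the_inv_into (hom C (tens C (ihom C X Z) X) Z) (curry C (ihom C X Z) X)
                (idn C (ihom C X Z))"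

section \<open>Canonical isomorphisms between left-nested tensors\<close>

definition tenss :: "('o, 'm, 'x) monoidal_category_scheme \<Rightarrow> 'o list \<Rightarrow> 'o" where
  "tenss C Xs = (case Xs of [] \<Rightarrow> unit_ob C | X # Ys \<Rightarrow> foldl (tens C) X Ys)"

definition tensms :: "('o, 'm, 'x) monoidal_category_scheme \<Rightarrow> 'm list \<Rightarrow> 'm" where
  "tensms C ms = (case ms of [] \<Rightarrow> idn C (unit_ob C) | m # ns \<Rightarrow> foldl (tensm C) m ns)"

text \<open>\<open>split2 C Xs Ys : tenss C (Xs @ Ys) \<rightarrow> tenss C Xs \<odot> tenss C Ys\<close>\<close>

fun split2 :: "('o, 'm, 'x) monoidal_category_scheme \<Rightarrow> 'o list \<Rightarrow> 'o list \<Rightarrow> 'm" where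
  "split2 C Xs Ys =
    (if Xs = [] then inv_arrow C (lun C (tenss C Ys))
     else if Ys = [] then inv_arrow C (run C (tenss C Xs))
     else if butlast Ys = [] then idn C (tenss C (Xs @ Ys))
     else cmp C (assoc C (tenss C Xs) (tenss C (butlast Ys)) (last Ys))
                (tensm C (split2 C Xs (butlast Ys)) (idn C (last Ys))))"

declare split2.simps [simp del]

text \<open>\<open>split C [Xs1, ..., Xsn] : tenss C (Xs1 @ ... @ Xsn) \<rightarrow> tenss C Xs1 \<odot> ... \<odot> tenss C Xsn\<close>\<close>

fun split :: "('o, 'm, 'x) monoidal_category_scheme \<Rightarrow> 'o list list \<Rightarrow> 'm" where
  "split C Xss =
    (if Xss = [] then idn C (unit_ob C)
     else if butlast Xss = [] then idn C (tenss C (last Xss))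
     else cmp C (tensm C (split C (butlast Xss)) (idn C (tenss C (last Xss))))
                (split2 C (concat (butlast Xss)) (last Xss)))"

declare split.simps [simp del]

text \<open>\<open>exch C Xs Y Z Zs : tenss C (Xs @ [Y, Z] @ Zs) \<rightarrow> tenss C (Xs @ [Z, Y] @ Zs)\<close>\<close>

fun exch :: "('o, 'm, 'x) monoidal_category_scheme \<Rightarrow> 'o list \<Rightarrow> 'o \<Rightarrow> 'o \<Rightarrow> 'o list \<Rightarrow> 'm" where
  "exch C Xs Y Z Zs =
    (if Zs \<noteq> [] then tensm C (exch C Xs Y Z (butlast Zs)) (idn C (last Zs))
     else if Xs = [] then sym C Y Z
     else cmp C (inv_arrow C (assoc C (tenss C Xs) Z Y))
            (cmp C (tensm C (idn C (tenss C Xs)) (sym C Y Z)) (assoc C (tenss C Xs) Y Z)))"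

declare exch.simps [simp del]

text \<open>\<open>move_last C Xs Y Zs : tenss C (Xs @ [Y] @ Zs) \<rightarrow> tenss C (Xs @ Zs @ [Y])\<close>\<close>

fun move_last :: "('o, 'm, 'x) monoidal_category_scheme \<Rightarrow> 'o list \<Rightarrow> 'o \<Rightarrow> 'o list \<Rightarrow> 'm" where
  "move_last C Xs Y [] = idn C (tenss C (Xs @ [Y]))"
| "move_last C Xs Y (Z # Zs) = cmp C (move_last C (Xs @ [Z]) Y Zs) (exch C Xs Y Z Zs)"

text \<open>
  If \<open>E\<close> and \<open>F\<close> list the same distinct entries and \<open>ob\<close> assigns objects to entries, then
  \<open>permute C ob E F : tenss C (map ob E) \<rightarrow> tenss C (map ob F)\<close> is the canonical isomorphism,
  decomposed into exchanges of neighbours: the last entry of \<open>F\<close> is first moved to the end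
  of \<open>E\<close>.
\<close>

fun permute ::
  "('o, 'm, 'x) monoidal_category_scheme \<Rightarrow> ('e \<Rightarrow> 'o) \<Rightarrow> 'e list \<Rightarrow> 'e list \<Rightarrow> 'm" where
  "permute C ob E F =
    (if F = [] then idn C (unit_ob C)
     else let e = last F; E1 = takeWhile (\<lambda>x. x \<noteq> e) E; E2 = tl (dropWhile (\<lambda>x. x \<noteq> e) E) in
       if butlast F = [] then idn C (ob e)
       else cmp C (tensm C (permute C ob (E1 @ E2) (butlast F)) (idn C (ob e)))
                  (move_last C (map ob E1) (ob e) (map ob E2)))"

declare permute.simps [simp del]

section \<open>Linear lambda-calculus\<close>

datatype 'g ty = Ground 'g | Unit | Tensor "'g ty" "'g ty" | Lolli "'g ty" "'g ty"

record ('g, 'f) signature =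
  grounds :: "'g set"
  ops :: "'f set"
  args :: "'f \<Rightarrow> 'g ty list"
  res :: "'f \<Rightarrow> 'g ty"

definition is_type :: "('g, 'f) signature \<Rightarrow> 'g ty \<Rightarrow> bool" where
  "is_type S A \<longleftrightarrow> set_ty A \<subseteq> grounds S"

definition is_signature :: "('g, 'f) signature \<Rightarrow> bool" where
  "is_signature S \<longleftrightarrow>
     (\<forall>f\<in>ops S. args S f \<noteq> [] \<and> (\<forall>A\<in>set (args S f). is_type S A) \<and> is_type S (res S f))"

text \<open>
  Terms are taken up to renaming of bound variables. This is achieved by a locally nameless
  representation: free variables are names (natural numbers), whereas bound variables are
  de Bruijn indices \<open>BVar i\<close>. \<open>PmT v w\<close> binds two indices in \<open>w\<close>, namely \<open>1\<close> for the first
  and \<open>0\<close> for the second component, and \<open>LamT A v\<close> binds one. These two constructors are only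
  used through the named binders \<open>Pm\<close> and \<open>Lam\<close> below, so that typable terms never
  contain dangling indices and equality of typable terms is alpha-equivalence.
\<close>

datatype ('g, 'f) tm =
    Var nat
  | BVar nat
  | Op 'f "('g, 'f) tm list"
  | Star
  | To "('g, 'f) tm" "('g, 'f) tm"  \<comment> \<open>\<open>v to *. w\<close>\<close>
  | Tens "('g, 'f) tm" "('g, 'f) tm"
  | PmT "('g, 'f) tm" "('g, 'f) tm"
  | LamT "'g ty" "('g, 'f) tm"
  | App "('g, 'f) tm" "('g, 'f) tm"

text \<open>\<open>close k x t\<close> replaces the free variable \<open>x\<close> by the index that is \<open>k\<close> at the root of \<open>t\<close>.\<close>

primrec close :: "nat \<Rightarrow> nat \<Rightarrow> ('g, 'f) tm \<Rightarrow> ('g, 'f) tm" where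
  "close k x (Var y) = (if y = x then BVar k else Var y)"
| "close k x (BVar i) = BVar i"
| "close k x (Op f ts) = Op f (map (close k x) ts)"
| "close k x Star = Star"
| "close k x (To t u) = To (close k x t) (close k x u)"
| "close k x (Tens t u) = Tens (close k x t) (close k x u)"
| "close k x (PmT t u) = PmT (close k x t) (close (k + 2) x u)"
| "close k x (LamT A t) = LamT A (close (k + 1) x t)"
| "close k x (App t u) = App (close k x t) (close k x u)"

definition Lam :: "nat \<Rightarrow> 'g ty \<Rightarrow> ('g, 'f) tm \<Rightarrow> ('g, 'f) tm" where
  "Lam x A v = LamT A (close 0 x v)"

definition Pm :: "('g, 'f) tm \<Rightarrow> nat \<Rightarrow> nat \<Rightarrow> ('g, 'f) tm \<Rightarrow> ('g, 'f) tm" where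
  "Pm v x y w = PmT v (close 1 x (close 0 y w))"

text \<open>
  Simultaneous substitution for free variables. No index shifting is needed (and no capture can
  occur) as long as the substituted terms have no dangling indices, in particular for typable ones.
\<close>

primrec subst :: "(nat \<Rightarrow> ('g, 'f) tm) \<Rightarrow> ('g, 'f) tm \<Rightarrow> ('g, 'f) tm" where
  "subst \<sigma> (Var y) = \<sigma> y"
| "subst \<sigma> (BVar i) = BVar i"
| "subst \<sigma> (Op f ts) = Op f (map (subst \<sigma>) ts)"
| "subst \<sigma> Star = Star"
| "subst \<sigma> (To t u) = To (subst \<sigma> t) (subst \<sigma> u)"
| "subst \<sigma> (Tens t u) = Tens (subst \<sigma> t) (subst \<sigma> u)"
| "subst \<sigma> (PmT t u) = PmT (subst \<sigma> t) (subst \<sigma> u)"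
| "subst \<sigma> (LamT A t) = LamT A (subst \<sigma> t)"
| "subst \<sigma> (App t u) = App (subst \<sigma> t) (subst \<sigma> u)"

abbreviation subst1 :: "('g, 'f) tm \<Rightarrow> ('g, 'f) tm \<Rightarrow> nat \<Rightarrow> ('g, 'f) tm" ("_[_'/'/_]" [1000, 0, 0] 1000)
  where "u[v//x] \<equiv> subst (Var(x := v)) u"

abbreviation subst2 ::
  "('g, 'f) tm \<Rightarrow> ('g, 'f) tm \<Rightarrow> nat \<Rightarrow> ('g, 'f) tm \<Rightarrow> nat \<Rightarrow> ('g, 'f) tm"
  ("_[_'/'/_, _'/'/_]" [1000, 0, 0, 0, 0] 1000)
  where "u[v//x, w//y] \<equiv> subst (Var(x := v, y := w)) u"

type_synonym 'g ctx = "(nat \<times> 'g ty) list"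

definition is_ctx :: "'g ctx \<Rightarrow> bool" where
  "is_ctx \<Gamma> \<longleftrightarrow> distinct (map fst \<Gamma>)"

text \<open>The shuffles of finitely many lists, generalising \<^const>\<open>shuffles\<close>.\<close>

primrec shuffless :: "'a list list \<Rightarrow> 'a list set" where
  "shuffless [] = {[]}"
| "shuffless (xs # xss) = (\<Union>ys\<in>shuffless xss. shuffles xs ys)"

inductive typed :: "('g, 'f) signature \<Rightarrow> 'g ctx \<Rightarrow> ('g, 'f) tm \<Rightarrow> 'g ty \<Rightarrow> bool"
  for S :: "('g, 'f) signature" where
  Op: "\<lbrakk>f \<in> ops S; length \<Gamma>s = length (args S f); length vs = length (args S f);
        \<forall>i<length (args S f). typed S (\<Gamma>s ! i) (vs ! i) (args S f ! i);
        E \<in> shuffless \<Gamma>s; is_ctx E\<rbrakk>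
       \<Longrightarrow> typed S E (Op f vs) (res S f)"
| Var: "is_type S A \<Longrightarrow> typed S [(x, A)] (Var x) A"
| Star: "typed S [] Star Unit"
| To: "\<lbrakk>typed S \<Gamma> v Unit; typed S \<Delta> w A; E \<in> shuffles \<Gamma> \<Delta>; is_ctx E\<rbrakk>
       \<Longrightarrow> typed S E (To v w) A"
| Tens: "\<lbrakk>typed S \<Gamma> v A; typed S \<Delta> w B; E \<in> shuffles \<Gamma> \<Delta>; is_ctx E\<rbrakk>
       \<Longrightarrow> typed S E (Tens v w) (Tensor A B)"
| Pm: "\<lbrakk>typed S \<Gamma> v (Tensor A B); typed S (\<Delta> @ [(x, A), (y, B)]) w D;
        E \<in> shuffles \<Gamma> \<Delta>; is_ctx E\<rbrakk>
       \<Longrightarrow> typed S E (Pm v x y w) D"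
| Lam: "typed S (\<Gamma> @ [(x, A)]) v B \<Longrightarrow> typed S \<Gamma> (Lam x A v) (Lolli A B)"
| App: "\<lbrakk>typed S \<Gamma> v (Lolli A B); typed S \<Delta> w A; E \<in> shuffles \<Gamma> \<Delta>; is_ctx E\<rbrakk>
       \<Longrightarrow> typed S E (App v w) B"

section \<open>Interpretation\<close>

primrec tyob :: "('o, 'm, 'x) autonomous_category_scheme \<Rightarrow> ('g \<Rightarrow> 'o) \<Rightarrow> 'g ty \<Rightarrow> 'o" where
  "tyob C gi (Ground X) = gi X"
| "tyob C gi Unit = unit_ob C"
| "tyob C gi (Tensor A B) = tens C (tyob C gi A) (tyob C gi B)"
| "tyob C gi (Lolli A B) = ihom C (tyob C gi A) (tyob C gi B)"

abbreviation ctxobs ::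
  "('o, 'm, 'x) autonomous_category_scheme \<Rightarrow> ('g \<Rightarrow> 'o) \<Rightarrow> 'g ctx \<Rightarrow> 'o list" where
  "ctxobs C gi \<Gamma> \<equiv> map (tyob C gi \<circ> snd) \<Gamma>"

definition ctxob ::
  "('o, 'm, 'x) autonomous_category_scheme \<Rightarrow> ('g \<Rightarrow> 'o) \<Rightarrow> 'g ctx \<Rightarrow> 'o" where
  "ctxob C gi \<Gamma> = tenss C (ctxobs C gi \<Gamma>)"

definition is_interpretation ::
  "('o, 'm, 'x) autonomous_category_scheme \<Rightarrow> ('g, 'f) signature \<Rightarrow> ('g \<Rightarrow> 'o) \<Rightarrow> ('f \<Rightarrow> 'm) \<Rightarrow> bool"
  where
  "is_interpretation C S gi fi \<longleftrightarrow>
     (\<forall>X\<in>grounds S. gi X \<in> Ob C) \<and>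
     (\<forall>f\<in>ops S. fi f \<in> hom C (tenss C (map (tyob C gi) (args S f))) (tyob C gi (res S f)))"

text \<open>\<open>split_shuffle C gi E \<Gamma>s : ctxob C gi E \<rightarrow> ctxob C gi \<Gamma>1 \<odot> ... \<odot> ctxob C gi \<Gamma>n\<close>\<close>

definition split_shuffle ::
  "('o, 'm, 'x) autonomous_category_scheme \<Rightarrow> ('g \<Rightarrow> 'o) \<Rightarrow> 'g ctx \<Rightarrow> 'g ctx list \<Rightarrow> 'm" where
  "split_shuffle C gi E \<Gamma>s =
     cmp C (split C (map (ctxobs C gi) \<Gamma>s)) (permute C (tyob C gi \<circ> snd) E (concat \<Gamma>s))"

text \<open>
  The interpretation of judgements, as a relation following the typing rules: \<open>interp S C gi fi
  \<Gamma> v A m\<close> states that some derivation of \<open>\<Gamma> \<rhd> v : A\<close> is interpreted by \<open>m\<close>. Derivations are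
  unique up to the names chosen for bound variables, which do not influence \<open>m\<close>.
\<close>

inductive interp ::
  "('g, 'f) signature \<Rightarrow> ('o, 'm, 'x) autonomous_category_scheme \<Rightarrow> ('g \<Rightarrow> 'o) \<Rightarrow> ('f \<Rightarrow> 'm)
    \<Rightarrow> 'g ctx \<Rightarrow> ('g, 'f) tm \<Rightarrow> 'g ty \<Rightarrow> 'm \<Rightarrow> bool"
  for S :: "('g, 'f) signature" and C :: "('o, 'm, 'x) autonomous_category_scheme" (structure)
    and gi :: "'g \<Rightarrow> 'o" and fi :: "'f \<Rightarrow> 'm" where
  Op: "\<lbrakk>f \<in> ops S; length \<Gamma>s = length (args S f); length vs = length (args S f);
        length ms = length (args S f);
        \<forall>i<length (args S f). interp S C gi fi (\<Gamma>s ! i) (vs ! i) (args S f ! i) (ms ! i);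
        E \<in> shuffless \<Gamma>s; is_ctx E\<rbrakk>
       \<Longrightarrow> interp S C gi fi E (Op f vs) (res S f) (fi f \<cdot> tensms C ms \<cdot> split_shuffle C gi E \<Gamma>s)"
| Var: "is_type S A \<Longrightarrow> interp S C gi fi [(x, A)] (Var x) A (idn C (tyob C gi A))"
| Star: "interp S C gi fi [] Star Unit (idn C (unit_ob C))"
| To: "\<lbrakk>interp S C gi fi \<Gamma> v Unit m; interp S C gi fi \<Delta> w A n; E \<in> shuffles \<Gamma> \<Delta>; is_ctx E\<rbrakk>
       \<Longrightarrow> interp S C gi fi E (To v w) A
             (n \<cdot> lun C (ctxob C gi \<Delta>) \<cdot> (m \<otimes> idn C (ctxob C gi \<Delta>)) \<cdot> split_shuffle C gi E [\<Gamma>, \<Delta>])"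
| Tens: "\<lbrakk>interp S C gi fi \<Gamma> v A m; interp S C gi fi \<Delta> w B n; E \<in> shuffles \<Gamma> \<Delta>; is_ctx E\<rbrakk>
       \<Longrightarrow> interp S C gi fi E (Tens v w) (Tensor A B) ((m \<otimes> n) \<cdot> split_shuffle C gi E [\<Gamma>, \<Delta>])"
| Pm: "\<lbrakk>interp S C gi fi \<Gamma> v (Tensor A B) m;
        interp S C gi fi (\<Delta> @ [(x, A), (y, B)]) w D n;
        E \<in> shuffles \<Gamma> \<Delta>; is_ctx E\<rbrakk>
       \<Longrightarrow> interp S C gi fi E (Pm v x y w) D
             (n \<cdot> inv_arrow C (split C [ctxobs C gi \<Delta>, [tyob C gi A], [tyob C gi B]])
                \<cdot> inv_arrow C (assoc C (ctxob C gi \<Delta>) (tyob C gi A) (tyob C gi B))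
                \<cdot> sym C (tyob C gi A \<odot> tyob C gi B) (ctxob C gi \<Delta>)
                \<cdot> (m \<otimes> idn C (ctxob C gi \<Delta>)) \<cdot> split_shuffle C gi E [\<Gamma>, \<Delta>])"
| Lam: "interp S C gi fi (\<Gamma> @ [(x, A)]) v B m
       \<Longrightarrow> interp S C gi fi \<Gamma> (Lam x A v) (Lolli A B)
             (curry C (ctxob C gi \<Gamma>) (tyob C gi A)
                (m \<cdot> inv_arrow C (split C [ctxobs C gi \<Gamma>, [tyob C gi A]])))"
| App: "\<lbrakk>interp S C gi fi \<Gamma> v (Lolli A B) m; interp S C gi fi \<Delta> w A n; E \<in> shuffles \<Gamma> \<Delta>; is_ctx E\<rbrakk>
       \<Longrightarrow> interp S C gi fi E (App v w) B
             (ev C (tyob C gi A) (tyob C gi B) \<cdot> (m \<otimes> n) \<cdot> split_shuffle C gi E [\<Gamma>, \<Delta>])"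

definition sem ::
  "('g, 'f) signature \<Rightarrow> ('o, 'm, 'x) autonomous_category_scheme \<Rightarrow> ('g \<Rightarrow> 'o) \<Rightarrow> ('f \<Rightarrow> 'm)
    \<Rightarrow> 'g ctx \<Rightarrow> ('g, 'f) tm \<Rightarrow> 'g ty \<Rightarrow> 'm" where
  "sem S C gi fi \<Gamma> v A = (THE m. interp S C gi fi \<Gamma> v A m)"

section \<open>Equations-in-context\<close>

text \<open>
  The equations of the calculus hold in every context in which both sides are typable, that is,
  in every permutation \<open>E\<close> of the contexts of the components.
\<close>

inductive lameq :: "('g, 'f) signature \<Rightarrow> 'g ctx \<Rightarrow> ('g, 'f) tm \<Rightarrow> ('g, 'f) tm \<Rightarrow> 'g ty \<Rightarrow> bool"
  for S :: "('g, 'f) signature" where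
  pm_beta:
    "\<lbrakk>typed S \<Gamma> v A; typed S \<Delta> w B; typed S (\<Theta> @ [(x, A), (y, B)]) u D;
      mset E = mset (\<Gamma> @ \<Delta> @ \<Theta>); is_ctx E\<rbrakk>
     \<Longrightarrow> lameq S E (Pm (Tens v w) x y u) (u[v//x, w//y]) D"
| pm_eta:
    "\<lbrakk>typed S \<Gamma> v (Tensor A B); typed S (\<Delta> @ [(z, Tensor A B)]) u D;
      is_ctx (\<Delta> @ [(x, A), (y, B)]); mset E = mset (\<Gamma> @ \<Delta>); is_ctx E\<rbrakk>
     \<Longrightarrow> lameq S E (Pm v x y (u[Tens (Var x) (Var y)//z])) (u[v//z]) D"
| to_beta:
    "typed S \<Gamma> v A \<Longrightarrow> lameq S \<Gamma> (To Star v) v A"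
| to_eta:
    "\<lbrakk>typed S \<Gamma> v Unit; typed S (\<Delta> @ [(z, Unit)]) w A; mset E = mset (\<Gamma> @ \<Delta>); is_ctx E\<rbrakk>
     \<Longrightarrow> lameq S E (To v (w[Star//z])) (w[v//z]) A"
| lam_beta:
    "\<lbrakk>typed S (\<Gamma> @ [(x, A)]) v B; typed S \<Delta> w A; mset E = mset (\<Gamma> @ \<Delta>); is_ctx E\<rbrakk>
     \<Longrightarrow> lameq S E (App (Lam x A v) w) (v[w//x]) B"
| lam_eta:
    "\<lbrakk>typed S \<Gamma> v (Lolli A B); is_ctx (\<Gamma> @ [(x, A)])\<rbrakk>
     \<Longrightarrow> lameq S \<Gamma> (Lam x A (App v (Var x))) v (Lolli A B)"
| to_comm:
    "\<lbrakk>typed S \<Gamma> v Unit; typed S \<Delta> w A; typed S (\<Theta> @ [(z, A)]) u B;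
      mset E = mset (\<Gamma> @ \<Delta> @ \<Theta>); is_ctx E\<rbrakk>
     \<Longrightarrow> lameq S E (u[To v w//z]) (To v (u[w//z])) B"
| pm_comm:
    "\<lbrakk>typed S \<Gamma> v (Tensor A B); typed S (\<Delta> @ [(x, A), (y, B)]) w D; typed S (\<Theta> @ [(z, D)]) u F;
      is_ctx (\<Theta> @ [(x, A), (y, B)]); mset E = mset (\<Gamma> @ \<Delta> @ \<Theta>); is_ctx E\<rbrakk>
     \<Longrightarrow> lameq S E (u[Pm v x y w//z]) (Pm v x y (u[w//z])) F"

text \<open>
  \<open>veq S B \<Gamma> v q w A\<close> is derivability of \<open>\<Gamma> \<rhd> v =\<^sub>q w : A\<close>. All labels are
  elements of the basis \<open>B\<close>: the side conditions ensure this where it does not follow from the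
  closure properties of \<open>B\<close>. Likewise, both sides are always typed.
\<close>

inductive veq ::
  "('g, 'f) signature \<Rightarrow> 'v::quantale set \<Rightarrow> 'g ctx \<Rightarrow> ('g, 'f) tm \<Rightarrow> 'v \<Rightarrow> ('g, 'f) tm \<Rightarrow> 'g ty \<Rightarrow> bool"
  for S :: "('g, 'f) signature" and B :: "'v set" where
  ax: "lameq S \<Gamma> v w A \<Longrightarrow> veq S B \<Gamma> v top w A"
| ax_sym: "lameq S \<Gamma> v w A \<Longrightarrow> veq S B \<Gamma> w top v A"
| refl: "typed S \<Gamma> v A \<Longrightarrow> veq S B \<Gamma> v top v A"
| trans: "\<lbrakk>veq S B \<Gamma> v q w A; veq S B \<Gamma> w r u A\<rbrakk> \<Longrightarrow> veq S B \<Gamma> v (q * r) u A"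
| weak: "\<lbrakk>veq S B \<Gamma> v q w A; r \<in> B; r \<le> q\<rbrakk> \<Longrightarrow> veq S B \<Gamma> v r w A"
| arch:
    "\<lbrakk>typed S \<Gamma> v A; typed S \<Gamma> w A; q \<in> B; \<forall>r\<in>B. r \<lless> q \<longrightarrow> veq S B \<Gamma> v r w A\<rbrakk>
     \<Longrightarrow> veq S B \<Gamma> v q w A"
| join:
    "\<lbrakk>typed S \<Gamma> v A; typed S \<Gamma> w A; finite Q; \<forall>q\<in>Q. veq S B \<Gamma> v q w A\<rbrakk>
     \<Longrightarrow> veq S B \<Gamma> v (Sup Q) w A"
| Op:
    "\<lbrakk>f \<in> ops S; length \<Gamma>s = length (args S f); length vs = length (args S f);
      length ws = length (args S f); length qs = length (args S f);
      \<forall>i<length (args S f). veq S B (\<Gamma>s ! i) (vs ! i) (qs ! i) (ws ! i) (args S f ! i);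
      E \<in> shuffless \<Gamma>s; is_ctx E\<rbrakk>
     \<Longrightarrow> veq S B E (Op f vs) (prod_list qs) (Op f ws) (res S f)"
| Tens:
    "\<lbrakk>veq S B \<Gamma> v q w A; veq S B \<Delta> v' r w' A'; E \<in> shuffles \<Gamma> \<Delta>; is_ctx E\<rbrakk>
     \<Longrightarrow> veq S B E (Tens v v') (q * r) (Tens w w') (Tensor A A')"
| Pm:
    "\<lbrakk>veq S B \<Gamma> v q w (Tensor A A'); veq S B (\<Delta> @ [(x, A), (y, A')]) v' r w' D;
      E \<in> shuffles \<Gamma> \<Delta>; is_ctx E\<rbrakk>
     \<Longrightarrow> veq S B E (Pm v x y v') (q * r) (Pm w x y w') D"
| To:
    "\<lbrakk>veq S B \<Gamma> v q w Unit; veq S B \<Delta> v' r w' A; E \<in> shuffles \<Gamma> \<Delta>; is_ctx E\<rbrakk>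
     \<Longrightarrow> veq S B E (To v v') (q * r) (To w w') A"
| App:
    "\<lbrakk>veq S B \<Gamma> v q w (Lolli A A'); veq S B \<Delta> v' r w' A; E \<in> shuffles \<Gamma> \<Delta>; is_ctx E\<rbrakk>
     \<Longrightarrow> veq S B E (App v v') (q * r) (App w w') A'"
| Subst:
    "\<lbrakk>veq S B (\<Gamma> @ [(x, A)]) v q w A'; veq S B \<Delta> v' r w' A; mset E = mset (\<Gamma> @ \<Delta>); is_ctx E\<rbrakk>
     \<Longrightarrow> veq S B E (v[v'//x]) (q * r) (w[w'//x]) A'"
| Lam:
    "veq S B (\<Gamma> @ [(x, A)]) v q w A' \<Longrightarrow> veq S B \<Gamma> (Lam x A v) q (Lam x A w) (Lolli A A')"
| Perm:
    "\<lbrakk>veq S B \<Gamma> v q w A; mset \<Delta> = mset \<Gamma>\<rbrakk> \<Longrightarrow> veq S B \<Delta> v q w A"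

end

theory Submission
  imports Defs
begin

text \<open>
  Morphisms between left-nested tensors form a strict symmetric monoidal category whose objects are
  lists of objects of \<open>C\<close>. There, moving the last variable of the target context to the end is a
  single block symmetry, and an induction based on naturality of the symmetry and the hexagon shows
  that \<^const>\<open>permute\<close> is functorial, compatible with concatenation and natural.

  Terms are interpreted in the strict category, splitting their contexts up to arbitrary
  permutations. This interpretation is closed under permuting the context, and one lemma on
  simultaneous substitution covers renaming of bound variables (hence uniqueness) as well as all
  substitutions in the equations. The equations of the calculus then become identities in the
  strict category, and the congruence rules say that composition, tensor and currying do not
  decrease distances.
\<close>

section \<open>Symmetric monoidal categories\<close>

text \<open>A strict arrow carries its source and target lists because an object of \<open>C\<close>
  does not remember how it was built as a tensor. Its tensor is that of \<open>C\<close> conjugated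
  by the splitting isomorphisms; once this is associative and unital, no associator or unitor
  appears in the later calculations. Strictness pays off because the given canonical maps are
  recursive, with separate branches for empty and one-element lists. Exchange must be free because
  equations and substitution are stated in every permutation of a context: both sides are computed
  in an order where no permutation intervenes, and then transported. The price is that the contexts
  of subterms are no longer fixed. Linearity compensates: the names of a context are exactly the
  free variables of its term, so up to bound names two derivations differ only by permutations
  inside the blocks, which functoriality absorbs. Uniqueness also matters for the congruence rules:
  transitivity glues two estimates at one middle morphism, and the rules on joins and on
  approximation from below collect several bounds on one fixed pair.\<close>

context category
begin

lemma homI: "\<lbrakk>f \<in> Ar C; src C f = X; tgt C f = Y\<rbrakk> \<Longrightarrow> f \<in> hom C X Y"
  by (simp add: hom_def)

lemma homD:
  assumes "f \<in> hom C X Y"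
  shows "f \<in> Ar C" "src C f = X" "tgt C f = Y" "X \<in> Ob C" "Y \<in> Ob C"
  using assms src_Ob tgt_Ob by (auto simp: hom_def)

lemma cmp_arr [simp]:
  assumes "f \<in> Ar C" "g \<in> Ar C" "tgt C f = src C g"
  shows "g \<cdot> f \<in> Ar C" "src C (g \<cdot> f) = src C f" "tgt C (g \<cdot> f) = tgt C g"
  using cmp_hom [of f "src C f" "tgt C f" g "tgt C g"] assms by (auto simp: hom_def)

lemma idn_arr [simp]:
  assumes "X \<in> Ob C"
  shows "idn C X \<in> Ar C" "src C (idn C X) = X" "tgt C (idn C X) = X"
  using idn_hom [OF assms] by (auto simp: hom_def)

declare src_Ob [simp] tgt_Ob [simp]

lemma cmp_idn' [simp]: "\<lbrakk>f \<in> Ar C; src C f = X\<rbrakk> \<Longrightarrow> f \<cdot> idn C X = f"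
  by (rule cmp_idn) (auto simp: hom_def)

lemma idn_cmp' [simp]: "\<lbrakk>f \<in> Ar C; tgt C f = X\<rbrakk> \<Longrightarrow> idn C X \<cdot> f = f"
  by (rule idn_cmp) (auto simp: hom_def)

lemma cmp_assoc [simp]:
  "\<lbrakk>f \<in> Ar C; g \<in> Ar C; h \<in> Ar C; tgt C f = src C g; tgt C g = src C h\<rbrakk>
    \<Longrightarrow> (h \<cdot> g) \<cdot> f = h \<cdot> (g \<cdot> f)"
  by (rule cmp_cmp) (auto simp: hom_def)

lemma is_iso_arr: "is_iso C f \<Longrightarrow> f \<in> Ar C"
  by (auto simp: is_iso_def inverse_arrows_def)

lemma inverse_arrows_unique:
  assumes "inverse_arrows C f g" "inverse_arrows C f h"
  shows "g = h"
proof -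
  have "g = g \<cdot> (f \<cdot> h)"
    using assms by (auto simp: inverse_arrows_def hom_def)
  also have "\<dots> = (g \<cdot> f) \<cdot> h"
    using assms by (subst cmp_assoc) (auto simp: inverse_arrows_def hom_def)
  also have "\<dots> = h"
    using assms by (auto simp: inverse_arrows_def hom_def)
  finally show ?thesis .
qed

lemma inverse_arrows_inv: "is_iso C f \<Longrightarrow> inverse_arrows C f (inv_arrow C f)"
  unfolding inv_arrow_def is_iso_def
  by (erule exE, rule theI, assumption) (rule inverse_arrows_unique)

lemma inv_arrow_eqI: "inverse_arrows C f g \<Longrightarrow> inv_arrow C f = g"
  by (metis inverse_arrows_inv inverse_arrows_unique is_iso_def)

lemma inv_arrow [simp]:
  assumes "is_iso C f"
  shows "inv_arrow C f \<in> Ar C" "src C (inv_arrow C f) = tgt C f" "tgt C (inv_arrow C f) = src C f"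
    "inv_arrow C f \<cdot> f = idn C (src C f)" "f \<cdot> inv_arrow C f = idn C (tgt C f)"
  using inverse_arrows_inv [OF assms] by (auto simp: inverse_arrows_def hom_def)

lemma inv_arrow_cancel [simp]:
  assumes "is_iso C f" "g \<in> Ar C"
  shows "tgt C g = src C f \<Longrightarrow> inv_arrow C f \<cdot> (f \<cdot> g) = g"
    "tgt C g = tgt C f \<Longrightarrow> f \<cdot> (inv_arrow C f \<cdot> g) = g"
  using assms is_iso_arr [of f] by (simp_all flip: cmp_assoc)

lemma is_isoI:
  assumes "f \<in> Ar C" "g \<in> Ar C" "src C g = tgt C f" "tgt C g = src C f"
    "g \<cdot> f = idn C (src C f)" "f \<cdot> g = idn C (tgt C f)"
  shows "is_iso C f" "inv_arrow C f = g"
proof -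
  have *: "inverse_arrows C f g"
    using assms by (auto simp: inverse_arrows_def hom_def)
  then show "is_iso C f" "inv_arrow C f = g"
    by (auto simp: is_iso_def inv_arrow_eqI)
qed

lemma is_iso_inv [simp]: "is_iso C f \<Longrightarrow> is_iso C (inv_arrow C f)"
  using is_iso_arr [of f] by (intro is_isoI(1) [of _ f]) auto

lemma is_iso_idn [simp]: "X \<in> Ob C \<Longrightarrow> is_iso C (idn C X)"
  and inv_idn [simp]: "X \<in> Ob C \<Longrightarrow> inv_arrow C (idn C X) = idn C X"
  using is_isoI [of "idn C X" "idn C X"] by auto

lemma is_iso_cmp [simp]:
  "\<lbrakk>is_iso C f; is_iso C g; tgt C f = src C g\<rbrakk> \<Longrightarrow> is_iso C (g \<cdot> f)"
  using is_iso_arr [of f] is_iso_arr [of g]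
  by (intro is_isoI(1) [of _ "inv_arrow C f \<cdot> inv_arrow C g"]) auto

lemma iso_cancel_right:
  assumes eq: "f \<cdot> h = g \<cdot> h"
    and "is_iso C h" "f \<in> Ar C" "g \<in> Ar C" "src C f = tgt C h" "src C g = tgt C h"
  shows "f = g"
proof -
  have "f = (f \<cdot> h) \<cdot> inv_arrow C h"
    using assms(2-6) is_iso_arr [of h] by simp
  also have "\<dots> = (g \<cdot> h) \<cdot> inv_arrow C h"
    by (simp only: eq)
  also have "\<dots> = g"
    using assms(2-6) is_iso_arr [of h] by simp
  finally show ?thesis .
qed

lemma iso_cancel_left:
  assumes eq: "h \<cdot> f = h \<cdot> g"
    and "is_iso C h" "f \<in> Ar C" "g \<in> Ar C" "tgt C f = src C h" "tgt C g = src C h"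
  shows "f = g"
proof -
  have "f = inv_arrow C h \<cdot> (h \<cdot> f)"
    using assms(2-6) is_iso_arr [of h] by simp
  also have "\<dots> = inv_arrow C h \<cdot> (h \<cdot> g)"
    by (simp only: eq)
  also have "\<dots> = g"
    using assms(2-6) is_iso_arr [of h] by simp
  finally show ?thesis .
qed

end

section \<open>Interchange, naturality and unit coherence\<close>

context symmetric_monoidal_category
begin

abbreviation \<I> where "\<I> \<equiv> unit_ob C"

lemmas [simp] = unit_Ob tens_Ob assoc_iso lun_iso run_iso

lemma tensm_arr [simp]:
  assumes "f \<in> Ar C" "g \<in> Ar C"
  shows "f \<otimes> g \<in> Ar C" "src C (f \<otimes> g) = src C f \<odot> src C g" "tgt C (f \<otimes> g) = tgt C f \<odot> tgt C g"
  using tensm_hom [of f "src C f" "tgt C f" g "src C g" "tgt C g"] assms by (auto simp: hom_def)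

lemma coherence_arr [simp]:
  "\<lbrakk>X \<in> Ob C; Y \<in> Ob C; Z \<in> Ob C\<rbrakk> \<Longrightarrow> assoc C X Y Z \<in> Ar C"
  "\<lbrakk>X \<in> Ob C; Y \<in> Ob C; Z \<in> Ob C\<rbrakk> \<Longrightarrow> src C (assoc C X Y Z) = (X \<odot> Y) \<odot> Z"
  "\<lbrakk>X \<in> Ob C; Y \<in> Ob C; Z \<in> Ob C\<rbrakk> \<Longrightarrow> tgt C (assoc C X Y Z) = X \<odot> (Y \<odot> Z)"
  "X \<in> Ob C \<Longrightarrow> lun C X \<in> Ar C" "X \<in> Ob C \<Longrightarrow> src C (lun C X) = \<I> \<odot> X"
  "X \<in> Ob C \<Longrightarrow> tgt C (lun C X) = X"
  "X \<in> Ob C \<Longrightarrow> run C X \<in> Ar C" "X \<in> Ob C \<Longrightarrow> src C (run C X) = X \<odot> \<I>"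
  "X \<in> Ob C \<Longrightarrow> tgt C (run C X) = X"
  "\<lbrakk>X \<in> Ob C; Y \<in> Ob C\<rbrakk> \<Longrightarrow> sym C X Y \<in> Ar C"
  "\<lbrakk>X \<in> Ob C; Y \<in> Ob C\<rbrakk> \<Longrightarrow> src C (sym C X Y) = X \<odot> Y"
  "\<lbrakk>X \<in> Ob C; Y \<in> Ob C\<rbrakk> \<Longrightarrow> tgt C (sym C X Y) = Y \<odot> X"
  using assoc_hom lun_hom run_hom sym_hom by (auto simp: hom_def)

lemma tensm_idn' [simp]: "\<lbrakk>X \<in> Ob C; Y \<in> Ob C\<rbrakk> \<Longrightarrow> idn C X \<otimes> idn C Y = idn C (X \<odot> Y)"
  by (rule tensm_idn)

lemma interchange [simp]:
  "\<lbrakk>f \<in> Ar C; g \<in> Ar C; f' \<in> Ar C; g' \<in> Ar C; tgt C f = src C g; tgt C f' = src C g'\<rbrakk>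
    \<Longrightarrow> (g \<otimes> g') \<cdot> (f \<otimes> f') = (g \<cdot> f) \<otimes> (g' \<cdot> f')"
  by (rule tensm_cmp [symmetric]) (auto simp: hom_def)

lemma interchange_cmp [simp]:
  "\<lbrakk>f \<in> Ar C; g \<in> Ar C; f' \<in> Ar C; g' \<in> Ar C; tgt C f = src C g; tgt C f' = src C g';
    h \<in> Ar C; tgt C h = src C f \<odot> src C f'\<rbrakk>
    \<Longrightarrow> (g \<otimes> g') \<cdot> ((f \<otimes> f') \<cdot> h) = ((g \<cdot> f) \<otimes> (g' \<cdot> f')) \<cdot> h"
  by (simp flip: cmp_assoc)

lemma is_iso_tensm [simp]: "\<lbrakk>is_iso C f; is_iso C g\<rbrakk> \<Longrightarrow> is_iso C (f \<otimes> g)"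
  and inv_tensm: "\<lbrakk>is_iso C f; is_iso C g\<rbrakk> \<Longrightarrow> inv_arrow C (f \<otimes> g) = inv_arrow C f \<otimes> inv_arrow C g"
  using is_isoI [of "f \<otimes> g" "inv_arrow C f \<otimes> inv_arrow C g"] is_iso_arr [of f] is_iso_arr [of g]
  by auto

lemma assoc_nat:
  "\<lbrakk>f \<in> Ar C; g \<in> Ar C; h \<in> Ar C; src C f = X; src C g = Y; src C h = Z;
    tgt C f = X'; tgt C g = Y'; tgt C h = Z'\<rbrakk>
    \<Longrightarrow> assoc C X' Y' Z' \<cdot> ((f \<otimes> g) \<otimes> h) = (f \<otimes> (g \<otimes> h)) \<cdot> assoc C X Y Z"
  by (rule assoc_natural) (auto simp: hom_def)

lemma lun_nat: "\<lbrakk>f \<in> Ar C; src C f = X; tgt C f = Y\<rbrakk> \<Longrightarrow> lun C Y \<cdot> (idn C \<I> \<otimes> f) = f \<cdot> lun C X"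
  by (rule lun_natural) (auto simp: hom_def)

lemma run_nat: "\<lbrakk>f \<in> Ar C; src C f = X; tgt C f = Y\<rbrakk> \<Longrightarrow> run C Y \<cdot> (f \<otimes> idn C \<I>) = f \<cdot> run C X"
  by (rule run_natural) (auto simp: hom_def)

lemma sym_nat:
  "\<lbrakk>f \<in> Ar C; g \<in> Ar C; src C f = X; src C g = Y; tgt C f = X'; tgt C g = Y'\<rbrakk>
    \<Longrightarrow> sym C X' Y' \<cdot> (f \<otimes> g) = (g \<otimes> f) \<cdot> sym C X Y"
  by (rule sym_natural) (auto simp: hom_def)

text \<open>Tensoring with the unit is naturally isomorphic to the identity functor through
  \<open>lun\<close>, and \<open>lun\<close> is invertible.\<close>

lemma unit_tensm_faithful:
  assumes [simp]: "f \<in> Ar C" "g \<in> Ar C" "src C f = X" "src C g = X" "tgt C f = Y" "tgt C g = Y"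
    and eq: "idn C \<I> \<otimes> f = idn C \<I> \<otimes> g"
  shows "f = g"
proof -
  have [simp]: "X \<in> Ob C"
    using src_Ob [of f] by simp
  have "f \<cdot> lun C X = g \<cdot> lun C X"
    using lun_nat [of f X Y] lun_nat [of g X Y] eq by (simp del: interchange)
  from iso_cancel_right [OF this] show ?thesis
    by simp
qed

lemma tensm_unit_faithful:
  assumes [simp]: "f \<in> Ar C" "g \<in> Ar C" "src C f = X" "src C g = X" "tgt C f = Y" "tgt C g = Y"
    and eq: "f \<otimes> idn C \<I> = g \<otimes> idn C \<I>"
  shows "f = g"
proof -
  have [simp]: "X \<in> Ob C"
    using src_Ob [of f] by simp
  have "f \<cdot> run C X = g \<cdot> run C X"
    using run_nat [of f X Y] run_nat [of g X Y] eq by (simp del: interchange)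
  from iso_cancel_right [OF this] show ?thesis
    by simp
qed

text \<open>Composites are kept nested to the right by \<open>simp\<close>, so a commuting square is
  often hidden inside a longer composite. This form applies it there, in front of a tail
  \<open>h\<close>.\<close>

lemma cmp_eq_cmp:
  assumes "p \<cdot> q = r \<cdot> s" "p \<in> Ar C" "q \<in> Ar C" "r \<in> Ar C" "s \<in> Ar C" "tgt C q = src C p"
    "tgt C s = src C r" "h \<in> Ar C" "tgt C h = src C q" "src C s = src C q"
  shows "p \<cdot> (q \<cdot> h) = r \<cdot> (s \<cdot> h)"
  using assms by (metis cmp_assoc)

text \<open>Kelly's derivation of a unit law that the axioms omit: after tensoring with
  \<open>\<I>\<close> on the left, the pentagon at \<open>\<I>, \<I>, X, Y\<close> and two triangles
  identify both sides up to the isomorphism \<open>?k\<close>.\<close>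

lemma lun_tens:
  assumes [simp]: "X \<in> Ob C" "Y \<in> Ob C"
  shows "lun C (X \<odot> Y) \<cdot> assoc C \<I> X Y = lun C X \<otimes> idn C Y"
proof (rule unit_tensm_faithful)
  let ?k = "assoc C \<I> (\<I> \<odot> X) Y \<cdot> (assoc C \<I> \<I> X \<otimes> idn C Y)"
  have *: "idn C \<I> \<otimes> (lun C (X \<odot> Y) \<cdot> assoc C \<I> X Y)
      = (idn C \<I> \<otimes> lun C (X \<odot> Y)) \<cdot> (idn C \<I> \<otimes> assoc C \<I> X Y)"
    by simp
  have "(idn C \<I> \<otimes> (lun C (X \<odot> Y) \<cdot> assoc C \<I> X Y)) \<cdot> ?k
      = (idn C \<I> \<otimes> lun C (X \<odot> Y)) \<cdot> ((idn C \<I> \<otimes> assoc C \<I> X Y) \<cdot> ?k)"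
    unfolding * by (subst cmp_assoc) auto
  also have "\<dots> = (idn C \<I> \<otimes> lun C (X \<odot> Y)) \<cdot> (assoc C \<I> \<I> (X \<odot> Y) \<cdot> assoc C (\<I> \<odot> \<I>) X Y)"
    by (simp only: pentagon assms unit_Ob)
  also have "\<dots> = (run C \<I> \<otimes> (idn C X \<otimes> idn C Y)) \<cdot> assoc C (\<I> \<odot> \<I>) X Y"
    using triangle [of \<I> "X \<odot> Y"] by (simp flip: cmp_assoc)
  also have "\<dots> = assoc C \<I> X Y \<cdot> ((run C \<I> \<otimes> idn C X) \<otimes> idn C Y)"
    by (rule assoc_nat [symmetric]) auto
  also have "\<dots> = assoc C \<I> X Y \<cdot> (((idn C \<I> \<otimes> lun C X) \<otimes> idn C Y) \<cdot> (assoc C \<I> \<I> X \<otimes> idn C Y))"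
    by (simp flip: triangle)
  also have "\<dots> = (idn C \<I> \<otimes> (lun C X \<otimes> idn C Y)) \<cdot> ?k"
    by (rule cmp_eq_cmp [OF assoc_nat]) auto
  finally show "idn C \<I> \<otimes> (lun C (X \<odot> Y) \<cdot> assoc C \<I> X Y) = idn C \<I> \<otimes> (lun C X \<otimes> idn C Y)"
    by (rule iso_cancel_right) auto
qed auto

text \<open>The mirror image, from the pentagon at \<open>X, Y, \<I>, \<I>\<close> and two
  triangles: tensoring with \<open>\<I>\<close> on the right is faithful, and the invertible
  \<open>?a\<close> is cancelled on the left.\<close>

lemma run_tens:
  assumes [simp]: "X \<in> Ob C" "Y \<in> Ob C"
  shows "(idn C X \<otimes> run C Y) \<cdot> assoc C X Y \<I> = run C (X \<odot> Y)"
proof (rule tensm_unit_faithful)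
  let ?a = "assoc C X Y \<I>"
  have "?a \<cdot> (((idn C X \<otimes> run C Y) \<cdot> ?a) \<otimes> idn C \<I>)
      = ?a \<cdot> (((idn C X \<otimes> run C Y) \<otimes> idn C \<I>) \<cdot> (?a \<otimes> idn C \<I>))"
    by simp
  also have "\<dots> = (idn C X \<otimes> (run C Y \<otimes> idn C \<I>)) \<cdot> (assoc C X (Y \<odot> \<I>) \<I> \<cdot> (?a \<otimes> idn C \<I>))"
    by (rule cmp_eq_cmp [OF assoc_nat]) auto
  also have "\<dots> = (idn C X \<otimes> (idn C Y \<otimes> lun C \<I>)) \<cdot>
      ((idn C X \<otimes> assoc C Y \<I> \<I>) \<cdot> (assoc C X (Y \<odot> \<I>) \<I> \<cdot> (?a \<otimes> idn C \<I>)))"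
    by (simp flip: triangle)
  also have "\<dots> = (idn C X \<otimes> (idn C Y \<otimes> lun C \<I>)) \<cdot> (assoc C X Y (\<I> \<odot> \<I>) \<cdot> assoc C (X \<odot> Y) \<I> \<I>)"
    by (simp only: pentagon assms unit_Ob)
  also have "\<dots> = ?a \<cdot> (((idn C X \<otimes> idn C Y) \<otimes> lun C \<I>) \<cdot> assoc C (X \<odot> Y) \<I> \<I>)"
    by (rule cmp_eq_cmp [OF assoc_nat [symmetric]]) auto
  also have "\<dots> = ?a \<cdot> (run C (X \<odot> Y) \<otimes> idn C \<I>)"
    by (simp add: triangle)
  finally show "((idn C X \<otimes> run C Y) \<cdot> ?a) \<otimes> idn C \<I> = run C (X \<odot> Y) \<otimes> idn C \<I>"
    by (rule iso_cancel_left) auto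
qed auto

text \<open>Naturality of \<open>lun\<close> at \<open>lun C \<I>\<close> itself gives
  \<open>idn C \<I> \<otimes> lun C \<I> = lun C (\<I> \<odot> \<I>)\<close>;
  \<open>lun_tens\<close> and the triangle then describe the same arrow.\<close>

lemma lun_unit: "lun C \<I> = run C \<I>"
proof (rule tensm_unit_faithful)
  have "lun C \<I> \<cdot> (idn C \<I> \<otimes> lun C \<I>) = lun C \<I> \<cdot> lun C (\<I> \<odot> \<I>)"
    by (rule lun_nat) auto
  from iso_cancel_left [OF this] have "idn C \<I> \<otimes> lun C \<I> = lun C (\<I> \<odot> \<I>)"
    by simp
  then show "lun C \<I> \<otimes> idn C \<I> = run C \<I> \<otimes> idn C \<I>"
    using triangle [of \<I> \<I>] lun_tens [of \<I> \<I>] by simp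
qed auto

end

text \<open>Both lists are stored because \<open>tenss C\<close> is not injective:
  \<open>[X \<odot> Y]\<close> and \<open>[X, Y]\<close> have the same tensor, and passing between
  them is later an arrow of its own.\<close>

datatype ('o, 'm) strict_arrow = Strict (sdom: "'o list") (mor: 'm) (scod: "'o list")

section \<open>Splitting a left-nested tensor into blocks\<close>

context symmetric_monoidal_category
begin

lemma tenss_simps [simp]:
  "tenss C [] = \<I>" "tenss C [X] = X" "Xs \<noteq> [] \<Longrightarrow> tenss C (Xs @ [Y]) = tenss C Xs \<odot> Y"
  by (auto simp: tenss_def split: list.split)

lemma tenss_Ob [simp]: "set Xs \<subseteq> Ob C \<Longrightarrow> tenss C Xs \<in> Ob C"
proof (induction Xs rule: rev_induct)
  case (snoc X Xs)
  then show ?case by (cases "Xs = []") auto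
qed simp

lemma split2_simps:
  "split2 C [] Ys = inv_arrow C (lun C (tenss C Ys))"
  "Xs \<noteq> [] \<Longrightarrow> split2 C Xs [] = inv_arrow C (run C (tenss C Xs))"
  "Xs \<noteq> [] \<Longrightarrow> split2 C Xs [Y] = idn C (tenss C Xs \<odot> Y)"
  "\<lbrakk>Xs \<noteq> []; Ys \<noteq> []\<rbrakk> \<Longrightarrow> split2 C Xs (Ys @ [Y]) =
     assoc C (tenss C Xs) (tenss C Ys) Y \<cdot> (split2 C Xs Ys \<otimes> idn C Y)"
  by (subst split2.simps; simp)+

text \<open>The definition tests \<open>Xs = []\<close> first and then uses \<open>lun\<close>; when
  both lists are empty the two unitors agree by \<open>lun_unit\<close>.\<close>

lemma split2_nil_right: "split2 C Xs [] = inv_arrow C (run C (tenss C Xs))"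
  by (cases "Xs = []") (simp_all add: split2_simps lun_unit)

lemma split2_iso:
  "set Xs \<subseteq> Ob C \<Longrightarrow> set Ys \<subseteq> Ob C \<Longrightarrow> is_iso C (split2 C Xs Ys) \<and>
    src C (split2 C Xs Ys) = tenss C (Xs @ Ys) \<and> tgt C (split2 C Xs Ys) = tenss C Xs \<odot> tenss C Ys"
proof (induction Ys rule: rev_induct)
  case Nil
  then show ?case
    by (cases "Xs = []") (auto simp: split2_simps)
next
  case (snoc Y Ys)
  then have Y [simp]: "Y \<in> Ob C" and Ys [simp]: "set Ys \<subseteq> Ob C" by auto
  note IH = snoc.IH [OF snoc.prems(1) Ys]
  show ?case
  proof (cases "Xs = [] \<or> Ys = []")
    case True
    then show ?thesis
      using snoc.prems by (cases "Xs = []"; cases "Ys = []") (auto simp: split2_simps)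
  next
    case False
    moreover have "tenss C (Xs @ Ys @ [Y]) = tenss C (Xs @ Ys) \<odot> Y"
      using False tenss_simps(3) [of "Xs @ Ys" Y] by simp
    ultimately show ?thesis
      using IH is_iso_arr [of "split2 C Xs Ys"] snoc.prems by (simp add: split2_simps)
  qed
qed

lemma split2_arr [simp]:
  assumes "set Xs \<subseteq> Ob C" "set Ys \<subseteq> Ob C"
  shows "is_iso C (split2 C Xs Ys)" "split2 C Xs Ys \<in> Ar C"
    "src C (split2 C Xs Ys) = tenss C (Xs @ Ys)"
    "tgt C (split2 C Xs Ys) = tenss C Xs \<odot> tenss C Ys"
  using split2_iso [OF assms] is_iso_arr by auto

lemma cmp_cong_right:
  assumes "p \<cdot> q = r" "p \<in> Ar C" "q \<in> Ar C" "tgt C q = src C p" "h \<in> Ar C" "tgt C h = src C q"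
  shows "p \<cdot> (q \<cdot> h) = r \<cdot> h"
  using assms by (metis cmp_assoc)

lemma iso_square:
  assumes eq: "p \<cdot> a = b \<cdot> q" and [simp]: "is_iso C p" "is_iso C q" "a \<in> Ar C" "b \<in> Ar C"
    "src C p = tgt C a" "src C q = src C a" "src C b = tgt C q" "tgt C p = tgt C b"
  shows "a \<cdot> inv_arrow C q = inv_arrow C p \<cdot> b"
proof -
  have [simp]: "p \<in> Ar C" "q \<in> Ar C"
    by (simp_all add: is_iso_arr)
  have "p \<cdot> (a \<cdot> inv_arrow C q) = b \<cdot> (q \<cdot> inv_arrow C q)"
    by (rule cmp_eq_cmp [OF eq]) auto
  also have "\<dots> = p \<cdot> (inv_arrow C p \<cdot> b)"
    by simp
  finally show ?thesis
    by (rule iso_cancel_left) auto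
qed

lemma inv_lun_nat:
  assumes [simp]: "f \<in> Ar C" "src C f = X" "tgt C f = Y"
  shows "(idn C \<I> \<otimes> f) \<cdot> inv_arrow C (lun C X) = inv_arrow C (lun C Y) \<cdot> f"
  using src_Ob [of f] tgt_Ob [of f] by (intro iso_square [OF lun_nat]) auto

lemma inv_run_nat:
  assumes [simp]: "f \<in> Ar C" "src C f = X" "tgt C f = Y"
  shows "(f \<otimes> idn C \<I>) \<cdot> inv_arrow C (run C X) = inv_arrow C (run C Y) \<cdot> f"
  using src_Ob [of f] tgt_Ob [of f] by (intro iso_square [OF run_nat]) auto

lemma iso_triangle:
  assumes "p \<cdot> a = q" "is_iso C p" "is_iso C q" "a \<in> Ar C" "src C p = tgt C a" "src C q = src C a"
    "tgt C p = tgt C q"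
  shows "a \<cdot> inv_arrow C q = inv_arrow C p"
  using iso_square [of p a "idn C (tgt C p)" q] assms is_iso_arr [of p] is_iso_arr [of q] by simp

lemma assoc_inv_lun:
  assumes "Y \<in> Ob C" "Z \<in> Ob C"
  shows "assoc C \<I> Y Z \<cdot> (inv_arrow C (lun C Y) \<otimes> idn C Z) = inv_arrow C (lun C (Y \<odot> Z))"
  using iso_triangle [OF lun_tens] assms by (simp add: inv_tensm)

lemma assoc_inv_run:
  assumes "X \<in> Ob C" "Y \<in> Ob C"
  shows "assoc C X Y \<I> \<cdot> inv_arrow C (run C (X \<odot> Y)) = idn C X \<otimes> inv_arrow C (run C Y)"
  using iso_triangle [OF run_tens] assms by (simp add: inv_tensm)

lemma assoc_inv_run_lun:
  assumes "X \<in> Ob C" "Z \<in> Ob C"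
  shows "assoc C X \<I> Z \<cdot> (inv_arrow C (run C X) \<otimes> idn C Z) = idn C X \<otimes> inv_arrow C (lun C Z)"
  using iso_triangle [OF triangle] assms by (simp add: inv_tensm)

text \<open>The coherence fact behind strict associativity: splitting into three blocks does not
  depend on which cut comes first. In the induction the last object of \<open>Zs\<close> is peeled
  off by the pentagon, while empty lists lead to the unit identities in their inverted
  forms.\<close>

lemma split2_assoc:
  assumes [simp]: "set Xs \<subseteq> Ob C" "set Ys \<subseteq> Ob C"
  shows "set Zs \<subseteq> Ob C \<Longrightarrow>
    assoc C (tenss C Xs) (tenss C Ys) (tenss C Zs) \<cdot>
      ((split2 C Xs Ys \<otimes> idn C (tenss C Zs)) \<cdot> split2 C (Xs @ Ys) Zs)
    = (idn C (tenss C Xs) \<otimes> split2 C Ys Zs) \<cdot> split2 C Xs (Ys @ Zs)"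
proof (induction Zs rule: rev_induct)
  case Nil
  show ?case
  proof (cases "Xs = []")
    case True
    then show ?thesis
      by (simp add: split2_simps inv_lun_nat) (simp add: assoc_inv_lun cmp_cong_right [OF assoc_inv_lun])
  next
    case False
    have "assoc C (tenss C Xs) (tenss C Ys) \<I> \<cdot> ((split2 C Xs Ys \<otimes> idn C \<I>) \<cdot> inv_arrow C (run C (tenss C (Xs @ Ys))))
        = assoc C (tenss C Xs) (tenss C Ys) \<I> \<cdot> (inv_arrow C (run C (tenss C Xs \<odot> tenss C Ys)) \<cdot> split2 C Xs Ys)"
      by (subst inv_run_nat) auto
    also have "\<dots> = (idn C (tenss C Xs) \<otimes> inv_arrow C (run C (tenss C Ys))) \<cdot> split2 C Xs Ys"
      by (rule cmp_cong_right [OF assoc_inv_run]) auto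
    finally show ?thesis
      using False by (simp add: split2_nil_right)
  qed
next
  case (snoc Z Zs)
  then have Z [simp]: "Z \<in> Ob C" and Zs [simp]: "set Zs \<subseteq> Ob C" by auto
  let ?X = "tenss C Xs" and ?Y = "tenss C Ys" and ?Z = "tenss C Zs"
  consider "Xs = []" | "Xs \<noteq> []" "Ys = []" | "Xs \<noteq> []" "Ys \<noteq> []" "Zs = []"
    | "Xs \<noteq> []" "Ys \<noteq> []" "Zs \<noteq> []" by blast
  then show ?case
  proof cases
    case 1
    then show ?thesis
      by (simp add: split2_simps inv_lun_nat) (simp add: assoc_inv_lun cmp_cong_right [OF assoc_inv_lun])
  next
    case 2
    then show ?thesis
      by (simp add: split2_simps(1) split2_nil_right) (simp add: cmp_cong_right [OF assoc_inv_run_lun])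
  next
    case 3
    then show ?thesis
      by (simp add: split2_simps)
  next
    case 4
    let ?s = "split2 C"
    \<comment> \<open>Appends are normalised to the right, so the clauses for a last element do not
      fire on lists such as \<open>Xs @ Ys @ [Z]\<close> and are instantiated by hand.\<close>
    have XY: "tenss C (Xs @ Ys @ [Z]) = tenss C (Xs @ Ys) \<odot> Z"
      "tenss C (Xs @ Ys @ Zs @ [Z]) = tenss C (Xs @ Ys @ Zs) \<odot> Z"
      "tenss C (Ys @ Zs @ [Z]) = tenss C (Ys @ Zs) \<odot> Z"
      "?s Xs (Ys @ Zs @ [Z]) = assoc C ?X (tenss C (Ys @ Zs)) Z \<cdot> (?s Xs (Ys @ Zs) \<otimes> idn C Z)"
      using 4 tenss_simps(3) [of "Xs @ Ys" Z] tenss_simps(3) [of "Xs @ Ys @ Zs" Z]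
        tenss_simps(3) [of "Ys @ Zs" Z] split2_simps(4) [of Xs "Ys @ Zs" Z] by auto
    have "assoc C ?X ?Y (?Z \<odot> Z) \<cdot> ((?s Xs Ys \<otimes> (idn C ?Z \<otimes> idn C Z)) \<cdot>
            (assoc C (tenss C (Xs @ Ys)) ?Z Z \<cdot> (?s (Xs @ Ys) Zs \<otimes> idn C Z)))
        = assoc C ?X ?Y (?Z \<odot> Z) \<cdot> (assoc C (?X \<odot> ?Y) ?Z Z \<cdot>
            (((?s Xs Ys \<otimes> idn C ?Z) \<otimes> idn C Z) \<cdot> (?s (Xs @ Ys) Zs \<otimes> idn C Z)))"
      by (subst cmp_eq_cmp [OF assoc_nat [symmetric]]) auto
    also have "\<dots> = (assoc C ?X ?Y (?Z \<odot> Z) \<cdot> assoc C (?X \<odot> ?Y) ?Z Z) \<cdot>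
            ((((?s Xs Ys \<otimes> idn C ?Z) \<cdot> ?s (Xs @ Ys) Zs) \<otimes> idn C Z))"
      by (simp del: tensm_idn')
    also have "\<dots> = ((idn C ?X \<otimes> assoc C ?Y ?Z Z) \<cdot> assoc C ?X (?Y \<odot> ?Z) Z \<cdot> (assoc C ?X ?Y ?Z \<otimes> idn C Z)) \<cdot>
            ((((?s Xs Ys \<otimes> idn C ?Z) \<cdot> ?s (Xs @ Ys) Zs) \<otimes> idn C Z))"
      by (subst pentagon) auto
    also have "\<dots> = (idn C ?X \<otimes> assoc C ?Y ?Z Z) \<cdot> (assoc C ?X (?Y \<odot> ?Z) Z \<cdot>
            ((assoc C ?X ?Y ?Z \<cdot> ((?s Xs Ys \<otimes> idn C ?Z) \<cdot> ?s (Xs @ Ys) Zs)) \<otimes> idn C Z))"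
      by simp
    also have "\<dots> = (idn C ?X \<otimes> assoc C ?Y ?Z Z) \<cdot> (assoc C ?X (?Y \<odot> ?Z) Z \<cdot>
            (((idn C ?X \<otimes> ?s Ys Zs) \<otimes> idn C Z) \<cdot> (?s Xs (Ys @ Zs) \<otimes> idn C Z)))"
      unfolding snoc.IH [OF Zs] by simp
    also have "\<dots> = (idn C ?X \<otimes> assoc C ?Y ?Z Z) \<cdot> ((idn C ?X \<otimes> (?s Ys Zs \<otimes> idn C Z)) \<cdot>
            (assoc C ?X (tenss C (Ys @ Zs)) Z \<cdot> (?s Xs (Ys @ Zs) \<otimes> idn C Z)))"
      by (subst cmp_eq_cmp [OF assoc_nat]) auto
    finally show ?thesis
      using 4 by (simp add: split2_simps(4) XY)
  qed
qed

end

section \<open>Strictification\<close>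

context symmetric_monoidal_category
begin

abbreviation objs :: "'o list \<Rightarrow> bool" where "objs Xs \<equiv> set Xs \<subseteq> Ob C"

definition arr :: "('o, 'm) strict_arrow \<Rightarrow> bool" where
  "arr f \<longleftrightarrow> objs (sdom f) \<and> objs (scod f) \<and> mor f \<in> hom C (tenss C (sdom f)) (tenss C (scod f))"

definition ide :: "'o list \<Rightarrow> ('o, 'm) strict_arrow" where
  "ide Xs = Strict Xs (idn C (tenss C Xs)) Xs"

definition comp :: "('o, 'm) strict_arrow \<Rightarrow> ('o, 'm) strict_arrow \<Rightarrow> ('o, 'm) strict_arrow"
    (infixr "\<bullet>" 65) where
  "g \<bullet> f = Strict (sdom f) (mor g \<cdot> mor f) (scod g)"

definition ten :: "('o, 'm) strict_arrow \<Rightarrow> ('o, 'm) strict_arrow \<Rightarrow> ('o, 'm) strict_arrow"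
    (infixr "\<star>" 70) where
  "f \<star> g = Strict (sdom f @ sdom g)
     (inv_arrow C (split2 C (scod f) (scod g)) \<cdot> (mor f \<otimes> mor g) \<cdot> split2 C (sdom f) (sdom g))
     (scod f @ scod g)"

definition swap :: "'o list \<Rightarrow> 'o list \<Rightarrow> ('o, 'm) strict_arrow" where
  "swap Xs Ys = Strict (Xs @ Ys)
     (inv_arrow C (split2 C Ys Xs) \<cdot> sym C (tenss C Xs) (tenss C Ys) \<cdot> split2 C Xs Ys) (Ys @ Xs)"

lemma strict_eqI:
  "\<lbrakk>sdom f = sdom g; scod f = scod g; mor f = mor g\<rbrakk> \<Longrightarrow> f = g"
  by (simp add: strict_arrow.expand)

lemma arrD [simp]:
  assumes "arr f"
  shows "objs (sdom f)" "objs (scod f)" "mor f \<in> Ar C"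
    "src C (mor f) = tenss C (sdom f)" "tgt C (mor f) = tenss C (scod f)"
  using assms by (auto simp: arr_def hom_def)

lemma arrI:
  assumes "objs Xs" "objs Ys" "m \<in> Ar C" "src C m = tenss C Xs" "tgt C m = tenss C Ys"
  shows "arr (Strict Xs m Ys)"
  using assms by (auto simp: arr_def hom_def)

lemma strict_dom_cod [simp]:
  "sdom (ide Xs) = Xs" "scod (ide Xs) = Xs"
  "sdom (g \<bullet> f) = sdom f" "scod (g \<bullet> f) = scod g"
  "sdom (f \<star> g) = sdom f @ sdom g" "scod (f \<star> g) = scod f @ scod g"
  "sdom (swap Xs Ys) = Xs @ Ys" "scod (swap Xs Ys) = Ys @ Xs"
  by (simp_all add: ide_def comp_def ten_def swap_def)

lemma mor_simps [simp]: "mor (ide Xs) = idn C (tenss C Xs)" "mor (g \<bullet> f) = mor g \<cdot> mor f"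
  by (simp_all add: ide_def comp_def)

lemma arr_ide [simp]: "objs Xs \<Longrightarrow> arr (ide Xs)"
  unfolding ide_def by (rule arrI) auto

lemma arr_comp [simp]: "\<lbrakk>arr f; arr g; scod f = sdom g\<rbrakk> \<Longrightarrow> arr (g \<bullet> f)"
  unfolding comp_def by (rule arrI) auto

lemma arr_ten [simp]: "\<lbrakk>arr f; arr g\<rbrakk> \<Longrightarrow> arr (f \<star> g)"
  unfolding ten_def by (rule arrI) auto

lemma arr_swap [simp]: "\<lbrakk>objs Xs; objs Ys\<rbrakk> \<Longrightarrow> arr (swap Xs Ys)"
  unfolding swap_def by (rule arrI) auto

lemma comp_ide [simp]: "\<lbrakk>arr f; sdom f = Xs\<rbrakk> \<Longrightarrow> f \<bullet> ide Xs = f"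
  by (rule strict_eqI) (auto simp: comp_def ide_def)

lemma ide_comp [simp]: "\<lbrakk>arr f; scod f = Xs\<rbrakk> \<Longrightarrow> ide Xs \<bullet> f = f"
  by (rule strict_eqI) (auto simp: comp_def ide_def)

lemma comp_assoc:
  "\<lbrakk>arr f; arr g; arr h; scod f = sdom g; scod g = sdom h\<rbrakk> \<Longrightarrow> (h \<bullet> g) \<bullet> f = h \<bullet> g \<bullet> f"
  by (rule strict_eqI) (auto simp: comp_def)

lemma split2_ten:
  assumes "arr f" "arr g"
  shows "split2 C (scod f) (scod g) \<cdot> mor (f \<star> g) = (mor f \<otimes> mor g) \<cdot> split2 C (sdom f) (sdom g)"
  using assms by (simp add: ten_def)

lemma split2_swap:
  assumes "objs Xs" "objs Ys"
  shows "split2 C Ys Xs \<cdot> mor (swap Xs Ys) = sym C (tenss C Xs) (tenss C Ys) \<cdot> split2 C Xs Ys"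
  using assms by (simp add: swap_def)

lemma ten_comp:
  "\<lbrakk>arr f; arr g; arr f'; arr g'; scod f = sdom g; scod f' = sdom g'\<rbrakk>
    \<Longrightarrow> (g \<star> g') \<bullet> (f \<star> f') = (g \<bullet> f) \<star> (g' \<bullet> f')"
  by (rule strict_eqI) (auto simp: comp_def ten_def)

lemma ten_ide [simp]: "\<lbrakk>objs Xs; objs Ys\<rbrakk> \<Longrightarrow> ide Xs \<star> ide Ys = ide (Xs @ Ys)"
  by (rule strict_eqI) (auto simp: ide_def ten_def)

lemma ide_nil_ten [simp]:
  assumes "arr f"
  shows "ide [] \<star> f = f"
proof (rule strict_eqI)
  have "inv_arrow C (inv_arrow C (lun C X)) = lun C X" if "X \<in> Ob C" for X
    using that by (intro is_isoI(2)) auto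
  moreover have "lun C (tenss C (scod f)) \<cdot> ((idn C \<I> \<otimes> mor f) \<cdot> inv_arrow C (lun C (tenss C (sdom f)))) = mor f"
    using assms by (subst inv_lun_nat) auto
  ultimately show "mor (ide [] \<star> f) = mor f"
    using assms by (simp add: ten_def ide_def split2_simps(1))
qed auto

lemma ten_ide_nil [simp]:
  assumes "arr f"
  shows "f \<star> ide [] = f"
proof (rule strict_eqI)
  have "inv_arrow C (inv_arrow C (run C X)) = run C X" if "X \<in> Ob C" for X
    using that by (intro is_isoI(2)) auto
  moreover have "run C (tenss C (scod f)) \<cdot> ((mor f \<otimes> idn C \<I>) \<cdot> inv_arrow C (run C (tenss C (sdom f)))) = mor f"
    using assms by (subst inv_run_nat) auto
  ultimately show "mor (f \<star> ide []) = mor f"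
    using assms by (simp add: ten_def ide_def split2_nil_right)
qed auto

text \<open>A fixed reference splitting into three blocks. Both bracketings of a triple
  \<open>ten\<close> agree after it, the right one by this definition and the left one through
  \<open>split3_assoc\<close>; cancelling it gives \<open>ten_assoc\<close>.\<close>

definition split3 :: "'o list \<Rightarrow> 'o list \<Rightarrow> 'o list \<Rightarrow> 'm" where
  "split3 Xs Ys Zs = (idn C (tenss C Xs) \<otimes> split2 C Ys Zs) \<cdot> split2 C Xs (Ys @ Zs)"

lemma split3_arr [simp]:
  assumes "objs Xs" "objs Ys" "objs Zs"
  shows "split3 Xs Ys Zs \<in> Ar C" "src C (split3 Xs Ys Zs) = tenss C (Xs @ Ys @ Zs)"
    "tgt C (split3 Xs Ys Zs) = tenss C Xs \<odot> (tenss C Ys \<odot> tenss C Zs)" "is_iso C (split3 Xs Ys Zs)"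
  using assms by (simp_all add: split3_def)

lemma split3_assoc:
  "\<lbrakk>objs Xs; objs Ys; objs Zs\<rbrakk> \<Longrightarrow> split3 Xs Ys Zs =
    assoc C (tenss C Xs) (tenss C Ys) (tenss C Zs) \<cdot>
      ((split2 C Xs Ys \<otimes> idn C (tenss C Zs)) \<cdot> split2 C (Xs @ Ys) Zs)"
  unfolding split3_def by (rule split2_assoc [symmetric])

lemma split3_ten_right:
  assumes [simp]: "arr f" "arr g" "arr h"
  shows "split3 (scod f) (scod g) (scod h) \<cdot> mor (f \<star> g \<star> h)
    = (mor f \<otimes> (mor g \<otimes> mor h)) \<cdot> split3 (sdom f) (sdom g) (sdom h)"
proof -
  have "split3 (scod f) (scod g) (scod h) \<cdot> mor (f \<star> g \<star> h)
      = (idn C (tenss C (scod f)) \<otimes> split2 C (scod g) (scod h)) \<cdot>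
        (split2 C (scod f) (scod (g \<star> h)) \<cdot> mor (f \<star> (g \<star> h)))"
    using arrD [of "f \<star> g \<star> h"] by (simp add: split3_def del: arrD)
  also have "\<dots> = (mor f \<otimes> (split2 C (scod g) (scod h) \<cdot> mor (g \<star> h))) \<cdot> split2 C (sdom f) (sdom g @ sdom h)"
    using arrD [of "g \<star> h"] by (subst split2_ten) auto
  also have "\<dots> = (mor f \<otimes> (mor g \<otimes> mor h)) \<cdot> split3 (sdom f) (sdom g) (sdom h)"
    by (simp add: split2_ten split3_def)
  finally show ?thesis .
qed

lemma split3_ten_left:
  assumes [simp]: "arr f" "arr g" "arr h"
  shows "split3 (scod f) (scod g) (scod h) \<cdot> mor ((f \<star> g) \<star> h)
    = (mor f \<otimes> (mor g \<otimes> mor h)) \<cdot> split3 (sdom f) (sdom g) (sdom h)"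
proof -
  let ?a = "assoc C (tenss C (scod f)) (tenss C (scod g)) (tenss C (scod h))"
  have "split3 (scod f) (scod g) (scod h) \<cdot> mor ((f \<star> g) \<star> h)
      = ?a \<cdot> ((split2 C (scod f) (scod g) \<otimes> idn C (tenss C (scod h))) \<cdot>
          (split2 C (scod (f \<star> g)) (scod h) \<cdot> mor ((f \<star> g) \<star> h)))"
    using arrD [of "(f \<star> g) \<star> h"] by (simp add: split3_assoc del: arrD)
  also have "\<dots> = ?a \<cdot> (((split2 C (scod f) (scod g) \<cdot> mor (f \<star> g)) \<otimes> mor h) \<cdot> split2 C (sdom f @ sdom g) (sdom h))"
    using arrD [of "f \<star> g"] by (subst split2_ten) auto
  also have "\<dots> = ?a \<cdot> (((mor f \<otimes> mor g) \<otimes> mor h) \<cdot>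
      ((split2 C (sdom f) (sdom g) \<otimes> idn C (tenss C (sdom h))) \<cdot> split2 C (sdom f @ sdom g) (sdom h)))"
    by (simp add: split2_ten)
  also have "\<dots> = (mor f \<otimes> (mor g \<otimes> mor h)) \<cdot> split3 (sdom f) (sdom g) (sdom h)"
    unfolding split3_assoc [OF arrD(1) arrD(1) arrD(1), OF assms]
    by (rule cmp_eq_cmp [OF assoc_nat]) auto
  finally show ?thesis .
qed

lemma ten_assoc [simp]:
  assumes [simp]: "arr f" "arr g" "arr h"
  shows "(f \<star> g) \<star> h = f \<star> g \<star> h"
proof (rule strict_eqI)
  have *: "split3 (scod f) (scod g) (scod h) \<cdot> mor ((f \<star> g) \<star> h)
    = split3 (scod f) (scod g) (scod h) \<cdot> mor (f \<star> g \<star> h)"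
    by (simp only: split3_ten_left split3_ten_right assms)
  show "mor ((f \<star> g) \<star> h) = mor (f \<star> g \<star> h)"
    by (rule iso_cancel_left [OF *]) auto
qed auto

lemma swap_natural:
  assumes [simp]: "arr f" "arr g"
  shows "swap (scod f) (scod g) \<bullet> (f \<star> g) = (g \<star> f) \<bullet> swap (sdom f) (sdom g)"
proof (rule strict_eqI)
  let ?s = "split2 C (scod g) (scod f)"
  have "?s \<cdot> mor (swap (scod f) (scod g) \<bullet> (f \<star> g))
      = (sym C (tenss C (scod f)) (tenss C (scod g)) \<cdot> split2 C (scod f) (scod g)) \<cdot> mor (f \<star> g)"
    by (simp add: cmp_cong_right [OF split2_swap])
  also have "\<dots> = sym C (tenss C (scod f)) (tenss C (scod g)) \<cdot> ((mor f \<otimes> mor g) \<cdot> split2 C (sdom f) (sdom g))"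
    by (simp add: split2_ten)
  also have "\<dots> = (mor g \<otimes> mor f) \<cdot> (sym C (tenss C (sdom f)) (tenss C (sdom g)) \<cdot> split2 C (sdom f) (sdom g))"
    by (rule cmp_eq_cmp [OF sym_nat]) auto
  also have "\<dots> = (mor g \<otimes> mor f) \<cdot> (split2 C (sdom g) (sdom f) \<cdot> mor (swap (sdom f) (sdom g)))"
    by (simp add: split2_swap)
  also have "\<dots> = ?s \<cdot> (mor (g \<star> f) \<cdot> mor (swap (sdom f) (sdom g)))"
    by (rule cmp_eq_cmp [OF split2_ten [symmetric]]) auto
  finally show "mor (swap (scod f) (scod g) \<bullet> (f \<star> g)) = mor ((g \<star> f) \<bullet> swap (sdom f) (sdom g))"
    unfolding mor_simps by (rule iso_cancel_left) auto
qed auto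

lemma swap_swap:
  assumes [simp]: "objs Xs" "objs Ys"
  shows "swap Ys Xs \<bullet> swap Xs Ys = ide (Xs @ Ys)"
  by (rule strict_eqI)
    (auto simp: comp_def swap_def ide_def cmp_cong_right [OF sym_sym])

text \<open>The hexagon with the associators absorbed. Both sides are followed by the isomorphism
  \<open>split3 Ys Zs Xs\<close>; the right one unfolds to one side of the hexagon of
  \<open>C\<close>, and the left one is the other side by naturality of \<open>sym\<close> along
  \<open>split2 C Ys Zs\<close>.\<close>

lemma swap_append_right:
  assumes [simp]: "objs Xs" "objs Ys" "objs Zs"
  shows "swap Xs (Ys @ Zs) = (ide Ys \<star> swap Xs Zs) \<bullet> (swap Xs Ys \<star> ide Zs)"
proof (rule strict_eqI)
  let ?X = "tenss C Xs" and ?Y = "tenss C Ys" and ?Z = "tenss C Zs"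
  let ?f = "swap Xs Ys \<star> ide Zs" and ?g = "ide Ys \<star> swap Xs Zs" and ?h = "swap Xs (Ys @ Zs)"
  have "split3 Ys Zs Xs \<cdot> (mor ?g \<cdot> mor ?f)
      = (idn C ?Y \<otimes> split2 C Zs Xs) \<cdot> ((split2 C (scod (ide Ys)) (scod (swap Xs Zs)) \<cdot> mor ?g) \<cdot> mor ?f)"
    by (simp add: split3_def)
  also have "\<dots> = ((idn C ?Y \<otimes> (split2 C Zs Xs \<cdot> mor (swap Xs Zs))) \<cdot> split2 C Ys (Xs @ Zs)) \<cdot> mor ?f"
    by (subst split2_ten) auto
  also have "\<dots> = (idn C ?Y \<otimes> sym C ?X ?Z) \<cdot> (split3 Ys Xs Zs \<cdot> mor ?f)"
    by (simp add: split2_swap split3_def)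
  also have "split3 Ys Xs Zs \<cdot> mor ?f = (assoc C ?Y ?X ?Z \<cdot> (split2 C Ys Xs \<otimes> idn C ?Z)) \<cdot>
      (split2 C (scod (swap Xs Ys)) (scod (ide Zs)) \<cdot> mor ?f)"
    by (simp add: split3_assoc)
  also have "\<dots> = assoc C ?Y ?X ?Z \<cdot> (((split2 C Ys Xs \<cdot> mor (swap Xs Ys)) \<otimes> idn C ?Z) \<cdot> split2 C (Xs @ Ys) Zs)"
    by (subst split2_ten) auto
  also have "\<dots> = (assoc C ?Y ?X ?Z \<cdot> (sym C ?X ?Y \<otimes> idn C ?Z)) \<cdot>
      ((split2 C Xs Ys \<otimes> idn C ?Z) \<cdot> split2 C (Xs @ Ys) Zs)"
    by (simp add: split2_swap)
  also have "(idn C ?Y \<otimes> sym C ?X ?Z) \<cdot> \<dots> = ((idn C ?Y \<otimes> sym C ?X ?Z) \<cdot> assoc C ?Y ?X ?Z \<cdot> (sym C ?X ?Y \<otimes> idn C ?Z)) \<cdot>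
      ((split2 C Xs Ys \<otimes> idn C ?Z) \<cdot> split2 C (Xs @ Ys) Zs)"
    by simp
  also have "\<dots> = (assoc C ?Y ?Z ?X \<cdot> sym C ?X (?Y \<odot> ?Z) \<cdot> assoc C ?X ?Y ?Z) \<cdot>
      ((split2 C Xs Ys \<otimes> idn C ?Z) \<cdot> split2 C (Xs @ Ys) Zs)"
    by (simp only: hexagon tenss_Ob assms)
  also have "\<dots> = assoc C ?Y ?Z ?X \<cdot> (sym C ?X (?Y \<odot> ?Z) \<cdot> split3 Xs Ys Zs)"
    by (simp add: split3_assoc)
  also have "\<dots> = assoc C ?Y ?Z ?X \<cdot> ((split2 C Ys Zs \<otimes> idn C ?X) \<cdot>
      (sym C ?X (tenss C (Ys @ Zs)) \<cdot> split2 C Xs (Ys @ Zs)))"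
    unfolding split3_def by (subst cmp_eq_cmp [OF sym_nat]) auto
  also have "\<dots> = split3 Ys Zs Xs \<cdot> mor ?h"
    by (simp add: split2_swap [symmetric] split3_assoc)
  finally show "mor ?h = mor (?g \<bullet> ?f)"
    unfolding mor_simps by (rule iso_cancel_left [symmetric]) auto
qed auto

end

section \<open>Coherence for permutations\<close>

context symmetric_monoidal_category
begin

abbreviation obs :: "('e \<Rightarrow> 'o) \<Rightarrow> 'e list \<Rightarrow> bool" where
  "obs ob E \<equiv> ob ` set E \<subseteq> Ob C"

lemma ten_comp_ide:
  "\<lbrakk>arr f; arr g; scod f = sdom g; objs Xs\<rbrakk> \<Longrightarrow> (g \<bullet> f) \<star> ide Xs = (g \<star> ide Xs) \<bullet> (f \<star> ide Xs)"
  by (subst ten_comp) auto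

lemma ide_ten_comp:
  "\<lbrakk>arr f; arr g; scod f = sdom g; objs Xs\<rbrakk> \<Longrightarrow> ide Xs \<star> (g \<bullet> f) = (ide Xs \<star> g) \<bullet> (ide Xs \<star> f)"
  by (subst ten_comp) auto

lemma ide_ide_ten: "\<lbrakk>arr f; objs Xs; objs Ys\<rbrakk> \<Longrightarrow> ide Xs \<star> ide Ys \<star> f = ide (Xs @ Ys) \<star> f"
  by (subst ten_assoc [symmetric]) auto

text \<open>Used as rewrite rules to push composition out of tensors with identities and to merge
  these identities, so that composites of whiskered arrows are compared factor by factor.\<close>

lemmas whisker = ten_comp_ide ide_ten_comp comp_assoc ide_ide_ten

lemma slide:
  assumes [simp]: "arr f" "arr g"
  shows "(ide (scod f) \<star> g) \<bullet> (f \<star> ide (sdom g)) = f \<star> g"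
    "(f \<star> ide (scod g)) \<bullet> (ide (sdom f) \<star> g) = f \<star> g"
  by (subst ten_comp; simp)+

lemma comp_cancel_left:
  "\<lbrakk>g \<bullet> f = ide Xs; arr f; arr g; arr h; scod f = sdom g; scod h = sdom f; sdom f = Xs\<rbrakk>
    \<Longrightarrow> g \<bullet> f \<bullet> h = h"
  by (simp flip: comp_assoc)

text \<open>By the hexagon at empty lists this symmetry is idempotent, and by
  \<open>swap_swap\<close> it has a left inverse; an idempotent with a left inverse is an
  identity.\<close>

lemma swap_nil_right [simp]:
  assumes [simp]: "objs Xs"
  shows "swap Xs [] = ide Xs"
proof -
  let ?s = "swap Xs []"
  have idem: "?s = ?s \<bullet> ?s"
    using swap_append_right [of Xs "[]" "[]"] by simp
  have inv: "swap [] Xs \<bullet> ?s = ide Xs"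
    using swap_swap [of Xs "[]"] by simp
  have "?s = swap [] Xs \<bullet> ?s \<bullet> ?s"
    by (subst comp_cancel_left [OF inv]) auto
  also have "\<dots> = ide Xs"
    by (simp only: idem [symmetric] inv)
  finally show ?thesis .
qed

lemma swap_nil_left [simp]:
  assumes "objs Xs"
  shows "swap [] Xs = ide Xs"
proof -
  have "ide Xs \<bullet> swap [] Xs = ide Xs"
    using swap_swap [of "[]" Xs] assms by simp
  then show ?thesis
    using assms by simp
qed

text \<open>The other hexagon is not an axiom. It follows by inverting the first one:
  \<open>swap Zs (Xs @ Ys)\<close> is inverse to both sides.\<close>

lemma swap_append_left:
  assumes [simp]: "objs Xs" "objs Ys" "objs Zs"
  shows "swap (Xs @ Ys) Zs = (swap Xs Zs \<star> ide Ys) \<bullet> (ide Xs \<star> swap Ys Zs)"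
proof -
  let ?r = "(swap Xs Zs \<star> ide Ys) \<bullet> (ide Xs \<star> swap Ys Zs)"
  have 1: "(swap Zs Xs \<star> ide Ys) \<bullet> (swap Xs Zs \<star> ide Ys) = ide (Xs @ Zs @ Ys)"
    by (subst ten_comp) (auto simp: swap_swap)
  have 2: "(ide Xs \<star> swap Zs Ys) \<bullet> (ide Xs \<star> swap Ys Zs) = ide (Xs @ Ys @ Zs)"
    by (subst ten_comp) (auto simp: swap_swap)
  have 3: "swap Zs (Xs @ Ys) \<bullet> ?r = ide (Xs @ Ys @ Zs)"
    by (simp add: swap_append_right comp_assoc comp_cancel_left [OF 1] 2)
  have 4: "swap (Xs @ Ys) Zs \<bullet> swap Zs (Xs @ Ys) = ide (Zs @ Xs @ Ys)"
    by (simp add: swap_swap)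
  have "?r = swap (Xs @ Ys) Zs \<bullet> swap Zs (Xs @ Ys) \<bullet> ?r"
    by (rule comp_cancel_left [OF 4, symmetric]) auto
  then show ?thesis
    unfolding 3 by simp
qed

text \<open>A last object is split off a nonempty list by an identity, so here the strict tensor is
  that of \<open>C\<close>. This links strict arrows to recursions such as \<open>exch\<close> and
  \<open>permute\<close>, which peel off the last entry.\<close>

lemma mor_ten_single:
  assumes "arr f" "arr g" "sdom f \<noteq> []" "scod f \<noteq> []" "sdom g = [X]" "scod g = [Y]"
  shows "mor (f \<star> g) = mor f \<otimes> mor g"
proof -
  have "X \<in> Ob C" "Y \<in> Ob C"
    using arrD(1,2) [of g] assms by auto
  then show ?thesis
    using assms by (simp add: ten_def split2_simps)
qed

text \<open>The induction runs from the right end of \<open>Zs\<close>, as the recursion of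
  \<open>exch\<close> does; only the base case involves associators.\<close>

lemma exch_strict:
  assumes [simp]: "objs Xs" "Y \<in> Ob C" "Z \<in> Ob C"
  shows "objs Zs \<Longrightarrow> Strict (Xs @ [Y, Z] @ Zs) (exch C Xs Y Z Zs) (Xs @ [Z, Y] @ Zs)
    = ide Xs \<star> swap [Y] [Z] \<star> ide Zs"
proof (induction Zs rule: rev_induct)
  case Nil
  show ?case
  proof (cases "Xs = []")
    case True
    have "swap [Y] [Z] = Strict [Y, Z] (sym C Y Z) [Z, Y]"
      by (simp add: swap_def split2_simps)
    with True show ?thesis
      by (subst exch.simps) (simp flip: \<open>swap [Y] [Z] = _\<close>)
  next
    case False
    then have "split2 C Xs [U, V] = assoc C (tenss C Xs) U V" if "U \<in> Ob C" "V \<in> Ob C" for U V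
      using split2_simps(4) [of Xs "[U]" V] that by (simp add: split2_simps)
    moreover have "ide Xs \<star> swap [Y] [Z] \<star> ide [] = ide Xs \<star> swap [Y] [Z]"
      by simp
    ultimately show ?thesis
      using False by (subst exch.simps) (simp add: swap_def ten_def split2_simps)
  qed
next
  case (snoc W Ws)
  then have [simp]: "objs Ws" "W \<in> Ob C" by auto
  have *: "exch C Xs Y Z (Ws @ [W]) = exch C Xs Y Z Ws \<otimes> idn C W"
    by (subst exch.simps) simp
  let ?s = "ide Xs \<star> swap [Y] [Z] \<star> ide Ws"
  have "ide Xs \<star> swap [Y] [Z] \<star> ide (Ws @ [W]) = ?s \<star> ide [W]"
    by simp
  also have "\<dots> = Strict (Xs @ [Y, Z] @ Ws @ [W]) (mor ?s \<otimes> idn C W) (Xs @ [Z, Y] @ Ws @ [W])"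
    by (rule strict_eqI) (auto simp: mor_ten_single simp del: ten_assoc ten_ide)
  also have "mor ?s = exch C Xs Y Z Ws"
    by (simp flip: snoc.IH)
  finally show ?case
    by (simp add: *)
qed

text \<open>Each exchange lengthens the block already passed by one object, and
  \<open>swap_append_right\<close> merges it with the block symmetry for the rest.\<close>

lemma move_last_strict:
  assumes [simp]: "Y \<in> Ob C"
  shows "\<lbrakk>objs Xs; objs Zs\<rbrakk> \<Longrightarrow>
    Strict (Xs @ [Y] @ Zs) (move_last C Xs Y Zs) (Xs @ Zs @ [Y]) = ide Xs \<star> swap [Y] Zs"
proof (induction Zs arbitrary: Xs)
  case Nil
  then have "ide Xs \<star> swap [Y] [] = ide (Xs @ [Y])"
    by simp
  then show ?case
    by (simp add: ide_def)
next
  case (Cons Z Zs)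
  then have [simp]: "objs Xs" "objs Zs" "Z \<in> Ob C" by auto
  have "Strict (Xs @ [Y] @ Z # Zs) (move_last C Xs Y (Z # Zs)) (Xs @ (Z # Zs) @ [Y])
     = Strict ((Xs @ [Z]) @ [Y] @ Zs) (move_last C (Xs @ [Z]) Y Zs) ((Xs @ [Z]) @ Zs @ [Y]) \<bullet>
       Strict (Xs @ [Y, Z] @ Zs) (exch C Xs Y Z Zs) (Xs @ [Z, Y] @ Zs)"
    by (simp add: comp_def)
  also have "\<dots> = (ide (Xs @ [Z]) \<star> swap [Y] Zs) \<bullet> (ide Xs \<star> swap [Y] [Z] \<star> ide Zs)"
    using Cons.IH [of "Xs @ [Z]"] exch_strict [of Xs Y Z Zs] by simp
  also have "\<dots> = ide Xs \<star> swap [Y] ([Z] @ Zs)"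
    by (subst swap_append_right) (simp_all add: whisker)
  finally show ?case by simp
qed

section \<open>Permutations as strict arrows\<close>

definition perm :: "('e \<Rightarrow> 'o) \<Rightarrow> 'e list \<Rightarrow> 'e list \<Rightarrow> ('o, 'm) strict_arrow" where
  "perm ob E F = Strict (map ob E) (permute C ob E F) (map ob F)"

lemma perm_dom_cod [simp]: "sdom (perm ob E F) = map ob E" "scod (perm ob E F) = map ob F"
  by (simp_all add: perm_def)

lemma perm_nil [simp]: "perm ob [] [] = ide []"
  by (simp add: perm_def ide_def permute.simps)

text \<open>The last premise is there because \<open>arr_perm\<close> is proved by induction from
  this very recursion; \<open>perm_snoc\<close> is the version without it.\<close>

lemma perm_snoc':
  assumes "objs (map ob (E1 @ e # E2))" "e \<notin> set E1" "mset (E1 @ E2) = mset F" "arr (perm ob (E1 @ E2) F)"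
  shows "perm ob (E1 @ e # E2) (F @ [e]) =
    (perm ob (E1 @ E2) F \<star> ide [ob e]) \<bullet> (ide (map ob E1) \<star> swap [ob e] (map ob E2))"
proof -
  have [simp]: "obs ob E1" "obs ob E2" "ob e \<in> Ob C"
    using assms(1) by auto
  have tw: "takeWhile (\<lambda>x. x \<noteq> e) (E1 @ e # E2) = E1" "dropWhile (\<lambda>x. x \<noteq> e) (E1 @ e # E2) = e # E2"
    using assms(2) by (auto simp: takeWhile_append dropWhile_append)
  show ?thesis
  proof (cases "F = []")
    case True
    then have "E1 = []" "E2 = []" using assms(3) by auto
    with True have "perm ob (E1 @ e # E2) (F @ [e]) = ide [ob e]"
      by (simp add: perm_def permute.simps) (simp add: ide_def)
    then show ?thesis
      using True \<open>E1 = []\<close> \<open>E2 = []\<close> by simp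
  next
    case False
    then have ne: "E1 @ E2 \<noteq> []" using assms(3) by auto
    have "permute C ob (E1 @ e # E2) (F @ [e]) =
        (permute C ob (E1 @ E2) F \<otimes> idn C (ob e)) \<cdot> move_last C (map ob E1) (ob e) (map ob E2)"
      by (subst permute.simps) (simp only: Let_def tw last_snoc butlast_snoc False list.sel, simp)
    also have "permute C ob (E1 @ E2) F \<otimes> idn C (ob e) = mor (perm ob (E1 @ E2) F \<star> ide [ob e])"
      using assms(4) ne False by (subst mor_ten_single) (auto simp: perm_def)
    also have "move_last C (map ob E1) (ob e) (map ob E2) = mor (ide (map ob E1) \<star> swap [ob e] (map ob E2))"
      using arg_cong [OF move_last_strict [of "ob e" "map ob E1" "map ob E2"], of mor] by simp
    finally show ?thesis
      by (intro strict_eqI) (simp_all add: perm_def)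
  qed
qed

text \<open>The first occurrence is taken because \<open>permute\<close> finds the entry by
  \<open>takeWhile\<close>.\<close>

lemma perm_cases:
  assumes "mset E = mset (F @ [e])"
  obtains E1 E2 where "E = E1 @ e # E2" "e \<notin> set E1" "mset (E1 @ E2) = mset F"
proof -
  have "set E = set (F @ [e])"
    using assms by (rule mset_eq_setD)
  then obtain E1 E2 where "E = E1 @ e # E2" "e \<notin> set E1"
    using split_list_first [of e E] by auto
  with that assms show ?thesis by simp
qed

lemma arr_perm [simp]: "\<lbrakk>mset E = mset F; objs (map ob E)\<rbrakk> \<Longrightarrow> arr (perm ob E F)"
proof (induction F arbitrary: E rule: rev_induct)
  case (snoc e F)
  obtain E1 E2 where E: "E = E1 @ e # E2" "e \<notin> set E1" "mset (E1 @ E2) = mset F"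
    using perm_cases [OF snoc.prems(1)] .
  have [simp]: "obs ob E1" "obs ob E2" "ob e \<in> Ob C"
    using snoc.prems(2) E by auto
  have "arr (perm ob (E1 @ E2) F)"
    using snoc.IH [of "E1 @ E2"] E(3) by simp
  then show ?case
    unfolding E using E by (subst perm_snoc') auto
qed auto

lemma perm_snoc:
  "\<lbrakk>objs (map ob (E1 @ e # E2)); e \<notin> set E1; mset (E1 @ E2) = mset F\<rbrakk> \<Longrightarrow>
    perm ob (E1 @ e # E2) (F @ [e]) =
    (perm ob (E1 @ E2) F \<star> ide [ob e]) \<bullet> (ide (map ob E1) \<star> swap [ob e] (map ob E2))"
  by (rule perm_snoc') auto

lemma perm_refl [simp]: "\<lbrakk>distinct E; objs (map ob E)\<rbrakk> \<Longrightarrow> perm ob E E = ide (map ob E)"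
proof (induction E rule: rev_induct)
  case (snoc e E)
  then show ?case
    using perm_snoc [of ob E e "[]" E] by simp
qed simp

text \<open>The case in which \<open>d\<close> starts to the right of \<open>e\<close>: the hexagon
  joins the two moves of \<open>e\<close> into one symmetry past \<open>(E3 @ E4) @ d\<close>, and
  naturality carries the move of \<open>d\<close> through it.\<close>

lemma swap_slide_right:
  assumes [simp]: "objs E3" "objs E4" "objs e" "objs d"
  shows "(ide (E3 @ E4) \<star> swap e d) \<bullet> (swap e (E3 @ E4) \<star> ide d) \<bullet> (ide (e @ E3) \<star> swap d E4)
    = (ide E3 \<star> swap d E4 \<star> ide e) \<bullet> swap e (E3 @ d @ E4)"
proof -
  have "(ide (E3 @ E4) \<star> swap e d) \<bullet> (swap e (E3 @ E4) \<star> ide d) \<bullet> (ide (e @ E3) \<star> swap d E4)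
    = swap e ((E3 @ E4) @ d) \<bullet> (ide (e @ E3) \<star> swap d E4)"
    by (subst swap_append_right) (auto simp: comp_assoc)
  also have "\<dots> = swap e ((E3 @ E4) @ d) \<bullet> (ide e \<star> (ide E3 \<star> swap d E4))"
    by (simp add: ide_ide_ten)
  also have "\<dots> = ((ide E3 \<star> swap d E4) \<star> ide e) \<bullet> swap e (E3 @ d @ E4)"
    using swap_natural [of "ide e" "ide E3 \<star> swap d E4"] by simp
  finally show ?thesis by simp
qed

text \<open>The case in which \<open>d\<close> starts to the left of \<open>e\<close>: naturality
  carries the move of \<open>e\<close> through the symmetry of \<open>d\<close>, and then
  \<open>swap e d\<close> cancels against \<open>swap d e\<close>.\<close>

lemma swap_slide_left:
  assumes [simp]: "objs E2" "objs E4" "objs e" "objs d"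
  shows "(ide (E4 @ E2) \<star> swap e d) \<bullet> (ide E4 \<star> swap e E2 \<star> ide d) \<bullet> swap d (E4 @ e @ E2)
    = (swap d (E4 @ E2) \<star> ide e) \<bullet> (ide (d @ E4) \<star> swap e E2)"
proof -
  have 1: "(ide E4 \<star> swap e E2 \<star> ide d) \<bullet> swap d (E4 @ e @ E2) = swap d ((E4 @ E2) @ e) \<bullet> (ide (d @ E4) \<star> swap e E2)"
    using swap_natural [of "ide d" "ide E4 \<star> swap e E2"] by (simp add: ide_ide_ten)
  have 2: "(ide (E4 @ E2) \<star> swap e d) \<bullet> (ide (E4 @ E2) \<star> swap d e) = ide (E4 @ E2 @ d @ e)"
    by (subst ten_comp) (auto simp: swap_swap)
  show ?thesis
    unfolding 1 by (subst swap_append_right) (auto simp: comp_assoc comp_cancel_left [OF 2])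
qed

text \<open>The part of the induction step of \<open>perm_move\<close> common to both positions of
  the new entry \<open>D\<close>: \<open>IH\<close> handles the move past \<open>F2\<close>, and
  \<open>R\<close> stands for the move of \<open>D\<close> to the end of the source.\<close>

lemma perm_move_step:
  assumes IH: "(ide F1 \<star> swap [E] F2) \<bullet> P = (Q \<star> ide [E]) \<bullet> (ide E1 \<star> swap [E] E2)"
    and [simp]: "arr P" "arr Q" "objs F1" "objs F2" "objs E1" "objs E2" "E \<in> Ob C" "D \<in> Ob C"
    and QE: "sdom Q = E1 @ E2"
    and dc [simp]: "scod P = F1 @ E # F2" "scod Q = F1 @ F2"
      "sdom P = E1 @ E # E2" "arr R" "scod R = E1 @ E # E2 @ [D]"
  shows "(ide F1 \<star> swap [E] (F2 @ [D])) \<bullet> (P \<star> ide [D]) \<bullet> R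
    = (Q \<star> ide [D, E]) \<bullet> (ide (E1 @ E2) \<star> swap [E] [D]) \<bullet> (ide E1 \<star> swap [E] E2 \<star> ide [D]) \<bullet> R"
proof -
  note [simp] = QE
  have swapF: "ide F1 \<star> swap [E] (F2 @ [D])
      = (ide (F1 @ F2) \<star> swap [E] [D]) \<bullet> ((ide F1 \<star> swap [E] F2) \<star> ide [D])"
    using swap_append_right [of "[E]" F2 "[D]"] by (simp add: whisker)
  have "(ide F1 \<star> swap [E] (F2 @ [D])) \<bullet> (P \<star> ide [D]) \<bullet> R
      = (ide (F1 @ F2) \<star> swap [E] [D]) \<bullet> (((ide F1 \<star> swap [E] F2) \<bullet> P) \<star> ide [D]) \<bullet> R"
    unfolding swapF by (simp add: whisker)
  also have "\<dots> = ((ide (F1 @ F2) \<star> swap [E] [D]) \<bullet> (Q \<star> ide [E, D])) \<bullet> (ide E1 \<star> swap [E] E2 \<star> ide [D]) \<bullet> R"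
    unfolding IH by (simp add: whisker)
  also have "(ide (F1 @ F2) \<star> swap [E] [D]) \<bullet> (Q \<star> ide [E, D]) = (Q \<star> ide [D, E]) \<bullet> (ide (E1 @ E2) \<star> swap [E] [D])"
    using slide [of Q "swap [E] [D]"] by simp
  finally show ?thesis
    by (simp add: comp_assoc)
qed

text \<open>\<open>perm_snoc\<close> only describes how the last target entry travels. Composition
  needs this for an arbitrary entry \<open>e\<close> of the target, because the last entry of the
  final list can sit anywhere in the middle one.\<close>

lemma perm_move:
  "\<lbrakk>mset (E1 @ e # E2) = mset (F1 @ e # F2); distinct (F1 @ e # F2); objs (map ob (E1 @ e # E2))\<rbrakk> \<Longrightarrow>
    (ide (map ob F1) \<star> swap [ob e] (map ob F2)) \<bullet> perm ob (E1 @ e # E2) (F1 @ e # F2)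
    = (perm ob (E1 @ E2) (F1 @ F2) \<star> ide [ob e]) \<bullet> (ide (map ob E1) \<star> swap [ob e] (map ob E2))"
proof (induction F2 arbitrary: E1 E2 rule: rev_induct)
  case Nil
  have "distinct (E1 @ e # E2)"
    using mset_eq_imp_distinct_iff [OF Nil.prems(1)] Nil.prems(2) by simp
  moreover have "obs ob (F1 @ e # [])"
    using Nil.prems(3) unfolding mset_eq_setD [OF Nil.prems(1), symmetric] by auto
  ultimately show ?case
    using Nil.prems perm_snoc [of ob E1 e E2 F1] by auto
next
  case (snoc d F2)
  let ?o = "map ob"
  let ?D = "[ob d]" and ?E = "[ob e]"
  have dist: "distinct (E1 @ e # E2)"
    using mset_eq_imp_distinct_iff [OF snoc.prems(1)] snoc.prems(2) by simp
  have sets: "set (E1 @ e # E2) = set (F1 @ e # F2 @ [d])"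
    using snoc.prems(1) by (rule mset_eq_setD)
  have "obs ob (E1 @ e # E2)"
    using snoc.prems(3) by auto
  then have "obs ob (F1 @ e # F2 @ [d])"
    by (simp only: sets)
  then have [simp]: "obs ob F1" "obs ob F2" "ob e \<in> Ob C" "ob d \<in> Ob C" by auto
  have [simp]: "obs ob E1" "obs ob E2"
    using snoc.prems(3) by auto
  \<comment> \<open>In the source the last target entry \<open>d\<close> lies on one side of
    \<open>e\<close> or the other, which decides between the two sliding lemmas.\<close>
  have "d \<in> set E1 \<or> d \<in> set E2"
    using sets snoc.prems(2) by auto
  then show ?case
  proof
    assume "d \<in> set E2"
    then obtain E3 E4 where E2: "E2 = E3 @ d # E4"
      by (meson split_list_first)
    have d: "d \<notin> set (E1 @ e # E3)" "d \<notin> set (E1 @ E3)"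
      using dist unfolding E2 by auto
    have [simp]: "obs ob E3" "obs ob E4"
      using \<open>obs ob E2\<close> unfolding E2 by auto
    have m: "mset (E1 @ e # E3 @ E4) = mset (F1 @ e # F2)" "mset (E1 @ E3 @ E4) = mset (F1 @ F2)"
      using snoc.prems(1) by (simp_all add: E2)
    let ?P = "perm ob (E1 @ e # E3 @ E4) (F1 @ e # F2)" and ?Q = "perm ob (E1 @ E3 @ E4) (F1 @ F2)"
    have [simp]: "arr ?P" "arr ?Q"
      using m by simp_all
    have P: "perm ob (E1 @ e # E2) (F1 @ e # F2 @ [d])
        = (?P \<star> ide ?D) \<bullet> (ide (?o (E1 @ e # E3)) \<star> swap ?D (?o E4))"
      using perm_snoc [of ob "E1 @ e # E3" d E4 "F1 @ e # F2"] d m(1) by (simp add: E2)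
    have Q: "perm ob (E1 @ E2) (F1 @ F2 @ [d])
        = (?Q \<star> ide ?D) \<bullet> (ide (?o (E1 @ E3)) \<star> swap ?D (?o E4))"
      using perm_snoc [of ob "E1 @ E3" d E4 "F1 @ F2"] d m(2) by (simp add: E2)
    have IH: "(ide (?o F1) \<star> swap ?E (?o F2)) \<bullet> ?P
        = (?Q \<star> ide ?E) \<bullet> (ide (?o E1) \<star> swap ?E (?o (E3 @ E4)))"
      using snoc.IH [of E1 "E3 @ E4"] snoc.prems(2) m by auto
    have "(ide (?o F1) \<star> swap ?E (?o (F2 @ [d]))) \<bullet> perm ob (E1 @ e # E2) (F1 @ e # F2 @ [d])
      = (?Q \<star> ide (?D @ ?E)) \<bullet> (ide (?o (E1 @ E3 @ E4)) \<star> swap ?E ?D) \<bullet>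
          (ide (?o E1) \<star> swap ?E (?o (E3 @ E4)) \<star> ide ?D) \<bullet> (ide (?o (E1 @ e # E3)) \<star> swap ?D (?o E4))"
      unfolding P using perm_move_step [OF IH,
          where R = "ide (?o (E1 @ e # E3)) \<star> swap ?D (?o E4)" and D = "ob d"] by simp
    also have "\<dots> = (?Q \<star> ide (?D @ ?E)) \<bullet> (ide (?o E1) \<star> ((ide (?o E3 @ ?o E4) \<star> swap ?E ?D) \<bullet>
          (swap ?E (?o E3 @ ?o E4) \<star> ide ?D) \<bullet> (ide (?E @ ?o E3) \<star> swap ?D (?o E4))))"
      by (simp add: whisker)
    also have "\<dots> = (?Q \<star> ide (?D @ ?E)) \<bullet> (ide (?o E1) \<star> ((ide (?o E3) \<star> swap ?D (?o E4) \<star> ide ?E) \<bullet> swap ?E (?o E3 @ ?D @ ?o E4)))"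
      by (subst swap_slide_right) auto
    also have "\<dots> = (perm ob (E1 @ E2) (F1 @ F2 @ [d]) \<star> ide ?E) \<bullet> (ide (?o E1) \<star> swap ?E (?o E2))"
      unfolding Q by (simp add: whisker E2)
    finally show ?case by simp
  next
    assume "d \<in> set E1"
    then obtain E3 E4 where E1: "E1 = E3 @ d # E4" and d3: "d \<notin> set E3"
      by (meson split_list_first)
    have [simp]: "obs ob E3" "obs ob E4"
      using \<open>obs ob E1\<close> unfolding E1 by auto
    have m: "mset (E3 @ E4 @ e # E2) = mset (F1 @ e # F2)" "mset (E3 @ E4 @ E2) = mset (F1 @ F2)"
      using snoc.prems(1) by (simp_all add: E1)
    let ?P = "perm ob (E3 @ E4 @ e # E2) (F1 @ e # F2)" and ?Q = "perm ob (E3 @ E4 @ E2) (F1 @ F2)"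
    have [simp]: "arr ?P" "arr ?Q"
      using m by simp_all
    have P: "perm ob (E1 @ e # E2) (F1 @ e # F2 @ [d])
        = (?P \<star> ide ?D) \<bullet> (ide (?o E3) \<star> swap ?D (?o (E4 @ e # E2)))"
      using perm_snoc [of ob E3 d "E4 @ e # E2" "F1 @ e # F2"] d3 m(1) by (simp add: E1)
    have Q: "perm ob (E1 @ E2) (F1 @ F2 @ [d])
        = (?Q \<star> ide ?D) \<bullet> (ide (?o E3) \<star> swap ?D (?o (E4 @ E2)))"
      using perm_snoc [of ob E3 d "E4 @ E2" "F1 @ F2"] d3 m(2) by (simp add: E1)
    have IH: "(ide (?o F1) \<star> swap ?E (?o F2)) \<bullet> ?P
        = (?Q \<star> ide ?E) \<bullet> (ide (?o (E3 @ E4)) \<star> swap ?E (?o E2))"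
      using snoc.IH [of "E3 @ E4" E2] snoc.prems(2) m by auto
    have "(ide (?o F1) \<star> swap ?E (?o (F2 @ [d]))) \<bullet> perm ob (E1 @ e # E2) (F1 @ e # F2 @ [d])
        = (?Q \<star> ide (?D @ ?E)) \<bullet> (ide (?o (E3 @ E4 @ E2)) \<star> swap ?E ?D) \<bullet>
          (ide (?o (E3 @ E4)) \<star> swap ?E (?o E2) \<star> ide ?D) \<bullet> (ide (?o E3) \<star> swap ?D (?o (E4 @ e # E2)))"
      unfolding P using perm_move_step [OF IH,
          where R = "ide (?o E3) \<star> swap ?D (?o (E4 @ e # E2))" and D = "ob d"] by simp
    also have "\<dots> = (?Q \<star> ide (?D @ ?E)) \<bullet> (ide (?o E3) \<star> ((ide (?o E4 @ ?o E2) \<star> swap ?E ?D) \<bullet>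
          (ide (?o E4) \<star> swap ?E (?o E2) \<star> ide ?D) \<bullet> swap ?D (?o E4 @ ?E @ ?o E2)))"
      by (simp add: whisker)
    also have "\<dots> = (?Q \<star> ide (?D @ ?E)) \<bullet> (ide (?o E3) \<star> ((swap ?D (?o E4 @ ?o E2) \<star> ide ?E) \<bullet> (ide (?D @ ?o E4) \<star> swap ?E (?o E2))))"
      by (subst swap_slide_left) auto
    also have "\<dots> = (perm ob (E1 @ E2) (F1 @ F2 @ [d]) \<star> ide ?E) \<bullet> (ide (?o E1) \<star> swap ?E (?o E2))"
      unfolding Q by (simp add: whisker E1)
    finally show ?case by simp
  qed
qed

text \<open>The last entry \<open>e\<close> of \<open>G\<close> is followed backwards:
  \<open>perm ob F G\<close> first moves it to the end, \<open>perm_move\<close> pushes that move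
  through \<open>perm ob E F\<close>, and the shorter lists are left to the induction
  hypothesis.\<close>

lemma perm_comp:
  "\<lbrakk>mset E = mset F; mset F = mset G; distinct G; objs (map ob E)\<rbrakk>
    \<Longrightarrow> perm ob F G \<bullet> perm ob E F = perm ob E G"
proof (induction G arbitrary: E F rule: rev_induct)
  case (snoc e G)
  obtain F1 F2 where F: "F = F1 @ e # F2" "e \<notin> set F1" "mset (F1 @ F2) = mset G"
    using perm_cases [OF snoc.prems(2)] .
  obtain E1 E2 where E: "E = E1 @ e # E2" "e \<notin> set E1" "mset (E1 @ E2) = mset G"
    using perm_cases [of E G e] snoc.prems by metis
  let ?o = "map ob"
  have [simp]: "obs ob E1" "obs ob E2" "ob e \<in> Ob C"
    using snoc.prems(4) E(1) by auto
  have "set F = set E"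
    using snoc.prems(1) by (metis mset_eq_setD)
  then have "obs ob F"
    using snoc.prems(4) by simp
  then have [simp]: "obs ob F1" "obs ob F2"
    using F(1) by auto
  have dist: "distinct F"
    using mset_eq_imp_distinct_iff [OF snoc.prems(2)] snoc.prems(3) by simp
  have [simp]: "arr (perm ob (F1 @ F2) G)" "arr (perm ob E F)" "arr (perm ob (E1 @ E2) (F1 @ F2))"
    using E F snoc.prems by auto
  have [simp]: "arr (perm ob E (F1 @ e # F2))"
    using \<open>arr (perm ob E F)\<close> F(1) by simp
  have "perm ob F (G @ [e]) \<bullet> perm ob E F = (perm ob (F1 @ F2) G \<star> ide [ob e]) \<bullet>
      (ide (?o F1) \<star> swap [ob e] (?o F2)) \<bullet> perm ob E F"
    using perm_snoc [of ob F1 e F2 G] F by (simp add: comp_assoc)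
  also have "\<dots> = (perm ob (F1 @ F2) G \<star> ide [ob e]) \<bullet>
      (perm ob (E1 @ E2) (F1 @ F2) \<star> ide [ob e]) \<bullet> (ide (?o E1) \<star> swap [ob e] (?o E2))"
    using snoc.prems E F dist perm_move [of E1 e E2 F1 F2 ob] by auto
  also have "\<dots> = ((perm ob (F1 @ F2) G \<bullet> perm ob (E1 @ E2) (F1 @ F2)) \<star> ide [ob e]) \<bullet>
      (ide (?o E1) \<star> swap [ob e] (?o E2))"
    by (simp add: whisker)
  also have "perm ob (F1 @ F2) G \<bullet> perm ob (E1 @ E2) (F1 @ F2) = perm ob (E1 @ E2) G"
    using snoc.prems E F by (intro snoc.IH) auto
  also have "(perm ob (E1 @ E2) G \<star> ide [ob e]) \<bullet> (ide (?o E1) \<star> swap [ob e] (?o E2)) = perm ob E (G @ [e])"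
    using perm_snoc [of ob E1 e E2 G] E by simp
  finally show ?case .
qed simp

lemma perm_ten:
  "\<lbrakk>mset E1 = mset F1; mset E2 = mset F2; distinct (F1 @ F2); objs (map ob (E1 @ E2))\<rbrakk>
    \<Longrightarrow> perm ob E1 F1 \<star> perm ob E2 F2 = perm ob (E1 @ E2) (F1 @ F2)"
proof (induction F2 arbitrary: E2 rule: rev_induct)
  case (snoc e F2)
  obtain E3 E4 where E: "E2 = E3 @ e # E4" "e \<notin> set E3" "mset (E3 @ E4) = mset F2"
    using perm_cases [OF snoc.prems(2)] .
  let ?o = "map ob"
  have [simp]: "obs ob E1" "obs ob E3" "obs ob E4" "ob e \<in> Ob C"
    using snoc.prems(4) E by auto
  have "set F1 = set E1"
    using snoc.prems(1) by (metis mset_eq_setD)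
  \<comment> \<open>\<open>perm_snoc\<close> wants the first occurrence in all of
    \<open>E1 @ E2\<close>, not only in \<open>E2\<close>; distinctness of the target excludes
    \<open>e\<close> from \<open>E1\<close>.\<close>
  then have e: "e \<notin> set (E1 @ E3)"
    using snoc.prems(3) E by auto
  have [simp]: "arr (perm ob E1 F1)" "arr (perm ob (E3 @ E4) F2)" "arr (perm ob (E1 @ E3 @ E4) (F1 @ F2))"
    using E snoc.prems by auto
  have "perm ob E1 F1 \<star> perm ob E2 (F2 @ [e]) =
     (perm ob E1 F1 \<star> perm ob (E3 @ E4) F2 \<star> ide [ob e]) \<bullet> (ide (?o (E1 @ E3)) \<star> swap [ob e] (?o E4))"
    using perm_snoc [of ob E3 e E4 F2] E
      ten_comp [of "ide (?o E1)" "perm ob E1 F1" "ide (?o E3) \<star> swap [ob e] (?o E4)" "perm ob (E3 @ E4) F2 \<star> ide [ob e]"]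
    by (simp add: ide_ide_ten)
  also have "\<dots> = ((perm ob E1 F1 \<star> perm ob (E3 @ E4) F2) \<star> ide [ob e]) \<bullet> (ide (?o (E1 @ E3)) \<star> swap [ob e] (?o E4))"
    by simp
  also have "perm ob E1 F1 \<star> perm ob (E3 @ E4) F2 = perm ob (E1 @ E3 @ E4) (F1 @ F2)"
    using snoc.prems E by (intro snoc.IH) auto
  also have "(perm ob (E1 @ E3 @ E4) (F1 @ F2) \<star> ide [ob e]) \<bullet> (ide (?o (E1 @ E3)) \<star> swap [ob e] (?o E4))
      = perm ob (E1 @ E2) (F1 @ F2 @ [e])"
    using perm_snoc [of ob "E1 @ E3" e E4 "F1 @ F2"] snoc.prems e E by simp
  finally show ?case .
qed simp

lemma perm_swap:
  "\<lbrakk>distinct (E1 @ E2); objs (map ob (E1 @ E2))\<rbrakk>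
    \<Longrightarrow> perm ob (E1 @ E2) (E2 @ E1) = swap (map ob E1) (map ob E2)"
proof (induction E1 rule: rev_induct)
  case (snoc e E1)
  let ?o = "map ob"
  have [simp]: "obs ob E1" "obs ob E2" "ob e \<in> Ob C"
    using snoc.prems by auto
  have "perm ob (E1 @ e # E2) ((E2 @ E1) @ [e])
     = (perm ob (E1 @ E2) (E2 @ E1) \<star> ide [ob e]) \<bullet> (ide (?o E1) \<star> swap [ob e] (?o E2))"
    using snoc.prems by (intro perm_snoc) auto
  also have "perm ob (E1 @ E2) (E2 @ E1) = swap (?o E1) (?o E2)"
    using snoc by auto
  also have "(swap (?o E1) (?o E2) \<star> ide [ob e]) \<bullet> (ide (?o E1) \<star> swap [ob e] (?o E2)) = swap (?o E1 @ [ob e]) (?o E2)"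
    by (subst swap_append_left) auto
  finally show ?case by simp
qed simp

end

section \<open>Tensors of families and naturality of permutations\<close>

lemma mset_concat_map: "mset (concat (map D xs)) = (\<Sum>x\<in>#mset xs. mset (D x))"
  by (induction xs) auto

lemma mset_concat_map_cong: "mset xs = mset ys \<Longrightarrow> mset (concat (map D xs)) = mset (concat (map D ys))"
  by (simp add: mset_concat_map)

context symmetric_monoidal_category
begin

primrec tens_list :: "('o, 'm) strict_arrow list \<Rightarrow> ('o, 'm) strict_arrow" where
  "tens_list [] = ide []"
| "tens_list (f # fs) = f \<star> tens_list fs"

lemma arr_tens_list [simp]: "\<forall>f\<in>set fs. arr f \<Longrightarrow> arr (tens_list fs)"
  by (induction fs) auto

lemma tens_list_dom_cod [simp]:
  "sdom (tens_list fs) = concat (map sdom fs)" "scod (tens_list fs) = concat (map scod fs)"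
  by (induction fs) auto

lemma tens_list_append:
  "\<lbrakk>\<forall>f\<in>set fs. arr f; \<forall>f\<in>set gs. arr f\<rbrakk> \<Longrightarrow> tens_list (fs @ gs) = tens_list fs \<star> tens_list gs"
  by (induction fs) auto

lemma tens_list_concat:
  "\<forall>fs\<in>set fss. \<forall>f\<in>set fs. arr f \<Longrightarrow> tens_list (concat fss) = tens_list (map tens_list fss)"
  by (induction fss) (auto simp: tens_list_append)

lemma tens_list_comp:
  "list_all2 (\<lambda>g f. arr g \<and> arr f \<and> scod f = sdom g) gs fs \<Longrightarrow>
    tens_list (map2 (\<bullet>) gs fs) = tens_list gs \<bullet> tens_list fs
    \<and> concat (map scod fs) = concat (map sdom gs)
    \<and> arr (tens_list gs) \<and> arr (tens_list fs)"
  by (induction gs fs rule: list_all2_induct) (auto simp: ten_comp)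

text \<open>An entry \<open>e\<close> is the target of an arrow \<open>m e\<close> from a whole
  block \<open>D e\<close>. Permuting entries afterwards amounts to permuting blocks beforehand,
  which is how a permutation passes a substitution.\<close>

lemma perm_natural:
  "\<lbrakk>mset E = mset F; \<And>e. e \<in> set E \<Longrightarrow> arr (m e) \<and> sdom (m e) = map ob' (D e) \<and> scod (m e) = [ob e];
    distinct E; distinct (concat (map D E))\<rbrakk> \<Longrightarrow> perm ob E F \<bullet> tens_list (map m E)
    = tens_list (map m F) \<bullet> perm ob' (concat (map D E)) (concat (map D F))"
proof (induction F arbitrary: E rule: rev_induct)
  case (snoc e F)
  obtain E1 E2 where E: "E = E1 @ e # E2" "e \<notin> set E1" "mset (E1 @ E2) = mset F"
    using perm_cases [OF snoc.prems(1)] .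
  have me [simp]: "arr (m e)" "sdom (m e) = map ob' (D e)" "scod (m e) = [ob e]"
    and ms: "\<And>x. x \<in> set (E1 @ E2) \<Longrightarrow> arr (m x) \<and> sdom (m x) = map ob' (D x) \<and> scod (m x) = [ob x]"
    using snoc.prems(2) E by auto
  \<comment> \<open>Kept opaque so that \<open>simp\<close> does not take the tensors of the
    families apart.\<close>
  define M where "M = (\<lambda>E. tens_list (map m E))"
  let ?D = "\<lambda>E. concat (map D E)"
  have arrM: "arr (M G) \<and> sdom (M G) = map ob' (?D G) \<and> scod (M G) = map ob G"
     if "set G \<subseteq> set (E1 @ E2)" for G
    using that ms by (induction G) (auto simp: M_def)
  have F: "set F = set (E1 @ E2)"
    using E(3) by (metis mset_eq_setD)
  note [simp] = arrM [of E1, simplified] arrM [of E2, simplified] arrM [of "E1 @ E2", simplified]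
    arrM [of F, unfolded F, simplified]
  have objs [simp]: "obs ob E1" "obs ob E2" "ob e \<in> Ob C"
    "obs ob' (?D E1)" "obs ob' (?D E2)" "obs ob' (D e)"
    using arrD(1,2) [of "M E1"] arrD(1,2) [of "M E2"] arrD(1,2) [of "m e"] by simp_all
  have objs' [simp]: "ob' ` (\<Union>x\<in>set E1. set (D x)) \<subseteq> Ob C" "ob' ` (\<Union>x\<in>set E2. set (D x)) \<subseteq> Ob C"
    "(\<Union>x\<in>set E1. ob' ` set (D x)) \<subseteq> Ob C" "(\<Union>x\<in>set E2. ob' ` set (D x)) \<subseteq> Ob C"
    using objs(4,5) by (simp_all add: image_UN)
  have mD: "mset (?D E1 @ ?D E2) = mset (?D F)"
    using mset_concat_map_cong [OF E(3), of D] by simp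
  have dD: "distinct (?D E1 @ D e @ ?D E2)"
    using snoc.prems(4) E by simp
  have "mset (?D E1 @ D e @ ?D E2) = mset (?D F @ D e)"
    using mD by simp
  from mset_eq_imp_distinct_iff [OF this] have dD': "distinct (?D F @ D e)"
    using dD by simp
  have [simp]: "arr (perm ob (E1 @ E2) F)" "arr (perm ob' (?D E1 @ ?D E2) (?D F))"
    using E mD by (auto simp: image_Union)
  have MM: "M (E1 @ E2) = M E1 \<star> M E2" "M (F @ [e]) = M F \<star> m e" "M E = M E1 \<star> m e \<star> M E2"
    using ms F by (simp_all add: M_def E tens_list_append)
  let ?s = "swap (map ob' (D e)) (map ob' (?D E2))"
  have "perm ob E (F @ [e]) \<bullet> M E = (perm ob (E1 @ E2) F \<star> ide [ob e]) \<bullet>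
      (ide (map ob E1) \<star> swap [ob e] (map ob E2)) \<bullet> (M E1 \<star> m e \<star> M E2)"
    unfolding MM using perm_snoc [of ob E1 e E2 F] E by (simp add: comp_assoc)
  also have "(ide (map ob E1) \<star> swap [ob e] (map ob E2)) \<bullet> (M E1 \<star> m e \<star> M E2)
      = M E1 \<star> (swap [ob e] (map ob E2) \<bullet> (m e \<star> M E2))"
    by (subst ten_comp) auto
  also have "swap [ob e] (map ob E2) \<bullet> (m e \<star> M E2) = (M E2 \<star> m e) \<bullet> ?s"
    using swap_natural [of "m e" "M E2"] by simp
  also have "M E1 \<star> ((M E2 \<star> m e) \<bullet> ?s) = (M (E1 @ E2) \<star> m e) \<bullet> (ide (map ob' (?D E1)) \<star> ?s)"
    unfolding MM using ten_comp [of "ide (map ob' (?D E1))" "M E1" ?s "M E2 \<star> m e"] by simp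
  also have "(perm ob (E1 @ E2) F \<star> ide [ob e]) \<bullet> \<dots> = ((perm ob (E1 @ E2) F \<bullet> M (E1 @ E2)) \<star> m e) \<bullet>
     (ide (map ob' (?D E1)) \<star> ?s)"
    by (subst comp_assoc [symmetric]) (auto simp: ten_comp)
  also have "perm ob (E1 @ E2) F \<bullet> M (E1 @ E2) = M F \<bullet> perm ob' (?D (E1 @ E2)) (?D F)"
    using snoc.prems E ms unfolding M_def by (intro snoc.IH) auto
  also have "(M F \<bullet> perm ob' (?D (E1 @ E2)) (?D F)) \<star> m e
     = M (F @ [e]) \<bullet> (perm ob' (?D (E1 @ E2)) (?D F) \<star> ide (map ob' (D e)))"
    unfolding MM by (simp add: ten_comp)
  \<comment> \<open>The block symmetry is again a permutation of single entries, so that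
    \<open>perm_comp\<close> can merge it with the permutation from the induction
    hypothesis.\<close>
  also have "ide (map ob' (?D E1)) \<star> ?s = perm ob' (?D E) (?D (E1 @ E2) @ D e)"
  proof -
    have "?s = perm ob' (D e @ ?D E2) (?D E2 @ D e)"
      using dD by (intro perm_swap [symmetric]) auto
    moreover have "ide (map ob' (?D E1)) = perm ob' (?D E1) (?D E1)"
      using dD by simp
    ultimately show ?thesis
      using dD by (simp only: E, subst perm_ten) auto
  qed
  also have "perm ob' (?D (E1 @ E2)) (?D F) \<star> ide (map ob' (D e)) = perm ob' (?D (E1 @ E2) @ D e) (?D F @ D e)"
    using dD' mD by (subst perm_ten [symmetric]) auto
  also have "(M (F @ [e]) \<bullet> perm ob' (?D (E1 @ E2) @ D e) (?D F @ D e)) \<bullet> perm ob' (?D E) (?D (E1 @ E2) @ D e)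
     = M (F @ [e]) \<bullet> (perm ob' (?D (E1 @ E2) @ D e) (?D F @ D e) \<bullet> perm ob' (?D E) (?D (E1 @ E2) @ D e))"
    using mD by (intro comp_assoc) (auto simp: E MM(2))
  also have "perm ob' (?D (E1 @ E2) @ D e) (?D F @ D e) \<bullet> perm ob' (?D E) (?D (E1 @ E2) @ D e) = perm ob' (?D E) (?D F @ D e)"
    using mD dD' by (intro perm_comp) (auto simp: E)
  finally show ?case by (simp add: M_def)
qed simp

end

section \<open>Variables and binders\<close>

primrec fv :: "('g, 'f) tm \<Rightarrow> nat set" where
  "fv (Var y) = {y}"
| "fv (BVar i) = {}"
| "fv (Op f ts) = \<Union> (set (map fv ts))"
| "fv Star = {}"
| "fv (To t u) = fv t \<union> fv u"
| "fv (Tens t u) = fv t \<union> fv u"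
| "fv (PmT t u) = fv t \<union> fv u"
| "fv (LamT A t) = fv t"
| "fv (App t u) = fv t \<union> fv u"

text \<open>Local closedness: no dangling index from \<open>k\<close> on. For \<open>Op\<close> the
  quantifier ranges over the mapped list so that the recursive calls stand under \<open>map\<close>,
  as primitive recursion through lists requires.\<close>

primrec closed_at :: "nat \<Rightarrow> ('g, 'f) tm \<Rightarrow> bool" where
  "closed_at k (Var y) = True"
| "closed_at k (BVar i) = (i < k)"
| "closed_at k (Op f ts) = (\<forall>b\<in>set (map (closed_at k) ts). b)"
| "closed_at k Star = True"
| "closed_at k (To t u) = (closed_at k t \<and> closed_at k u)"
| "closed_at k (Tens t u) = (closed_at k t \<and> closed_at k u)"
| "closed_at k (PmT t u) = (closed_at k t \<and> closed_at (k + 2) u)"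
| "closed_at k (LamT A t) = closed_at (k + 1) t"
| "closed_at k (App t u) = (closed_at k t \<and> closed_at k u)"

lemma fv_close [simp]: "fv (close k x t) = fv t - {x}"
  by (induction t arbitrary: k) auto

lemma closed_at_close: "closed_at k t \<Longrightarrow> closed_at (Suc k) (close k x t)"
  by (induction t arbitrary: k) force+

text \<open>Closedness excludes the one ambiguity: \<open>close k x\<close> sends
  \<open>Var x\<close> and \<open>BVar k\<close> to the same term.\<close>

lemma close_inject:
  "\<lbrakk>close k x v = close k x w; closed_at k v; closed_at k w\<rbrakk> \<Longrightarrow> v = w"
proof (induction v arbitrary: w k)
  case (Op f ts)
  note prems = Op.prems and IH = Op.IH
  from prems show ?case
  proof (cases w)
    case (Op g us)
    have "ts = us"
      using Op prems by (intro list.inj_map_strong [of ts us "close k x" "close k x"]) (auto intro: IH)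
    then show ?thesis
      using Op prems by simp
  qed (auto split: if_splits)
next
  case (PmT t u)
  from PmT.prems show ?case
    by (cases w) (auto split: if_splits intro: PmT.IH)
next
  case (LamT A t)
  from LamT.prems show ?case
    by (cases w) (auto split: if_splits intro: LamT.IH)
qed (case_tac w; force split: if_splits)+

lemma close_fresh: "x \<notin> fv t \<Longrightarrow> close k x t = t"
  by (induction t arbitrary: k) (auto simp: map_idI)

lemma subst_Var [simp]: "subst Var t = t"
  by (induction t) (auto simp: map_idI)

text \<open>Freshness of \<open>x'\<close> for the substituted terms keeps \<open>close\<close> from
  capturing; with it a substitution may be carried out under a binder once the bound name is changed
  to \<open>x'\<close>.\<close>

lemma close_subst:
  "(\<And>y. y \<in> fv t - {x} \<Longrightarrow> x' \<notin> fv (\<sigma> y)) \<Longrightarrow>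
    close k x' (subst (\<sigma>(x := Var x')) t) = subst \<sigma> (close k x t)"
  by (induction t arbitrary: k) (auto simp: close_fresh)

lemma subst_Lam:
  "(\<And>y. y \<in> fv v - {x} \<Longrightarrow> x' \<notin> fv (\<sigma> y)) \<Longrightarrow>
    subst \<sigma> (Lam x A v) = Lam x' A (subst (\<sigma>(x := Var x')) v)"
  using close_subst [of v x x' \<sigma> 0] by (auto simp: Lam_def)

lemma subst_Pm:
  assumes "x' \<noteq> y'" "x \<noteq> y" "\<And>z. z \<in> fv w - {x, y} \<Longrightarrow> x' \<notin> fv (\<sigma> z) \<and> y' \<notin> fv (\<sigma> z)"
  shows "subst \<sigma> (Pm v x y w) = Pm (subst \<sigma> v) x' y' (subst (\<sigma>(x := Var x', y := Var y')) w)"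
proof -
  have "close 0 y' (subst (\<sigma>(x := Var x', y := Var y')) w) = subst (\<sigma>(x := Var x')) (close 0 y w)"
    using assms by (intro close_subst) auto
  moreover have "close 1 x' (subst (\<sigma>(x := Var x')) (close 0 y w)) = subst \<sigma> (close 1 x (close 0 y w))"
    using assms by (intro close_subst) auto
  ultimately show ?thesis
    by (simp add: Pm_def)
qed

text \<open>Inversion of a named binder: the bound name of one side is renamed to that of the other,
  which is harmless because \<open>x\<close> is not free in the abstraction over \<open>x'\<close>,
  and \<open>close_inject\<close> compares the bodies.\<close>

lemma Lam_eq_Lam:
  assumes "Lam x A v = Lam x' A' v'" "closed_at 0 v" "closed_at 0 (subst (Var(x' := Var x)) v')" "x \<notin> fv v' - {x'}"
  shows "A = A'" "v = subst (Var(x' := Var x)) v'"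
proof -
  have "Lam x' A' v' = Lam x A' (subst (Var(x' := Var x)) v')"
    using subst_Lam [of v' x' x Var A'] assms(4) by auto
  with assms show "A = A'" "v = subst (Var(x' := Var x)) v'"
    by (auto simp: Lam_def intro: close_inject)
qed

lemma Pm_eq_Pm:
  assumes "Pm v x y w = Pm v' x' y' w'" "closed_at 0 w" "closed_at 0 (subst (Var(x' := Var x, y' := Var y)) w')"
    "x \<noteq> y" "x' \<noteq> y'" "{x, y} \<inter> (fv w' - {x', y'}) = {}"
  shows "v = v'" "w = subst (Var(x' := Var x, y' := Var y)) w'"
proof -
  let ?u = "subst (Var(x' := Var x, y' := Var y)) w'"
  have "Pm v' x' y' w' = Pm v' x y ?u"
    using subst_Pm [of x y x' y' w' Var v'] assms(4-6) by auto
  with assms(1) have *: "v = v'" "close 1 x (close 0 y w) = close 1 x (close 0 y ?u)"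
    by (auto simp: Pm_def)
  have "close 0 y w = close 0 y ?u"
    using assms closed_at_close [of 0] by (intro close_inject [OF *(2)]) auto
  with assms * show "v = v'" "w = ?u"
    by (auto intro: close_inject)
qed

lemma fv_Lam [simp]: "fv (Lam x A v) = fv v - {x}"
  by (simp add: Lam_def)

lemma fv_Pm [simp]: "fv (Pm v x y w) = fv v \<union> (fv w - {x, y})"
  by (auto simp: Pm_def)

lemma closed_at_Lam [simp]: "closed_at 0 v \<Longrightarrow> closed_at 0 (Lam x A v)"
  by (simp add: Lam_def closed_at_close)

lemma closed_at_Pm [simp]: "\<lbrakk>closed_at 0 v; closed_at 0 w\<rbrakk> \<Longrightarrow> closed_at 0 (Pm v x y w)"
  using closed_at_close [of 0 w y] closed_at_close [of 1 "close 0 y w" x]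
  by (simp add: Pm_def numeral_2_eq_2)

section \<open>Contexts, shuffles and names\<close>

lemma is_ctx_append:
  "is_ctx (\<Gamma> @ \<Delta>) \<longleftrightarrow> is_ctx \<Gamma> \<and> is_ctx \<Delta> \<and> fst ` set \<Gamma> \<inter> fst ` set \<Delta> = {}"
  by (auto simp: is_ctx_def)

lemma is_ctx_mset: "mset \<Gamma> = mset \<Delta> \<Longrightarrow> is_ctx \<Gamma> \<longleftrightarrow> is_ctx \<Delta>"
  unfolding is_ctx_def by (metis mset_eq_imp_distinct_iff mset_map)

lemma is_ctx_distinct: "is_ctx \<Gamma> \<Longrightarrow> distinct \<Gamma>"
  by (simp add: is_ctx_def distinct_map)

lemma is_ctx_concat: "\<lbrakk>is_ctx (concat \<Gamma>s); \<Gamma> \<in> set \<Gamma>s\<rbrakk> \<Longrightarrow> is_ctx \<Gamma>"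
  by (induction \<Gamma>s) (auto simp: is_ctx_append)

lemma mset_shuffless: "E \<in> shuffless \<Gamma>s \<Longrightarrow> mset E = mset (concat \<Gamma>s)"
  by (induction \<Gamma>s arbitrary: E) (auto dest: mset_shuffles)

text \<open>This leads from permutations back to shuffles: blocks reordered along \<open>E\<close>
  keep their relative order by construction.\<close>

lemma filter_in_shuffless:
  "\<lbrakk>distinct E; mset E = mset (concat \<Gamma>s)\<rbrakk> \<Longrightarrow> E \<in> shuffless (map (\<lambda>\<Gamma>. filter (\<lambda>e. e \<in> set \<Gamma>) E) \<Gamma>s)"
proof (induction \<Gamma>s arbitrary: E)
  case (Cons \<Gamma> \<Gamma>s)
  let ?E = "filter (\<lambda>e. e \<notin> set \<Gamma>) E"
  have d: "distinct (\<Gamma> @ concat \<Gamma>s)"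
    using mset_eq_imp_distinct_iff [OF Cons.prems(2)] Cons.prems(1) by simp
  have "mset ?E = filter_mset (\<lambda>e. e \<notin> set \<Gamma>) (mset \<Gamma>) + filter_mset (\<lambda>e. e \<notin> set \<Gamma>) (mset (concat \<Gamma>s))"
    using Cons.prems(2) by simp
  also have "filter_mset (\<lambda>e. e \<notin> set \<Gamma>) (mset \<Gamma>) = {#}"
    by (simp add: filter_empty_conv flip: mset_filter)
  also have "filter_mset (\<lambda>e. e \<notin> set \<Gamma>) (mset (concat \<Gamma>s)) = mset (concat \<Gamma>s)"
    using d by (intro filter_mset_eq_conv [THEN iffD2]) auto
  finally have "?E \<in> shuffless (map (\<lambda>\<Gamma>'. filter (\<lambda>e. e \<in> set \<Gamma>') ?E) \<Gamma>s)"
    using Cons.prems(1) by (intro Cons.IH) auto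
  also have "map (\<lambda>\<Gamma>'. filter (\<lambda>e. e \<in> set \<Gamma>') ?E) \<Gamma>s = map (\<lambda>\<Gamma>'. filter (\<lambda>e. e \<in> set \<Gamma>') E) \<Gamma>s"
    using d by (auto intro!: filter_cong)
  finally show ?case
    using partition_in_shuffles [of E "\<lambda>e. e \<in> set \<Gamma>"] by auto
qed simp

lemma mset_filter_concat:
  assumes "is_ctx E" "mset E = mset (concat \<Gamma>s)" "\<Gamma> \<in> set \<Gamma>s"
  shows "mset (filter (\<lambda>e. e \<in> set \<Gamma>) E) = mset \<Gamma>"
proof -
  have "distinct E" "distinct \<Gamma>"
    using assms is_ctx_mset [OF assms(2)] is_ctx_concat is_ctx_distinct by blast+
  moreover have "set \<Gamma> \<subseteq> set E"
    using mset_eq_setD [OF assms(2)] assms(3) by auto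
  ultimately show ?thesis
    by (subst set_eq_iff_mset_eq_distinct [symmetric]) auto
qed

text \<open>Within one context, names determine entries. Applied to the contexts of a subterm in two
  derivations, this shows that they can differ only in order.\<close>

lemma mset_eq_of_names:
  assumes "is_ctx E" "set \<Gamma> \<subseteq> set E" "set \<Delta> \<subseteq> set E" "is_ctx \<Gamma>" "is_ctx \<Delta>" "fst ` set \<Gamma> = fst ` set \<Delta>"
  shows "mset \<Gamma> = mset \<Delta>"
proof -
  have "inj_on fst (set E)"
    using assms(1) by (simp add: is_ctx_def distinct_map)
  then have "set \<Gamma> = set \<Delta>"
    using assms by (metis inj_on_image_eq_iff)
  then show ?thesis
    using is_ctx_distinct [OF assms(4)] is_ctx_distinct [OF assms(5)]
    by (simp add: set_eq_iff_mset_eq_distinct)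
qed

section \<open>Interpretation up to exchange\<close>

context autonomous_category
begin

lemmas [simp] = ihom_Ob

text \<open>Only arrows into a one-element list are curried, whence the \<open>hd\<close>. For
  nonempty \<open>Ys\<close> the splitting is an identity; for empty \<open>Ys\<close> its inverse
  is the unitor \<open>\<I> \<odot> X \<rightarrow> X\<close>.\<close>

definition scurry :: "'o list \<Rightarrow> 'o \<Rightarrow> ('o, 'm) strict_arrow \<Rightarrow> ('o, 'm) strict_arrow" where
  "scurry Ys X f = Strict Ys (curry C (tenss C Ys) X (mor f \<cdot> inv_arrow C (split2 C Ys [X]))) [X \<multimap> hd (scod f)]"

definition sev :: "'o \<Rightarrow> 'o \<Rightarrow> ('o, 'm) strict_arrow" where
  "sev X Z = Strict [X \<multimap> Z, X] (ev C X Z) [Z]"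

lemma curry_arr:
  assumes "X \<in> Ob C" "Y \<in> Ob C" "f \<in> Ar C" "src C f = Y \<odot> X"
  shows "curry C Y X f \<in> hom C Y (X \<multimap> tgt C f)"
  using curry_bij [of X Y "tgt C f"] homI [of f "Y \<odot> X" "tgt C f"] assms by (auto dest: bij_betwE)

lemma curry_inject:
  assumes "X \<in> Ob C" "Y \<in> Ob C" "f \<in> Ar C" "g \<in> Ar C" "src C f = Y \<odot> X" "src C g = Y \<odot> X"
    "tgt C f = tgt C g" "curry C Y X f = curry C Y X g"
  shows "f = g"
proof (rule inj_onD)
  show "inj_on (curry C Y X) (hom C (Y \<odot> X) (tgt C f))"
    using curry_bij [of X Y "tgt C f"] assms by (simp add: bij_betw_def)
qed (use assms in \<open>auto intro: homI\<close>)

lemma ev_arr: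
  assumes "X \<in> Ob C" "Z \<in> Ob C"
  shows "ev C X Z \<in> hom C ((X \<multimap> Z) \<odot> X) Z" "curry C (X \<multimap> Z) X (ev C X Z) = idn C (X \<multimap> Z)"
proof -
  have bij: "bij_betw (curry C (X \<multimap> Z) X) (hom C ((X \<multimap> Z) \<odot> X) Z) (hom C (X \<multimap> Z) (X \<multimap> Z))"
    using assms by (intro curry_bij) auto
  have id: "idn C (X \<multimap> Z) \<in> hom C (X \<multimap> Z) (X \<multimap> Z)"
    using assms by (intro idn_hom) auto
  show "ev C X Z \<in> hom C ((X \<multimap> Z) \<odot> X) Z"
    unfolding ev_def using bij id by (intro the_inv_into_into) (auto simp: bij_betw_def)
  show "curry C (X \<multimap> Z) X (ev C X Z) = idn C (X \<multimap> Z)"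
    unfolding ev_def using bij id by (intro f_the_inv_into_f) (auto simp: bij_betw_def)
qed

lemma ev_simps [simp]:
  assumes "X \<in> Ob C" "Z \<in> Ob C"
  shows "ev C X Z \<in> Ar C" "src C (ev C X Z) = (X \<multimap> Z) \<odot> X" "tgt C (ev C X Z) = Z"
  using homD [OF ev_arr(1) [OF assms]] by auto

lemma tenss_pair [simp]: "tenss C [X, Y] = X \<odot> Y"
  using tenss_simps(3) [of "[X]" Y] by simp

lemma sev_arr [simp]:
  "\<lbrakk>X \<in> Ob C; Z \<in> Ob C\<rbrakk> \<Longrightarrow> arr (sev X Z)" "sdom (sev X Z) = [X \<multimap> Z, X]" "scod (sev X Z) = [Z]"
  by (auto simp: sev_def intro!: arrI)

lemma scurry_dom [simp]: "sdom (scurry Ys X f) = Ys"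
  by (simp add: scurry_def)

lemma arr_scurry [simp]:
  assumes "arr f" "sdom f = Ys @ [X]" "scod f = [Z]"
  shows "arr (scurry Ys X f)" "scod (scurry Ys X f) = [X \<multimap> Z]"
proof -
  have *: "objs Ys" "X \<in> Ob C" "Z \<in> Ob C"
    using arrD(1,2) [OF assms(1)] assms by auto
  let ?g = "mor f \<cdot> inv_arrow C (split2 C Ys [X])"
  have "?g \<in> Ar C" "src C ?g = tenss C Ys \<odot> X" "tgt C ?g = Z"
    using assms * by simp_all
  with * show "arr (scurry Ys X f)"
    unfolding scurry_def using curry_arr [of X "tenss C Ys" ?g] assms by (auto simp: arr_def)
  show "scod (scurry Ys X f) = [X \<multimap> Z]"
    using assms by (simp add: scurry_def)
qed

lemma scurry_natural:
  assumes [simp]: "arr f" "sdom f = Ys @ [X]" "scod f = [Z]" "arr g" "scod g = Ys"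
  shows "scurry (sdom g) X (f \<bullet> (g \<star> ide [X])) = scurry Ys X f \<bullet> g"
proof -
  have [simp]: "objs Ys" "X \<in> Ob C" "Z \<in> Ob C"
    using arrD(1,2) [OF assms(1)] assms by auto
  have "mor (f \<bullet> (g \<star> ide [X])) \<cdot> inv_arrow C (split2 C (sdom g) [X])
      = (mor f \<cdot> inv_arrow C (split2 C Ys [X])) \<cdot> (mor g \<otimes> idn C X)"
    by (simp add: ten_def)
  also have "curry C (tenss C (sdom g)) X \<dots> =
      curry C (tenss C Ys) X (mor f \<cdot> inv_arrow C (split2 C Ys [X])) \<cdot> mor g"
    by (rule curry_natural_left) (auto intro!: homI)
  finally show ?thesis
    by (intro strict_eqI) (auto simp: scurry_def)
qed

lemma scurry_inject:
  assumes [simp]: "arr f" "arr g" "sdom f = Ys @ [X]" "sdom g = Ys @ [X]" "scod f = [Z]" "scod g = [Z]"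
    and eq: "scurry Ys X f = scurry Ys X g"
  shows "f = g"
proof -
  have [simp]: "objs Ys" "X \<in> Ob C"
    using arrD(1) [OF assms(1)] by auto
  have eq': "curry C (tenss C Ys) X (mor f \<cdot> inv_arrow C (split2 C Ys [X]))
      = curry C (tenss C Ys) X (mor g \<cdot> inv_arrow C (split2 C Ys [X]))"
    using eq by (simp add: scurry_def)
  have "mor f \<cdot> inv_arrow C (split2 C Ys [X]) = mor g \<cdot> inv_arrow C (split2 C Ys [X])"
    by (rule curry_inject [OF _ _ _ _ _ _ _ eq']) auto
  from iso_cancel_right [OF this] show ?thesis
    by (intro strict_eqI) auto
qed

lemma scurry_sev:
  assumes [simp]: "X \<in> Ob C" "Z \<in> Ob C"
  shows "scurry [X \<multimap> Z] X (sev X Z) = ide [X \<multimap> Z]"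
  by (rule strict_eqI) (auto simp: scurry_def sev_def split2_simps ev_arr(2))

lemma scurry_eta:
  assumes [simp]: "arr f" "scod f = [X \<multimap> Z]" "X \<in> Ob C" "Z \<in> Ob C"
  shows "scurry (sdom f) X (sev X Z \<bullet> (f \<star> ide [X])) = f"
  using scurry_natural [of "sev X Z" "[X \<multimap> Z]" X Z f] by (simp add: scurry_sev)

text \<open>Both sides have the same currying by \<open>scurry_eta\<close>, and currying is
  injective.\<close>

lemma scurry_beta:
  assumes [simp]: "arr f" "sdom f = Ys @ [X]" "scod f = [Z]"
  shows "sev X Z \<bullet> (scurry Ys X f \<star> ide [X]) = f"
proof -
  have [simp]: "objs Ys" "X \<in> Ob C" "Z \<in> Ob C"
    using arrD(1,2) [OF assms(1)] assms by auto
  have [simp]: "arr (scurry Ys X f)" "scod (scurry Ys X f) = [X \<multimap> Z]"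
    by (rule arr_scurry; simp)+
  have eq: "scurry Ys X (sev X Z \<bullet> (scurry Ys X f \<star> ide [X])) = scurry Ys X f"
    using scurry_eta [of "scurry Ys X f" X Z] by simp
  show ?thesis
    by (rule scurry_inject [OF _ _ _ _ _ _ eq]) auto
qed

end

section \<open>Denotations of terms and exchange\<close>

locale linear_model = autonomous_category C
  for C :: "('o, 'm, 'x) autonomous_category_scheme" (structure) +
  fixes S :: "('g, 'f) signature" and gi :: "'g \<Rightarrow> 'o" and fi :: "'f \<Rightarrow> 'm"
  assumes sig: "is_signature S"
    and interpr: "is_interpretation C S gi fi"
begin

abbreviation tob :: "'g ty \<Rightarrow> 'o" where "tob \<equiv> tyob C gi"

definition eob :: "nat \<times> 'g ty \<Rightarrow> 'o" where "eob = tyob C gi \<circ> snd"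

lemma eob_pair [simp]: "eob (x, A) = tob A"
  by (simp add: eob_def)

abbreviation meaning :: "'g ctx \<Rightarrow> ('g, 'f) tm \<Rightarrow> 'g ty \<Rightarrow> 'm \<Rightarrow> bool" where
  "meaning \<equiv> interp S C gi fi"

lemma tob_Ob [simp]: "is_type S A \<Longrightarrow> tob A \<in> Ob C"
  using interpr by (induction A) (auto simp: is_type_def is_interpretation_def)

lemma is_type_simps [simp]:
  "is_type S Unit" "is_type S (Tensor A B) \<longleftrightarrow> is_type S A \<and> is_type S B"
  "is_type S (Lolli A B) \<longleftrightarrow> is_type S A \<and> is_type S B"
  by (auto simp: is_type_def)

text \<open>An identity in \<open>C\<close>: only the bookkeeping of the lists changes, from two
  objects to their tensor. The next three definitions do the same for the reverse direction and for
  the unit against the empty list.\<close>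

definition pairing :: "'g ty \<Rightarrow> 'g ty \<Rightarrow> ('o, 'm) strict_arrow" where
  "pairing A B = Strict [tob A, tob B] (idn C (tob A \<odot> tob B)) [tob (Tensor A B)]"

definition unpairing :: "'g ty \<Rightarrow> 'g ty \<Rightarrow> ('o, 'm) strict_arrow" where
  "unpairing A B = Strict [tob (Tensor A B)] (idn C (tob A \<odot> tob B)) [tob A, tob B]"

definition unit_intro :: "('o, 'm) strict_arrow" where
  "unit_intro = Strict [] (idn C \<I>) [\<I>]"

definition unit_elim :: "('o, 'm) strict_arrow" where
  "unit_elim = Strict [\<I>] (idn C \<I>) []"

lemma structural_arr [simp]:
  "sdom (pairing A B) = [tob A, tob B]" "scod (pairing A B) = [tob A \<odot> tob B]"
  "sdom (unpairing A B) = [tob A \<odot> tob B]" "scod (unpairing A B) = [tob A, tob B]"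
  "sdom unit_intro = []" "scod unit_intro = [\<I>]" "sdom unit_elim = [\<I>]" "scod unit_elim = []"
  "\<lbrakk>is_type S A; is_type S B\<rbrakk> \<Longrightarrow> arr (pairing A B)"
  "\<lbrakk>is_type S A; is_type S B\<rbrakk> \<Longrightarrow> arr (unpairing A B)"
  "arr unit_intro" "arr unit_elim"
  "\<lbrakk>is_type S A; is_type S B\<rbrakk> \<Longrightarrow> pairing A B \<bullet> unpairing A B = ide [tob A \<odot> tob B]"
  "\<lbrakk>is_type S A; is_type S B\<rbrakk> \<Longrightarrow> unpairing A B \<bullet> pairing A B = ide [tob A, tob B]"
  "unit_intro \<bullet> unit_elim = ide [\<I>]" "unit_elim \<bullet> unit_intro = ide []"
  by (auto simp: pairing_def unpairing_def unit_intro_def unit_elim_def comp_def ide_def intro!: arrI)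

text \<open>
  All term formers without binders are treated uniformly: \<open>former t vs As B \<phi>\<close> states that \<open>t\<close> is
  built from immediate subterms \<open>vs\<close> of types \<open>As\<close>, has type \<open>B\<close>, and is interpreted by composing
  the tensor of the interpretations of \<open>vs\<close> with \<open>\<phi>\<close>.
\<close>

inductive former ::
  "('g, 'f) tm \<Rightarrow> ('g, 'f) tm list \<Rightarrow> 'g ty list \<Rightarrow> 'g ty \<Rightarrow> ('o, 'm) strict_arrow \<Rightarrow> bool" where
  Op: "\<lbrakk>f \<in> ops S; length vs = length (args S f)\<rbrakk> \<Longrightarrow>
    former (Op f vs) vs (args S f) (res S f) (Strict (map tob (args S f)) (fi f) [tob (res S f)])"
| Star: "former Star [] [] Unit unit_intro"
| To: "is_type S A \<Longrightarrow> former (To v w) [v, w] [Unit, A] A (unit_elim \<star> ide [tob A])"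
| Tens: "\<lbrakk>is_type S A; is_type S B\<rbrakk> \<Longrightarrow> former (Tens v w) [v, w] [A, B] (Tensor A B) (pairing A B)"
| App: "\<lbrakk>is_type S A; is_type S B\<rbrakk> \<Longrightarrow> former (App v w) [v, w] [Lolli A B, A] B (sev (tob A) (tob B))"

lemma former_length: "former t vs As B \<phi> \<Longrightarrow> length vs = length As"
  by (induction rule: former.induct) auto

lemma former_arr:
  assumes "former t vs As B \<phi>"
  shows "arr \<phi>" "sdom \<phi> = map tob As" "scod \<phi> = [tob B]" "is_type S B" "\<forall>A\<in>set As. is_type S A"
proof -
  have "arr \<phi> \<and> sdom \<phi> = map tob As \<and> scod \<phi> = [tob B] \<and> is_type S B \<and> (\<forall>A\<in>set As. is_type S A)"
    using assms
  proof (cases rule: former.cases)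
    case (Op f)
    then show ?thesis
      using sig interpr by (auto simp: is_signature_def is_interpretation_def arr_def)
  qed auto
  then show "arr \<phi>" "sdom \<phi> = map tob As" "scod \<phi> = [tob B]" "is_type S B" "\<forall>A\<in>set As. is_type S A"
    by auto
qed

lemma former_subst: "former t vs As B \<phi> \<Longrightarrow> former (subst \<sigma> t) (map (subst \<sigma>) vs) As B \<phi>"
  by (induction rule: former.induct) (auto intro: former.intros)

lemma former_fv: "former t vs As B \<phi> \<Longrightarrow> fv t = (\<Union>v\<in>set vs. fv v)"
  by (induction rule: former.induct) auto

lemma former_closed_at: "former t vs As B \<phi> \<Longrightarrow> (\<And>v. v \<in> set vs \<Longrightarrow> closed_at k v) \<Longrightarrow> closed_at k t"
  by (induction rule: former.induct) auto

lemma former_subterms: "\<lbrakk>former t vs As B \<phi>; former t vs' As' B' \<phi>'\<rbrakk> \<Longrightarrow> vs = vs'"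
  by (auto elim!: former.cases)

text \<open>The argument types have to agree beforehand, since \<open>App v w\<close> alone leaves
  them open; they come from the denotations of the subterms.\<close>

lemma former_unique: "\<lbrakk>former t vs As B \<phi>; former t vs' As B' \<phi>'\<rbrakk> \<Longrightarrow> B = B' \<and> \<phi> = \<phi>'"
  by (auto elim!: former.cases)

lemma not_former [simp]:
  "\<not> former (Var x) vs As B \<phi>" "\<not> former (Pm v x y w) vs As B \<phi>" "\<not> former (Lam x A v) vs As B \<phi>"
  by (auto simp: Pm_def Lam_def elim: former.cases)

text \<open>
  Compared with \<^const>\<open>interp\<close>, the context of a term may be an arbitrary permutation of the
  concatenated contexts of its subterms. This makes the relation closed under exchange, whereas it
  still determines the morphism.
\<close>

inductive den :: "'g ctx \<Rightarrow> ('g, 'f) tm \<Rightarrow> 'g ty \<Rightarrow> ('o, 'm) strict_arrow \<Rightarrow> bool" where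
  Node: "\<lbrakk>former t vs As B \<phi>; length \<Gamma>s = length As; length Ms = length As;
      \<forall>i<length As. den (\<Gamma>s ! i) (vs ! i) (As ! i) (Ms ! i); mset E = mset (concat \<Gamma>s); is_ctx E\<rbrakk>
    \<Longrightarrow> den E t B (\<phi> \<bullet> tens_list Ms \<bullet> perm eob E (concat \<Gamma>s))"
| Var: "is_type S A \<Longrightarrow> den [(x, A)] (Var x) A (ide [tob A])"
| Pm: "\<lbrakk>den \<Gamma> v (Tensor A B) M; den (\<Delta> @ [(x, A), (y, B)]) w D N; mset E = mset (\<Delta> @ \<Gamma>); is_ctx E\<rbrakk>
    \<Longrightarrow> den E (Pm v x y w) D
          (N \<bullet> (ide (map eob \<Delta>) \<star> (unpairing A B \<bullet> M)) \<bullet> perm eob E (\<Delta> @ \<Gamma>))"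
| Lam: "den (\<Gamma> @ [(x, A)]) v B M \<Longrightarrow> den \<Gamma> (Lam x A v) (Lolli A B) (scurry (map eob \<Gamma>) (tob A) M)"

lemma eob_Ob: "\<forall>e\<in>set E. is_type S (snd e) \<Longrightarrow> obs eob E"
  by (auto simp: eob_def)

text \<open>The assumptions list separate facts about the components rather than \<open>den\<close>,
  so that they can be fed from the induction hypotheses of \<open>den_props\<close>.\<close>

lemma den_subterms:
  assumes "former t vs As B \<phi>" "length \<Gamma>s = length As" "length Ms = length As"
    "\<And>i. i < length As \<Longrightarrow> is_ctx (\<Gamma>s ! i) \<and> (\<forall>e\<in>set (\<Gamma>s ! i). is_type S (snd e)) \<and>
      fst ` set (\<Gamma>s ! i) = fv (vs ! i) \<and> closed_at 0 (vs ! i) \<and>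
      arr (Ms ! i) \<and> sdom (Ms ! i) = map eob (\<Gamma>s ! i) \<and> scod (Ms ! i) = [tob (As ! i)]"
  shows "fst ` set (concat \<Gamma>s) = fv t" "closed_at 0 t" "\<forall>e\<in>set (concat \<Gamma>s). is_type S (snd e)"
    "\<forall>M\<in>set Ms. arr M" "map sdom Ms = map (map eob) \<Gamma>s" "map scod Ms = map (\<lambda>A. [tob A]) As"
proof -
  note len = former_length [OF assms(1)] assms(2,3)
  have set: "set \<Gamma>s = (!) \<Gamma>s ` {..<length As}"
    by (auto simp: set_conv_nth len)
  have "fst ` set (concat \<Gamma>s) = (\<Union>i<length As. fst ` set (\<Gamma>s ! i))"
    unfolding set_concat set by auto
  also have "\<dots> = (\<Union>i<length As. fv (vs ! i))"
    using assms(4) by simp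
  also have "\<dots> = fv t"
    unfolding former_fv [OF assms(1)] by (auto simp: set_conv_nth len)
  finally show "fst ` set (concat \<Gamma>s) = fv t" .
  show "closed_at 0 t"
    using assms(4) by (intro former_closed_at [OF assms(1)]) (auto simp: in_set_conv_nth len)
  show "\<forall>e\<in>set (concat \<Gamma>s). is_type S (snd e)"
    using assms(4) unfolding set_concat set by blast
  show "\<forall>M\<in>set Ms. arr M"
    using assms(4) by (auto simp: in_set_conv_nth len)
  show "map sdom Ms = map (map eob) \<Gamma>s" "map scod Ms = map (\<lambda>A. [tob A]) As"
    using assms(4) by (auto intro!: nth_equalityI simp: len)
qed

text \<open>That the names of the context are exactly the free variables is the trace of linearity
  on which uniqueness of denotations rests; local closedness is recorded for inverting
  binders.\<close>

lemma den_props: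
  "den E t A M \<Longrightarrow> is_ctx E \<and> (\<forall>e\<in>set E. is_type S (snd e)) \<and> fst ` set E = fv t \<and> closed_at 0 t \<and>
    is_type S A \<and> arr M \<and> sdom M = map eob E \<and> scod M = [tob A]"
proof (induction rule: den.induct)
  case (Node t vs As B \<phi> \<Gamma>s Ms E)
  have *: "fst ` set (concat \<Gamma>s) = fv t" "closed_at 0 t" "\<forall>e\<in>set (concat \<Gamma>s). is_type S (snd e)"
    "\<forall>M\<in>set Ms. arr M" "map sdom Ms = map (map eob) \<Gamma>s" "map scod Ms = map (\<lambda>A. [tob A]) As"
    using Node.IH by (intro den_subterms [OF Node.hyps(1-3)]; blast)+
  note phi = former_arr [OF Node.hyps(1)]
  have set: "set E = set (concat \<Gamma>s)"
    using Node.hyps(4) by (rule mset_eq_setD)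
  then have types: "\<forall>e\<in>set E. is_type S (snd e)"
    using *(3) by simp
  have "concat (map (\<lambda>A. [tob A]) As) = map tob As"
    by (induction As) auto
  then have "arr (\<phi> \<bullet> tens_list Ms \<bullet> perm eob E (concat \<Gamma>s))"
    using * phi eob_Ob [OF types] Node.hyps(4) by (auto simp: map_concat)
  then show ?case
    using * phi types set Node.hyps by auto
next
  case (Var A x)
  then show ?case by (auto simp: is_ctx_def)
next
  case (Pm \<Gamma> v A B M \<Delta> x y w D N E)
  have set: "set E = set (\<Delta> @ \<Gamma>)"
    using Pm.hyps(3) by (rule mset_eq_setD)
  have types: "\<forall>e\<in>set E. is_type S (snd e)"
    using Pm.IH unfolding set by auto
  then have "obs eob \<Delta>" "obs eob E"
    using eob_Ob [of \<Delta>] eob_Ob [of E] set by auto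
  then have "arr (N \<bullet> (ide (map eob \<Delta>) \<star> (unpairing A B \<bullet> M)) \<bullet> perm eob E (\<Delta> @ \<Gamma>))"
    using Pm.IH Pm.hyps(3) by auto
  moreover have "fst ` set E = fv (Pm v x y w)"
  proof -
    have "fst ` set \<Delta> = fv w - {x, y}"
      using Pm.IH(2) by (auto simp: is_ctx_append)
    then show ?thesis
      using Pm.IH(1) unfolding set by auto
  qed
  ultimately show ?case
    using Pm.IH Pm.hyps types by auto
next
  case (Lam \<Gamma> x A v B M)
  then have "fst ` set \<Gamma> = fv v - {x}"
    by (auto simp: is_ctx_append)
  moreover have "arr (scurry (map eob \<Gamma>) (tob A) M)" "scod (scurry (map eob \<Gamma>) (tob A) M) = [tob (Lolli A B)]"
    using Lam by (auto intro!: arr_scurry)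
  ultimately show ?case
    using Lam by (auto simp: is_ctx_append)
qed

lemma den_ctx: "den E t A M \<Longrightarrow> is_ctx E"
  and den_distinct: "den E t A M \<Longrightarrow> distinct E"
  and den_types: "den E t A M \<Longrightarrow> e \<in> set E \<Longrightarrow> is_type S (snd e)"
  and den_fv: "den E t A M \<Longrightarrow> fst ` set E = fv t"
  and den_closed: "den E t A M \<Longrightarrow> closed_at 0 t"
  and den_type: "den E t A M \<Longrightarrow> is_type S A"
  and den_arr: "den E t A M \<Longrightarrow> arr M"
  and den_dom: "den E t A M \<Longrightarrow> sdom M = map eob E"
  and den_cod: "den E t A M \<Longrightarrow> scod M = [tob A]"
  using den_props is_ctx_distinct by (blast | metis)+

lemma den_objs: "den E t A M \<Longrightarrow> obs eob E"
  by (intro eob_Ob ballI) (rule den_types)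

lemma den_list:
  assumes "former t vs As B \<phi>" "length \<Gamma>s = length As" "length Ms = length As"
    "\<forall>i<length As. den (\<Gamma>s ! i) (vs ! i) (As ! i) (Ms ! i)"
  shows "\<forall>M\<in>set Ms. arr M" "map sdom Ms = map (map eob) \<Gamma>s" "concat (map scod Ms) = map tob As"
    "arr (\<phi> \<bullet> tens_list Ms)" "objs (map eob (concat \<Gamma>s))"
proof -
  have *: "\<forall>M\<in>set Ms. arr M" "map sdom Ms = map (map eob) \<Gamma>s" "map scod Ms = map (\<lambda>A. [tob A]) As"
    "\<forall>e\<in>set (concat \<Gamma>s). is_type S (snd e)"
    using assms(4) den_props by (intro den_subterms [OF assms(1-3)]; blast)+
  then show "\<forall>M\<in>set Ms. arr M" "map sdom Ms = map (map eob) \<Gamma>s"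
    by auto
  have "concat (map (\<lambda>A. [tob A]) As) = map tob As"
    by (induction As) auto
  then show "concat (map scod Ms) = map tob As"
    using * by simp
  then show "arr (\<phi> \<bullet> tens_list Ms)"
    using * former_arr [OF assms(1)] by auto
  show "objs (map eob (concat \<Gamma>s))"
    using eob_Ob [OF *(4)] by simp
qed

text \<open>At nodes and at \<open>Pm\<close> the new permutation merges with the old one by
  \<open>perm_comp\<close>. At a lambda it is extended by an identity on the bound variable and
  taken out of the currying by naturality.\<close>

lemma den_exchange:
  "\<lbrakk>den E t A M; mset E' = mset E\<rbrakk> \<Longrightarrow> den E' t A (M \<bullet> perm eob E' E)"
proof (induction arbitrary: E' rule: den.induct)
  case (Node t vs As B \<phi> \<Gamma>s Ms E)
  have dens: "\<forall>i<length As. den (\<Gamma>s ! i) (vs ! i) (As ! i) (Ms ! i)"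
    using Node.IH by blast
  note l = den_list [OF Node.hyps(1-3) dens]
  have E': "mset E' = mset (concat \<Gamma>s)" "is_ctx E'"
    using Node is_ctx_mset [of E' E] by auto
  have "obs eob (concat \<Gamma>s)"
    using l(5) by auto
  then have obs: "obs eob E'" "obs eob E"
    using mset_eq_setD [OF E'(1)] mset_eq_setD [OF Node.hyps(4)] by auto
  have dist: "distinct (concat \<Gamma>s)"
    using is_ctx_mset [OF E'(1)] E'(2) is_ctx_distinct by blast
  have "(\<phi> \<bullet> tens_list Ms \<bullet> perm eob E (concat \<Gamma>s)) \<bullet> perm eob E' E
      = \<phi> \<bullet> tens_list Ms \<bullet> (perm eob E (concat \<Gamma>s) \<bullet> perm eob E' E)"
    using l obs Node.prems Node.hyps(4) former_arr(1,2) [OF Node.hyps(1)] by (simp add: comp_assoc map_concat)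
  also have "perm eob E (concat \<Gamma>s) \<bullet> perm eob E' E = perm eob E' (concat \<Gamma>s)"
    using obs Node dist by (intro perm_comp) auto
  finally show ?case
    using den.Node [OF Node.hyps(1-3) dens E'] by simp
next
  case (Var A x)
  then have "E' = [(x, A)]" by auto
  then show ?case
    using den.Var [OF Var.hyps, of x] Var.hyps by simp
next
  case (Pm \<Gamma> v A B M \<Delta> x y w D N E)
  have E': "mset E' = mset (\<Delta> @ \<Gamma>)" "is_ctx E'"
    using Pm is_ctx_mset [of E' E] by auto
  note p = den_props [OF Pm.hyps(1)] den_props [OF Pm.hyps(2)]
  have "obs eob (\<Delta> @ \<Gamma>)"
    using den_objs [OF Pm.hyps(1)] den_objs [OF Pm.hyps(2)] by auto
  then have obs: "obs eob E'" "obs eob E" "obs eob \<Delta>"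
    using mset_eq_setD [OF E'(1)] mset_eq_setD [OF Pm.hyps(3)] by auto
  have dist: "distinct (\<Delta> @ \<Gamma>)"
    using is_ctx_mset [OF E'(1)] E'(2) is_ctx_distinct by blast
  have "(N \<bullet> (ide (map eob \<Delta>) \<star> (unpairing A B \<bullet> M)) \<bullet> perm eob E (\<Delta> @ \<Gamma>)) \<bullet> perm eob E' E
      = N \<bullet> (ide (map eob \<Delta>) \<star> (unpairing A B \<bullet> M)) \<bullet> (perm eob E (\<Delta> @ \<Gamma>) \<bullet> perm eob E' E)"
    using p obs Pm.prems Pm.hyps(3) by (simp add: comp_assoc)
  also have "perm eob E (\<Delta> @ \<Gamma>) \<bullet> perm eob E' E = perm eob E' (\<Delta> @ \<Gamma>)"
    using obs Pm dist by (intro perm_comp) auto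
  finally show ?case
    using den.Pm [OF Pm.hyps(1,2) E'] by simp
next
  case (Lam \<Gamma> x A v B M)
  note p = den_props [OF Lam.hyps]
  have obs: "obs eob \<Gamma>" "tob A \<in> Ob C" "obs eob E'"
    using den_objs [OF Lam.hyps] mset_eq_setD [OF Lam.prems] by auto
  have "perm eob (E' @ [(x, A)]) (\<Gamma> @ [(x, A)]) = perm eob E' \<Gamma> \<star> ide [tob A]"
    using perm_ten [of E' \<Gamma> "[(x, A)]" "[(x, A)]" eob] Lam.prems obs is_ctx_distinct [of "\<Gamma> @ [(x, A)]"] p by auto
  then have "den (E' @ [(x, A)]) v B (M \<bullet> (perm eob E' \<Gamma> \<star> ide [tob A]))"
    using Lam.IH [of "E' @ [(x, A)]"] Lam.prems by simp
  from den.Lam [OF this]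
  have "den E' (Lam x A v) (Lolli A B) (scurry (map eob E') (tob A) (M \<bullet> (perm eob E' \<Gamma> \<star> ide [tob A])))" .
  also have "scurry (map eob E') (tob A) (M \<bullet> (perm eob E' \<Gamma> \<star> ide [tob A]))
     = scurry (map eob \<Gamma>) (tob A) M \<bullet> perm eob E' \<Gamma>"
    using scurry_natural [of M "map eob \<Gamma>" "tob A" "tob B" "perm eob E' \<Gamma>"] p Lam.prems obs by simp
  finally show ?case .
qed

end

section \<open>Substitution and uniqueness of denotations\<close>

context symmetric_monoidal_category
begin

lemma tens_list_perm:
  "\<lbrakk>list_all2 (\<lambda>G H. mset G = mset H) Gs Hs; distinct (concat Hs); objs (map ob (concat Gs))\<rbrakk> \<Longrightarrow>
    tens_list (map2 (perm ob) Gs Hs) = perm ob (concat Gs) (concat Hs) \<and> mset (concat Gs) = mset (concat Hs)"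
proof (induction Gs Hs rule: list_all2_induct)
  case (Cons G Gs H Hs)
  then show ?case
    using perm_ten [of G H "concat Gs" "concat Hs" ob] by auto
qed simp

lemma tens_list_ide:
  "obs ob E \<Longrightarrow> tens_list (map (\<lambda>e. ide [ob e]) E) = ide (map ob E)"
  by (induction E) auto

end

context linear_model
begin

lemma den_var: "is_type S (snd e) \<Longrightarrow> den [e] (Var (fst e)) (snd e) (ide [eob e])"
  using den.Var [of "snd e" "fst e"] by (cases e) simp

lemma family_arr:
  assumes "\<forall>e\<in>set G. den (D e) (\<sigma> e) (snd e) (m e)"
  shows "arr (tens_list (map m G))" "sdom (tens_list (map m G)) = map eob (concat (map D G))"
    "scod (tens_list (map m G)) = map eob G" "obs eob (concat (map D G))"
    "fst ` set (concat (map D G)) = (\<Union>e\<in>set G. fv (\<sigma> e))"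
proof -
  have "arr (tens_list (map m G)) \<and> sdom (tens_list (map m G)) = map eob (concat (map D G))
    \<and> scod (tens_list (map m G)) = map eob G \<and> fst ` set (concat (map D G)) = (\<Union>e\<in>set G. fv (\<sigma> e))"
    using assms
  proof (induction G)
    case (Cons e G)
    then have "den (D e) (\<sigma> e) (snd e) (m e)" by simp
    from den_props [OF this] Cons show ?case
      by (cases e) (auto simp: image_Un)
  qed simp
  then show "arr (tens_list (map m G))" "sdom (tens_list (map m G)) = map eob (concat (map D G))"
    "scod (tens_list (map m G)) = map eob G" "fst ` set (concat (map D G)) = (\<Union>e\<in>set G. fv (\<sigma> e))"
    by auto
  then show "obs eob (concat (map D G))"
    using arrD(1) [of "tens_list (map m G)"] by simp
qed

lemma family_update:
  assumes "\<forall>e\<in>set G. den (D e) (\<sigma> (fst e)) (snd e) (m e)" "x \<notin> fst ` set G"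
  shows "\<forall>e\<in>set G. den ((D((x, A) := d)) e) ((\<sigma>(x := s)) (fst e)) (snd e) ((m((x, A) := k)) e)"
  using assms by force

lemma fresh_name: "\<exists>x. x \<notin> fst ` set (\<Gamma> :: (nat \<times> 'z) list)"
  using ex_new_if_finite [OF infinite_UNIV_nat, of "fst ` set \<Gamma>"] by simp

text \<open>The substitution is simultaneous: every entry \<open>e\<close> is replaced by a term
  over its own block \<open>D e\<close>. In this generality a bound variable is one more entry, with
  a fresh variable as its substitute, and permutations pass by \<open>perm_natural\<close>.\<close>

lemma den_subst:
  "\<lbrakk>den \<Gamma> t A M; \<forall>e\<in>set \<Gamma>. den (D e) (\<sigma> (fst e)) (snd e) (m e); is_ctx (concat (map D \<Gamma>))\<rbrakk> \<Longrightarrow>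
    den (concat (map D \<Gamma>)) (subst \<sigma> t) A (M \<bullet> tens_list (map m \<Gamma>))"
proof (induction arbitrary: D \<sigma> m rule: den.induct)
  case (Node t vs As B \<phi> \<Gamma>s Ms E)
  let ?D = "\<lambda>\<Gamma>. concat (map D \<Gamma>)" and ?m = "\<lambda>\<Gamma>. tens_list (map m \<Gamma>)"
  have dens: "\<forall>i<length As. den (\<Gamma>s ! i) (vs ! i) (As ! i) (Ms ! i)"
    using Node.IH by blast
  note l = den_list [OF Node.hyps(1-3) dens] and len = former_length [OF Node.hyps(1)] Node.hyps(2,3)
  have set: "set E = set (concat \<Gamma>s)"
    using Node.hyps(4) by (rule mset_eq_setD)
  have ms: "mset (?D E) = mset (?D (concat \<Gamma>s))"
    using Node.hyps(4) by (rule mset_concat_map_cong)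
  have DD: "?D (concat \<Gamma>s) = concat (map ?D \<Gamma>s)"
    by (induction \<Gamma>s) auto
  have ctx: "is_ctx (concat (map ?D \<Gamma>s))"
    using Node.prems(2) is_ctx_mset [OF ms] DD by simp
  note famE = family_arr [OF Node.prems(1)]
  have fam: "\<forall>e\<in>set (concat \<Gamma>s). den (D e) (\<sigma> (fst e)) (snd e) (m e)"
    using Node.prems(1) set by simp
  note famC = family_arr [OF fam]
  have fam_i: "\<forall>e\<in>set (\<Gamma>s ! i). den (D e) (\<sigma> (fst e)) (snd e) (m e)" if "i < length As" for i
    using fam that len by auto
  \<comment> \<open>The subterms after substitution: each old denotation preceded by the part of the
    family over its own context.\<close>
  define Ms' where "Ms' = map2 (\<bullet>) Ms (map ?m \<Gamma>s)"
  have "list_all2 (\<lambda>g f. arr g \<and> arr f \<and> scod f = sdom g) Ms (map ?m \<Gamma>s)"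
    unfolding list_all2_conv_all_nth
  proof (intro conjI allI impI)
    fix i assume i: "i < length Ms"
    then have "den (\<Gamma>s ! i) (vs ! i) (As ! i) (Ms ! i)"
      using dens len by simp
    then show "arr (Ms ! i)" "arr (map ?m \<Gamma>s ! i)" "scod (map ?m \<Gamma>s ! i) = sdom (Ms ! i)"
      using family_arr [OF fam_i, of i] i len by (auto simp: den_arr den_dom simp del: tens_list_dom_cod)
  qed (simp add: len)
  from tens_list_comp [OF this] have T: "tens_list Ms' = tens_list Ms \<bullet> tens_list (map ?m \<Gamma>s)"
    by (simp add: Ms'_def)
  have "\<forall>\<Gamma>\<in>set \<Gamma>s. \<forall>e\<in>set \<Gamma>. arr (m e)"
    using fam by (fastforce intro: den_arr)
  then have "tens_list (map ?m \<Gamma>s) = ?m (concat \<Gamma>s)"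
    using tens_list_concat [of "map (map m) \<Gamma>s"] by (simp add: map_concat o_def)
  with T have T: "tens_list Ms' = tens_list Ms \<bullet> ?m (concat \<Gamma>s)" by simp
  have "den (?D E) (subst \<sigma> t) B (\<phi> \<bullet> tens_list Ms' \<bullet> perm eob (?D E) (concat (map ?D \<Gamma>s)))"
  proof (rule den.Node [OF former_subst [OF Node.hyps(1)]])
    show "\<forall>i<length As. den (map ?D \<Gamma>s ! i) (map (subst \<sigma>) vs ! i) (As ! i) (Ms' ! i)"
    proof (intro allI impI)
      fix i assume i: "i < length As"
      have "is_ctx (?D (\<Gamma>s ! i))"
        using is_ctx_concat [OF ctx] i len by simp
      then show "den (map ?D \<Gamma>s ! i) (map (subst \<sigma>) vs ! i) (As ! i) (Ms' ! i)"
        using Node.IH fam_i [OF i] i len by (simp add: Ms'_def)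
    qed
  qed (use len ms DD Node.prems(2) in \<open>auto simp: Ms'_def\<close>)
  also have "\<phi> \<bullet> tens_list Ms' \<bullet> perm eob (?D E) (concat (map ?D \<Gamma>s))
     = \<phi> \<bullet> tens_list Ms \<bullet> (?m (concat \<Gamma>s) \<bullet> perm eob (?D E) (?D (concat \<Gamma>s)))"
  proof -
    have "arr (perm eob (?D E) (?D (concat \<Gamma>s)))"
      using ms famE(4) by (intro arr_perm) auto
    then show ?thesis
      unfolding T DD [symmetric] using l famC former_arr(1,2) [OF Node.hyps(1)]
      by (simp add: comp_assoc map_concat)
  qed
  \<comment> \<open>Naturality trades the permutation of the blocks for the permutation of the
    original entries, which belongs to the denotation before substitution.\<close>
  also have "?m (concat \<Gamma>s) \<bullet> perm eob (?D E) (?D (concat \<Gamma>s)) = perm eob E (concat \<Gamma>s) \<bullet> ?m E"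
  proof (rule perm_natural [symmetric])
    show "arr (m e) \<and> sdom (m e) = map eob (D e) \<and> scod (m e) = [eob e]" if "e \<in> set E" for e
      using Node.prems(1) den_props that by (cases e) fastforce
  qed (use Node.hyps Node.prems(2) is_ctx_distinct in auto)
  also have "\<phi> \<bullet> tens_list Ms \<bullet> perm eob E (concat \<Gamma>s) \<bullet> ?m E = (\<phi> \<bullet> tens_list Ms \<bullet> perm eob E (concat \<Gamma>s)) \<bullet> ?m E"
  proof -
    have "arr (perm eob E (concat \<Gamma>s))"
      using Node.hyps(4) l(5) set by (intro arr_perm) auto
    then show ?thesis
      using l famE former_arr(1,2) [OF Node.hyps(1)] by (simp add: comp_assoc map_concat)
  qed
  finally show ?case .
next
  case (Var A x)
  then have "den (D (x, A)) (\<sigma> x) A (m (x, A))" by simp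
  from den_arr [OF this] den_cod [OF this] this show ?case
    by simp
next
  case (Pm \<Gamma> v A B M \<Delta> x y w W N E)
  let ?D = "\<lambda>\<Gamma>. concat (map D \<Gamma>)" and ?m = "\<lambda>\<Gamma>. tens_list (map m \<Gamma>)"
  note p = den_props [OF Pm.hyps(1)] den_props [OF Pm.hyps(2)]
  have set: "set E = set (\<Delta> @ \<Gamma>)"
    using Pm.hyps(3) by (rule mset_eq_setD)
  have ms: "mset (?D E) = mset (?D (\<Delta> @ \<Gamma>))"
    using Pm.hyps(3) by (rule mset_concat_map_cong)
  have ctx: "is_ctx (?D \<Delta> @ ?D \<Gamma>)"
    using Pm.prems(2) is_ctx_mset [OF ms] by simp
  \<comment> \<open>The bound variables receive names outside the contexts of the terms substituted
    over \<open>\<Delta>\<close>, so that the substitution passes under the binder by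
    \<open>subst_Pm\<close>.\<close>
  obtain x' where x': "x' \<notin> fst ` set (?D \<Delta>)"
    using fresh_name by blast
  obtain y' where y': "y' \<notin> fst ` set ((x', A) # ?D \<Delta>)"
    using fresh_name by blast
  have fam: "\<forall>e\<in>set \<Gamma>. den (D e) (\<sigma> (fst e)) (snd e) (m e)" "\<forall>e\<in>set \<Delta>. den (D e) (\<sigma> (fst e)) (snd e) (m e)"
    using Pm.prems(1) set by auto
  note famE = family_arr [OF Pm.prems(1)] and famG = family_arr [OF fam(1)] and famD = family_arr [OF fam(2)]
  have xy: "x \<noteq> y" "x \<notin> fst ` set \<Delta>" "y \<notin> fst ` set \<Delta>"
    using p by (auto simp: is_ctx_append is_ctx_def)
  \<comment> \<open>The family is extended to the bound variables: one-entry blocks with the fresh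
    names, interpreted by identities.\<close>
  let ?D' = "D((x, A) := [(x', A)], (y, B) := [(y', B)])" and ?\<sigma>' = "\<sigma>(x := Var x', y := Var y')"
    and ?m' = "m((x, A) := ide [tob A], (y, B) := ide [tob B])"
  have nin: "(x, A) \<notin> set \<Delta>" "(y, B) \<notin> set \<Delta>"
    using xy by force+
  have D': "concat (map ?D' (\<Delta> @ [(x, A), (y, B)])) = ?D \<Delta> @ [(x', A), (y', B)]"
    using nin xy by simp
  have types: "is_type S A" "is_type S B"
    using p by auto
  have "tens_list (map ?m' (\<Delta> @ [(x, A), (y, B)])) = ?m \<Delta> \<star> ide [tob A, tob B]"
    using nin xy types fam(2) den_arr by (subst map_append, subst tens_list_append) auto
  moreover have "den (?D \<Delta> @ [(x', A), (y', B)]) (subst ?\<sigma>' w) W (N \<bullet> tens_list (map ?m' (\<Delta> @ [(x, A), (y, B)])))"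
    unfolding D' [symmetric]
  proof (rule Pm.IH(2))
    show "is_ctx (concat (map ?D' (\<Delta> @ [(x, A), (y, B)])))"
      unfolding D' using ctx x' y' by (auto simp: is_ctx_append is_ctx_def)
    have "\<forall>e\<in>set \<Delta>. den (?D' e) (?\<sigma>' (fst e)) (snd e) (?m' e)"
      using fam(2) xy by (intro family_update)
    then show "\<forall>e\<in>set (\<Delta> @ [(x, A), (y, B)]). den (?D' e) (?\<sigma>' (fst e)) (snd e) (?m' e)"
      using xy types by (auto intro: den.Var)
  qed
  ultimately have w: "den (?D \<Delta> @ [(x', A), (y', B)]) (subst ?\<sigma>' w) W (N \<bullet> (?m \<Delta> \<star> ide [tob A, tob B]))"
    by simp
  have v: "den (?D \<Gamma>) (subst \<sigma> v) (Tensor A B) (M \<bullet> ?m \<Gamma>)"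
    using ctx fam by (intro Pm.IH(1)) (auto simp: is_ctx_append)
  have sub: "subst \<sigma> (Pm v x y w) = Pm (subst \<sigma> v) x' y' (subst ?\<sigma>' w)"
  proof (rule subst_Pm)
    fix z assume "z \<in> fv w - {x, y}"
    then have "z \<in> fst ` set \<Delta>"
      using den_fv [OF Pm.hyps(2)] by auto
    then have "fv (\<sigma> z) \<subseteq> fst ` set (?D \<Delta>)"
      unfolding famD(5) by auto
    then show "x' \<notin> fv (\<sigma> z) \<and> y' \<notin> fv (\<sigma> z)"
      using x' y' by auto
  qed (use xy y' in auto)
  have "den (?D E) (subst \<sigma> (Pm v x y w)) W ((N \<bullet> (?m \<Delta> \<star> ide [tob A, tob B])) \<bullet>
      (ide (map eob (?D \<Delta>)) \<star> (unpairing A B \<bullet> M \<bullet> ?m \<Gamma>)) \<bullet> perm eob (?D E) (?D \<Delta> @ ?D \<Gamma>))"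
    unfolding sub using ms Pm.prems(2) by (intro den.Pm [OF v w]) auto
  also have "\<dots> = N \<bullet> ((?m \<Delta> \<star> ide [tob A, tob B]) \<bullet>
      (ide (map eob (?D \<Delta>)) \<star> (unpairing A B \<bullet> M \<bullet> ?m \<Gamma>))) \<bullet> perm eob (?D E) (?D \<Delta> @ ?D \<Gamma>)"
    using p famG famD famE ms types by (simp add: comp_assoc)
  also have "(?m \<Delta> \<star> ide [tob A, tob B]) \<bullet> (ide (map eob (?D \<Delta>)) \<star> (unpairing A B \<bullet> M \<bullet> ?m \<Gamma>))
     = ?m \<Delta> \<star> (unpairing A B \<bullet> M \<bullet> ?m \<Gamma>)"
    using p famG famD types by (subst ten_comp) auto
  also have "\<dots> = (ide (map eob \<Delta>) \<star> (unpairing A B \<bullet> M)) \<bullet> (?m \<Delta> \<star> ?m \<Gamma>)"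
    using p famG famD types den_objs [OF Pm.hyps(2)] by (subst ten_comp) (auto simp: comp_assoc)
  also have "?m \<Delta> \<star> ?m \<Gamma> = ?m (\<Delta> @ \<Gamma>)"
    using fam by (subst map_append, subst tens_list_append) (fastforce intro: den_arr)+
  also have "N \<bullet> ((ide (map eob \<Delta>) \<star> (unpairing A B \<bullet> M)) \<bullet> ?m (\<Delta> @ \<Gamma>)) \<bullet> perm eob (?D E) (?D \<Delta> @ ?D \<Gamma>)
    = N \<bullet> (ide (map eob \<Delta>) \<star> (unpairing A B \<bullet> M)) \<bullet> (?m (\<Delta> @ \<Gamma>) \<bullet> perm eob (?D E) (?D (\<Delta> @ \<Gamma>)))"
  proof -
    have "\<forall>e\<in>set (\<Delta> @ \<Gamma>). den (D e) (\<sigma> (fst e)) (snd e) (m e)"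
      using fam by auto
    note f = family_arr [OF this]
    \<comment> \<open>Both factors are made opaque so that the composite is reassociated without
      splitting them along \<open>\<Delta> @ \<Gamma>\<close>.\<close>
    define T where "T = ?m (\<Delta> @ \<Gamma>)"
    define P where "P = perm eob (?D E) (?D (\<Delta> @ \<Gamma>))"
    have [simp]: "arr T" "sdom T = map eob (?D (\<Delta> @ \<Gamma>))" "scod T = map eob (\<Delta> @ \<Gamma>)"
      "arr P" "scod P = map eob (?D (\<Delta> @ \<Gamma>))"
      using f(1-3) famE(4) ms unfolding T_def P_def by (simp_all del: tens_list_dom_cod map_append)
    have "perm eob (?D E) (?D \<Delta> @ ?D \<Gamma>) = P"
      by (simp add: P_def)
    then show ?thesis
      unfolding T_def [symmetric] P_def [symmetric] using p types den_objs [OF Pm.hyps(2)]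
      by (simp add: comp_assoc)
  qed
  also have "?m (\<Delta> @ \<Gamma>) \<bullet> perm eob (?D E) (?D (\<Delta> @ \<Gamma>)) = perm eob E (\<Delta> @ \<Gamma>) \<bullet> ?m E"
  proof (rule perm_natural [symmetric])
    show "arr (m e) \<and> sdom (m e) = map eob (D e) \<and> scod (m e) = [eob e]" if "e \<in> set E" for e
      using Pm.prems(1) den_props that by (cases e) fastforce
  qed (use Pm.hyps Pm.prems(2) is_ctx_distinct in auto)
  also have "N \<bullet> (ide (map eob \<Delta>) \<star> (unpairing A B \<bullet> M)) \<bullet> perm eob E (\<Delta> @ \<Gamma>) \<bullet> ?m E
    = (N \<bullet> (ide (map eob \<Delta>) \<star> (unpairing A B \<bullet> M)) \<bullet> perm eob E (\<Delta> @ \<Gamma>)) \<bullet> ?m E"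
  proof -
    have "obs eob E"
      unfolding set using den_objs [OF Pm.hyps(1)] den_objs [OF Pm.hyps(2)] by auto
    then show ?thesis
      using p famE types den_objs [OF Pm.hyps(2)] Pm.hyps(3) by (simp add: comp_assoc del: tens_list_dom_cod)
  qed
  finally show ?case .
next
  case (Lam \<Gamma> x A v B M)
  let ?D = "\<lambda>\<Gamma>. concat (map D \<Gamma>)" and ?m = "\<lambda>\<Gamma>. tens_list (map m \<Gamma>)"
  note p = den_props [OF Lam.hyps] and fam = family_arr [OF Lam.prems(1)]
  obtain x' where x': "x' \<notin> fst ` set (?D \<Gamma>)"
    using fresh_name by blast
  have x: "x \<notin> fst ` set \<Gamma>"
    using p by (auto simp: is_ctx_append)
  then have nin: "(x, A) \<notin> set \<Gamma>" by force
  have type: "is_type S A" using p by auto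
  let ?D' = "D((x, A) := [(x', A)])" and ?\<sigma>' = "\<sigma>(x := Var x')" and ?m' = "m((x, A) := ide [tob A])"
  have D': "concat (map ?D' (\<Gamma> @ [(x, A)])) = ?D \<Gamma> @ [(x', A)]"
    using nin by simp
  have "tens_list (map ?m' (\<Gamma> @ [(x, A)])) = ?m \<Gamma> \<star> ide [tob A]"
    using nin type Lam.prems(1) den_arr by (subst map_append, subst tens_list_append) auto
  moreover have "den (?D \<Gamma> @ [(x', A)]) (subst ?\<sigma>' v) B (M \<bullet> tens_list (map ?m' (\<Gamma> @ [(x, A)])))"
    unfolding D' [symmetric]
  proof (rule Lam.IH)
    show "is_ctx (concat (map ?D' (\<Gamma> @ [(x, A)])))"
      unfolding D' using Lam.prems(2) x' by (auto simp: is_ctx_append is_ctx_def)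
    have "\<forall>e\<in>set \<Gamma>. den (?D' e) (?\<sigma>' (fst e)) (snd e) (?m' e)"
      using Lam.prems(1) x by (rule family_update)
    then show "\<forall>e\<in>set (\<Gamma> @ [(x, A)]). den (?D' e) (?\<sigma>' (fst e)) (snd e) (?m' e)"
      using type by (auto intro: den.Var)
  qed
  ultimately have v: "den (?D \<Gamma> @ [(x', A)]) (subst ?\<sigma>' v) B (M \<bullet> (?m \<Gamma> \<star> ide [tob A]))"
    by simp
  have sub: "subst \<sigma> (Lam x A v) = Lam x' A (subst ?\<sigma>' v)"
  proof (rule subst_Lam)
    fix z assume "z \<in> fv v - {x}"
    then have "z \<in> fst ` set \<Gamma>"
      using den_fv [OF Lam.hyps] by auto
    then have "fv (\<sigma> z) \<subseteq> fst ` set (?D \<Gamma>)"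
      unfolding fam(5) by auto
    then show "x' \<notin> fv (\<sigma> z)"
      using x' by auto
  qed
  have "scurry (map eob (?D \<Gamma>)) (tob A) (M \<bullet> (?m \<Gamma> \<star> ide [tob A])) = scurry (map eob \<Gamma>) (tob A) M \<bullet> ?m \<Gamma>"
    using scurry_natural [of M "map eob \<Gamma>" "tob A" "tob B" "?m \<Gamma>"] p fam by (simp del: tens_list_dom_cod)
  with den.Lam [OF v] show ?case
    unfolding sub by simp
qed

text \<open>The shape in which substitution is used: the variables of the prefix
  \<open>\<Theta>\<close> are replaced by themselves, which contributes identities.\<close>

lemma den_subst_suffix:
  assumes t: "den (\<Theta> @ \<Xi>) t B M" and \<Xi>: "\<forall>e\<in>set \<Xi>. den (D e) (\<sigma> (fst e)) (snd e) (m e)"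
    and \<Theta>: "\<forall>e\<in>set \<Theta>. \<sigma> (fst e) = Var (fst e)" and ctx: "is_ctx (\<Theta> @ concat (map D \<Xi>))"
  shows "den (\<Theta> @ concat (map D \<Xi>)) (subst \<sigma> t) B (M \<bullet> (ide (map eob \<Theta>) \<star> tens_list (map m \<Xi>)))"
proof -
  let ?D = "\<lambda>e. if e \<in> set \<Xi> then D e else [e]" and ?m = "\<lambda>e. if e \<in> set \<Xi> then m e else ide [eob e]"
  have "set \<Theta> \<inter> set \<Xi> = {}"
    using is_ctx_distinct [OF den_ctx [OF t]] by simp
  then have maps: "map ?D \<Theta> = map (\<lambda>e. [e]) \<Theta>" "map ?m \<Theta> = map (\<lambda>e. ide [eob e]) \<Theta>"
    "map ?D \<Xi> = map D \<Xi>" "map ?m \<Xi> = map m \<Xi>"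
    by auto
  have D: "concat (map ?D (\<Theta> @ \<Xi>)) = \<Theta> @ concat (map D \<Xi>)"
    by (simp only: map_append maps concat_append) simp
  have arrs: "\<forall>f\<in>set (map (\<lambda>e. ide [eob e]) \<Theta>). arr f"
    using den_objs [OF t] by auto
  have arrs': "\<forall>f\<in>set (map m \<Xi>). arr f"
    using \<Xi> by (fastforce intro: den_arr)
  have m: "tens_list (map ?m (\<Theta> @ \<Xi>)) = ide (map eob \<Theta>) \<star> tens_list (map m \<Xi>)"
    using den_objs [OF t] arrs arrs' by (simp only: map_append maps tens_list_append) (simp add: tens_list_ide image_Un)
  have "den (?D e) (\<sigma> (fst e)) (snd e) (?m e)" if "e \<in> set (\<Theta> @ \<Xi>)" for e
    using \<Xi> \<Theta> den_types [OF t that] den_var [of e] that by (cases "e \<in> set \<Xi>") simp_all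
  then have "\<forall>e\<in>set (\<Theta> @ \<Xi>). den (?D e) (\<sigma> (fst e)) (snd e) (?m e)"
    by blast
  from den_subst [OF t this, unfolded D m, OF ctx] show ?thesis .
qed

lemma den_subst1:
  assumes t: "den (\<Gamma> @ [(x, A)]) t B M" and w: "den \<Delta> w A N" and ctx: "is_ctx (\<Gamma> @ \<Delta>)"
  shows "den (\<Gamma> @ \<Delta>) (subst1 t w x) B (M \<bullet> (ide (map eob \<Gamma>) \<star> N))"
proof -
  have "den (\<Gamma> @ concat (map (\<lambda>_. \<Delta>) [(x, A)])) (subst1 t w x) B (M \<bullet> (ide (map eob \<Gamma>) \<star> tens_list (map (\<lambda>_. N) [(x, A)])))"
    by (rule den_subst_suffix [OF t]) (use den_ctx [OF t] w ctx in \<open>auto simp: is_ctx_append\<close>)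
  then show ?thesis
    using den_arr [OF w] by simp
qed

lemma den_subst2:
  assumes t: "den (\<Theta> @ [(x, A), (y, B)]) t D U" and v: "den \<Gamma> v A M" and w: "den \<Delta> w B N"
    and ctx: "is_ctx (\<Theta> @ \<Gamma> @ \<Delta>)"
  shows "den (\<Theta> @ \<Gamma> @ \<Delta>) (subst2 t v x w y) D (U \<bullet> (ide (map eob \<Theta>) \<star> M \<star> N))"
proof -
  let ?D = "\<lambda>e. if e = (x, A) then \<Gamma> else \<Delta>" and ?m = "\<lambda>e. if e = (x, A) then M else N"
  have xy: "x \<notin> fst ` set \<Theta>" "y \<notin> fst ` set \<Theta>" "x \<noteq> y"
    using den_ctx [OF t] by (auto simp: is_ctx_append is_ctx_def)
  have "den (\<Theta> @ concat (map ?D [(x, A), (y, B)])) (subst2 t v x w y) D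
      (U \<bullet> (ide (map eob \<Theta>) \<star> tens_list (map ?m [(x, A), (y, B)])))"
    by (rule den_subst_suffix [OF t]) (use xy v w ctx in auto)
  then show ?thesis
    using xy den_arr [OF w] by simp
qed

text \<open>A second derivation may order the contexts of subterms differently and choose other
  bound names. The free variables force these contexts to have the same entries, so
  \<open>den_exchange\<close> moves its subderivations to the contexts of the first one, where the
  induction hypothesis applies; the resulting permutations are absorbed by
  \<open>perm_comp\<close>.\<close>

lemma den_unique: "\<lbrakk>den E t A M; den E t A' M'\<rbrakk> \<Longrightarrow> A = A' \<and> M = M'"
proof (induction arbitrary: A' M' rule: den.induct)
  case (Node t vs As B \<phi> \<Gamma>s Ms E)
  have dens: "\<forall>i<length As. den (\<Gamma>s ! i) (vs ! i) (As ! i) (Ms ! i)"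
    using Node.IH by blast
  note l = den_list [OF Node.hyps(1-3) dens] and len = former_length [OF Node.hyps(1)] Node.hyps(2,3)
  from Node.prems show ?case
  proof (cases rule: den.cases)
    case (Node vs' As' \<phi>' \<Gamma>s' Ms')
    note second = this
    have vs: "vs' = vs"
      using former_subterms [OF Node.hyps(1) second(2)] by simp
    note former' = second(2) [unfolded vs]
    note len' = former_length [OF former'] second(3,4)
    have lenAs: "length As' = length As"
      using len len' by simp
    note l' = den_list [OF former' second(3,4) second(5) [unfolded vs]]
    have ctxc: "is_ctx (concat \<Gamma>s)" "is_ctx (concat \<Gamma>s')"
      using is_ctx_mset [OF Node.hyps(4)] is_ctx_mset [OF second(6)] second(7) by auto
    have m: "mset (\<Gamma>s ! i) = mset (\<Gamma>s' ! i)" if i: "i < length As" for i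
    proof (rule mset_eq_of_names)
      have "\<Gamma>s ! i \<in> set \<Gamma>s" "\<Gamma>s' ! i \<in> set \<Gamma>s'"
        using i len len' by auto
      then show "set (\<Gamma>s ! i) \<subseteq> set E" "set (\<Gamma>s' ! i) \<subseteq> set E"
        using mset_eq_setD [OF Node.hyps(4)] mset_eq_setD [OF second(6)] by auto
      show "is_ctx (\<Gamma>s ! i)" "is_ctx (\<Gamma>s' ! i)"
        using dens second(5) i lenAs by (auto intro: den_ctx)
      have "fst ` set (\<Gamma>s ! i) = fv (vs ! i)" "fst ` set (\<Gamma>s' ! i) = fv (vs' ! i)"
        using dens second(5) i lenAs by (auto intro!: den_fv)
      then show "fst ` set (\<Gamma>s ! i) = fst ` set (\<Gamma>s' ! i)"
        by (simp add: vs)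
    qed (fact Node.hyps)
    have eq: "As ! i = As' ! i \<and> Ms ! i = Ms' ! i \<bullet> perm eob (\<Gamma>s ! i) (\<Gamma>s' ! i)" if i: "i < length As" for i
    proof -
      have "den (\<Gamma>s' ! i) (vs ! i) (As' ! i) (Ms' ! i)"
        using second(5) i lenAs vs by simp
      from den_exchange [OF this m [OF i]] show ?thesis
        using Node.IH i by blast
    qed
    then have As: "As' = As"
      using lenAs by (intro nth_equalityI) auto
    have *: "A' = B" "\<phi>' = \<phi>"
      using former_unique [OF Node.hyps(1) former' [unfolded As]] second(1) by auto
    \<comment> \<open>The local discrepancies of order; their tensor is one permutation between the
      two concatenations.\<close>
    let ?P = "map2 (perm eob) \<Gamma>s \<Gamma>s'"
    have "Ms = map2 (\<bullet>) Ms' ?P"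
      using eq len len' As by (intro nth_equalityI) auto
    moreover have "tens_list (map2 (\<bullet>) Ms' ?P) = tens_list Ms' \<bullet> tens_list ?P"
    proof -
      have "list_all2 (\<lambda>g f. arr g \<and> arr f \<and> scod f = sdom g) Ms' ?P"
        unfolding list_all2_conv_all_nth
      proof (intro conjI allI impI)
        fix i assume i: "i < length Ms'"
        then have "den (\<Gamma>s' ! i) (vs' ! i) (As' ! i) (Ms' ! i)" "den (\<Gamma>s ! i) (vs ! i) (As ! i) (Ms ! i)"
          using second dens len' lenAs by auto
        with i show "arr (Ms' ! i)" "arr (?P ! i)" "scod (?P ! i) = sdom (Ms' ! i)"
          using len len' lenAs m [of i] den_objs by (auto simp: den_arr den_dom)
      qed (use len len' As in simp)
      from tens_list_comp [OF this] show ?thesis by simp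
    qed
    moreover have P: "tens_list ?P = perm eob (concat \<Gamma>s) (concat \<Gamma>s') \<and> mset (concat \<Gamma>s) = mset (concat \<Gamma>s')"
      using m len len' As l(5) ctxc is_ctx_distinct
      by (intro tens_list_perm) (auto simp: list_all2_conv_all_nth)
    ultimately have Ms: "tens_list Ms = tens_list Ms' \<bullet> perm eob (concat \<Gamma>s) (concat \<Gamma>s')"
      by simp
    have obE: "obs eob E"
      using l(5) mset_eq_setD [OF Node.hyps(4)] by simp
    define P where "P = perm eob (concat \<Gamma>s) (concat \<Gamma>s')"
    define Q where "Q = perm eob E (concat \<Gamma>s)"
    have [simp]: "arr P" "sdom P = map eob (concat \<Gamma>s)" "scod P = map eob (concat \<Gamma>s')"
      "arr Q" "scod Q = map eob (concat \<Gamma>s)"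
      using P l(5) obE Node.hyps(4) unfolding P_def Q_def by (auto intro!: arr_perm)
    have "\<phi> \<bullet> tens_list Ms \<bullet> perm eob E (concat \<Gamma>s) = \<phi> \<bullet> tens_list Ms' \<bullet> (P \<bullet> Q)"
      unfolding Ms P_def [symmetric] Q_def [symmetric]
      using l' former_arr(1,2) [OF Node.hyps(1)] As by (simp add: comp_assoc map_concat)
    also have "P \<bullet> Q = perm eob E (concat \<Gamma>s')"
      unfolding P_def Q_def using P obE Node.hyps(4) ctxc is_ctx_distinct by (intro perm_comp) auto
    finally show ?thesis
      using * second(1) by simp
  qed (use Node.hyps in auto)
next
  case (Var A x)
  from Var.prems show ?case
    by (cases rule: den.cases) (auto simp: Pm_def Lam_def)
next
  case (Pm \<Gamma> v A B M \<Delta> x y w D N E)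
  note p = den_props [OF Pm.hyps(1)] den_props [OF Pm.hyps(2)]
  from Pm.prems show ?case
  proof (cases rule: den.cases)
    case (Pm \<Gamma>' v' A1 B1 M1 \<Delta>' x' y' w' N')
    note second = this
    note p' = den_props [OF second(3)] den_props [OF second(4)]
    have "v' = v"
      using second(1) by (simp add: Pm_def)
    have mG: "mset \<Gamma> = mset \<Gamma>'"
      using p p' \<open>v' = v\<close> mset_eq_setD [OF second(5)] mset_eq_setD [OF Pm.hyps(3)]
      by (intro mset_eq_of_names [OF Pm.hyps(4)]) auto
    then have mD: "mset \<Delta> = mset \<Delta>'"
      using second(5) Pm.hyps(3) by simp
    have "den \<Gamma> v (Tensor A1 B1) (M1 \<bullet> perm eob \<Gamma> \<Gamma>')"
      using den_exchange [OF second(3) mG] \<open>v' = v\<close> by simp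
    from Pm.IH(1) [OF this] have AB: "A1 = A" "B1 = B" and M: "M = M1 \<bullet> perm eob \<Gamma> \<Gamma>'"
      by auto
    have types: "is_type S A" "is_type S B"
      using p by auto
    have ctx: "is_ctx (\<Delta>' @ [(x, A), (y, B)])"
      using p is_ctx_mset [of "\<Delta>' @ [(x, A), (y, B)]" "\<Delta> @ [(x, A), (y, B)]"] mD by simp
    have obD: "obs eob \<Delta>'" "obs eob \<Delta>"
      using den_objs [OF second(4)] den_objs [OF Pm.hyps(2)] by auto
    \<comment> \<open>The bound names of the second derivation are changed to \<open>x\<close> and
      \<open>y\<close>. Substituting variables contributes identities, so \<open>N'\<close> is
      unaffected.\<close>
    have w': "den (\<Delta>' @ [(x, A)] @ [(y, B)]) (subst2 w' (Var x) x' (Var y) y') D1 (N' \<bullet> (ide (map eob \<Delta>') \<star> ide [tob A] \<star> ide [tob B]))"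
      if "D1 = A'" for D1
      unfolding that
      by (rule den_subst2 [OF second(4) [unfolded AB] den.Var den.Var]) (use types ctx in auto)
    then have "den (\<Delta>' @ [(x, A), (y, B)]) (subst2 w' (Var x) x' (Var y) y') A' N'"
      using p' obD types AB by simp
    note w'' = this
    have "w = subst2 w' (Var x) x' (Var y) y'"
    proof (rule Pm_eq_Pm(2) [OF second(1)])
      show "closed_at 0 (subst2 w' (Var x) x' (Var y) y')"
        using w'' by (rule den_closed)
      show "x \<noteq> y" "x' \<noteq> y'"
        using p p' by (auto simp: is_ctx_append is_ctx_def)
      have "fv w' - {x', y'} = fst ` set \<Delta>'"
        using p' by (auto simp: is_ctx_append)
      then show "{x, y} \<inter> (fv w' - {x', y'}) = {}"
        using ctx by (auto simp: is_ctx_append)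
    qed (use p in auto)
    with den_exchange [OF w'', of "\<Delta> @ [(x, A), (y, B)]"] mD
    have "den (\<Delta> @ [(x, A), (y, B)]) w A' (N' \<bullet> perm eob (\<Delta> @ [(x, A), (y, B)]) (\<Delta>' @ [(x, A), (y, B)]))"
      by simp
    from Pm.IH(2) [OF this] have D: "A' = D" and
      N: "N = N' \<bullet> perm eob (\<Delta> @ [(x, A), (y, B)]) (\<Delta>' @ [(x, A), (y, B)])"
      by auto
    have "perm eob (\<Delta> @ [(x, A), (y, B)]) (\<Delta>' @ [(x, A), (y, B)]) = perm eob \<Delta> \<Delta>' \<star> ide [tob A, tob B]"
      using perm_ten [of \<Delta> \<Delta>' "[(x, A), (y, B)]" "[(x, A), (y, B)]" eob] mD obD types is_ctx_distinct [OF ctx]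
      by auto
    note N = N [unfolded this]
    have obG: "obs eob \<Gamma>"
      using den_objs [OF Pm.hyps(1)] .
    have obE: "obs eob E"
      using obG obD mset_eq_setD [OF Pm.hyps(3)] by auto
    let ?PD = "perm eob \<Delta> \<Delta>'" and ?PG = "perm eob \<Gamma> \<Gamma>'"
    have [simp]: "arr ?PD" "arr ?PG" "arr (perm eob E (\<Delta> @ \<Gamma>))"
      using mD mG obD obG obE Pm.hyps(3) by auto
    have distG: "distinct (\<Delta>' @ \<Gamma>')"
      using is_ctx_mset [OF second(5)] second(6) is_ctx_distinct [of "\<Delta>' @ \<Gamma>'"] by simp
    have "(?PD \<star> ide [tob A, tob B]) \<bullet> (ide (map eob \<Delta>) \<star> (unpairing A B \<bullet> M))
        = ?PD \<star> (unpairing A B \<bullet> M1 \<bullet> ?PG)"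
      unfolding M using p' types obD AB by (subst ten_comp) (auto simp: comp_assoc)
    also have "\<dots> = (ide (map eob \<Delta>') \<star> (unpairing A B \<bullet> M1)) \<bullet> (?PD \<star> ?PG)"
      using p' types obD AB by (subst ten_comp) (auto simp: comp_assoc)
    also have "?PD \<star> ?PG = perm eob (\<Delta> @ \<Gamma>) (\<Delta>' @ \<Gamma>')"
      using mD mG distG obD obG by (intro perm_ten) auto
    finally have *: "(?PD \<star> ide [tob A, tob B]) \<bullet> (ide (map eob \<Delta>) \<star> (unpairing A B \<bullet> M))
        = (ide (map eob \<Delta>') \<star> (unpairing A B \<bullet> M1)) \<bullet> perm eob (\<Delta> @ \<Gamma>) (\<Delta>' @ \<Gamma>')" .
    have [simp]: "arr (perm eob (\<Delta> @ \<Gamma>) (\<Delta>' @ \<Gamma>'))"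
      using mD mG obD obG by (intro arr_perm) auto
    have "N \<bullet> (ide (map eob \<Delta>) \<star> (unpairing A B \<bullet> M)) \<bullet> perm eob E (\<Delta> @ \<Gamma>)
       = N' \<bullet> ((?PD \<star> ide [tob A, tob B]) \<bullet> (ide (map eob \<Delta>) \<star> (unpairing A B \<bullet> M))) \<bullet> perm eob E (\<Delta> @ \<Gamma>)"
      unfolding N using p p' types obD AB by (simp add: comp_assoc)
    also have "\<dots> = N' \<bullet> (ide (map eob \<Delta>') \<star> (unpairing A B \<bullet> M1)) \<bullet> (perm eob (\<Delta> @ \<Gamma>) (\<Delta>' @ \<Gamma>') \<bullet> perm eob E (\<Delta> @ \<Gamma>))"
      unfolding * using p' types obD AB by (simp add: comp_assoc)
    also have "perm eob (\<Delta> @ \<Gamma>) (\<Delta>' @ \<Gamma>') \<bullet> perm eob E (\<Delta> @ \<Gamma>) = perm eob E (\<Delta>' @ \<Gamma>')"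
      using mD mG distG obE Pm.hyps(3) by (intro perm_comp) auto
    finally show ?thesis
      using D second(2) AB by simp
  qed (auto simp: Pm_def Lam_def elim: former.cases)
next
  case (Lam \<Gamma> x A v B M)
  note p = den_props [OF Lam.hyps]
  from Lam.prems show ?case
  proof (cases rule: den.cases)
    case (Lam x' A1 v' B1 M1)
    note second = this
    note p' = den_props [OF second(4)]
    have "A1 = A"
      using second(1) by (simp add: Lam_def)
    have type: "is_type S A" using p by auto
    have "den (\<Gamma> @ [(x, A)]) (subst1 v' (Var x) x') B1 (M1 \<bullet> (ide (map eob \<Gamma>) \<star> ide [tob A]))"
      by (rule den_subst1 [OF second(4) [unfolded \<open>A1 = A\<close>] den.Var]) (use type p in auto)
    then have v': "den (\<Gamma> @ [(x, A)]) (subst1 v' (Var x) x') B1 M1"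
      using p' den_objs [OF Lam.hyps] type \<open>A1 = A\<close> by simp
    have "v = subst1 v' (Var x) x'"
    proof (rule Lam_eq_Lam(2) [OF second(1)])
      show "closed_at 0 (subst1 v' (Var x) x')"
        using v' by (rule den_closed)
      have "fv v' - {x'} = fst ` set \<Gamma>"
        using p' by (auto simp: is_ctx_append)
      then show "x \<notin> fv v' - {x'}"
        using p by (auto simp: is_ctx_append)
    qed (use p in auto)
    with v' have "den (\<Gamma> @ [(x, A)]) v B1 M1" by simp
    from Lam.IH [OF this] show ?thesis
      using second \<open>A1 = A\<close> by simp
  qed (auto simp: Pm_def Lam_def elim: former.cases)
qed

end

section \<open>Comparison with the interpretation of judgements\<close>

context symmetric_monoidal_category
begin

lemma tensms_simps:
  "tensms C [] = idn C \<I>" "tensms C [m] = m" "ms \<noteq> [] \<Longrightarrow> tensms C (ms @ [m]) = tensms C ms \<otimes> m"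
  by (auto simp: tensms_def split: list.split)

lemma split_simps:
  "split C [] = idn C \<I>" "split C [Xs] = idn C (tenss C Xs)"
  "Xss \<noteq> [] \<Longrightarrow> split C (Xss @ [Xs]) = (split C Xss \<otimes> idn C (tenss C Xs)) \<cdot> split2 C (concat Xss) Xs"
  by (subst split.simps; simp)+

lemma split_pair [simp]: "objs Xs \<Longrightarrow> objs Ys \<Longrightarrow> split C [Xs, Ys] = split2 C Xs Ys"
  using split_simps(3) [of "[Xs]" Ys] by (simp add: split_simps)

lemma split_arr:
  "\<forall>Xs\<in>set Xss. objs Xs \<Longrightarrow> split C Xss \<in> Ar C \<and> src C (split C Xss) = tenss C (concat Xss) \<and>
    tgt C (split C Xss) = tenss C (map (tenss C) Xss)"
proof (induction Xss rule: rev_induct)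
  case (snoc Xs Xss)
  show ?case
  proof (cases "Xss = []")
    case False
    have "objs (concat Xss)" using snoc.prems by auto
    then show ?thesis
      using snoc False by (simp add: split_simps)
  qed (use snoc in \<open>simp add: split_simps\<close>)
qed (simp add: split_simps)

text \<open>Since every codomain is a single object, no splitting is left on the target side, and
  the strict tensor takes the form used in \<open>interp.Op\<close>.\<close>

lemma mor_tens_list:
  "\<forall>f\<in>set fs. arr f \<and> (\<exists>Y. scod f = [Y]) \<Longrightarrow>
    tensms C (map mor fs) \<in> Ar C \<and> src C (tensms C (map mor fs)) = tenss C (map (tenss C) (map sdom fs)) \<and>
    tgt C (tensms C (map mor fs)) = tenss C (concat (map scod fs)) \<and>
    mor (tens_list fs) = tensms C (map mor fs) \<cdot> split C (map sdom fs)"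
proof (induction fs rule: rev_induct)
  case (snoc f fs)
  then obtain Y where f: "arr f" "scod f = [Y]" by auto
  then have Y: "Y \<in> Ob C" using arrD(2) [of f] by simp
  have IH: "tensms C (map mor fs) \<in> Ar C" "src C (tensms C (map mor fs)) = tenss C (map (tenss C) (map sdom fs))"
    "tgt C (tensms C (map mor fs)) = tenss C (concat (map scod fs))"
    "mor (tens_list fs) = tensms C (map mor fs) \<cdot> split C (map sdom fs)"
    using snoc by auto
  have arrs: "\<forall>f\<in>set fs. arr f" using snoc.prems by simp
  have objs: "\<forall>Xs\<in>set (map sdom fs). objs Xs" using arrs by auto
  show ?case
  proof (cases "fs = []")
    case True
    then show ?thesis
      using f by (simp add: tensms_simps split_simps)
  next
    case False
    have "tens_list (fs @ [f]) = tens_list fs \<star> f"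
      using arrs f by (simp add: tens_list_append)
    moreover have ne: "concat (map scod fs) \<noteq> []"
      using False snoc.prems by (cases fs) auto
    moreover have T: "arr (tens_list fs)" using arrs by simp
    ultimately have "mor (tens_list (fs @ [f])) = (mor (tens_list fs) \<otimes> mor f) \<cdot> split2 C (concat (map sdom fs)) (sdom f)"
      using f Y arrD [OF T] by (simp add: ten_def split2_simps)
    also have "\<dots> = tensms C (map mor (fs @ [f])) \<cdot> split C (map sdom (fs @ [f]))"
      using False IH f split_arr [OF objs] arrD(1) [OF T] by (simp add: split_simps tensms_simps)
    finally show ?thesis
      using False IH f ne by (simp add: tensms_simps)
  qed
qed (simp add: tensms_simps split_simps)

lemma mor_ten_cod_single:
  "\<lbrakk>arr f; arr g; scod f = [X]; scod g = [Y]\<rbrakk> \<Longrightarrow> mor (f \<star> g) = (mor f \<otimes> mor g) \<cdot> split2 C (sdom f) (sdom g)"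
  using mor_tens_list [of "[f, g]"] tensms_simps(3) [of "[mor f]" "mor g"] by (simp add: tensms_simps(2))

text \<open>Associativity of splitting with two one-element blocks: cutting off both objects at
  once, as \<open>ten\<close> does, against cutting them off one after the other, as
  \<open>interp.Pm\<close> does.\<close>

lemma split2_pair:
  assumes "objs Xs" "X \<in> Ob C" "Y \<in> Ob C"
  shows "split2 C Xs [X, Y] = assoc C (tenss C Xs) X Y \<cdot> split C [Xs, [X], [Y]]"
  using split2_assoc [of Xs "[X]" "[Y]"] split_simps(3) [of "[Xs, [X]]" "[Y]"] assms
    tenss_simps(3) [of "[X]" Y]
  by (simp add: split2_simps)

end

context linear_model
begin

lemma den_node2:
  assumes "former t [v, w] [A1, A2] B \<phi>" "den \<Gamma> v A1 M" "den \<Delta> w A2 N" "mset E = mset (\<Gamma> @ \<Delta>)" "is_ctx E"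
  shows "den E t B (\<phi> \<bullet> (M \<star> N) \<bullet> perm eob E (\<Gamma> @ \<Delta>))"
  using den.Node [OF assms(1), of "[\<Gamma>, \<Delta>]" "[M, N]" E] assms den_arr [OF assms(3)]
  by (simp add: All_less_Suc)

lemma den_star: "den [] Star Unit unit_intro"
  using den.Node [OF former.Star, of "[]" "[]" "[]"] by (simp add: is_ctx_def)

lemma typed_den: "typed S \<Gamma> v A \<Longrightarrow> \<exists>M. den \<Gamma> v A M"
proof (induction rule: typed.induct)
  case (Op f \<Gamma>s vs E)
  then have "\<forall>i. \<exists>M. i < length (args S f) \<longrightarrow> den (\<Gamma>s ! i) (vs ! i) (args S f ! i) M"
    by blast
  then obtain M where M: "\<And>i. i < length (args S f) \<Longrightarrow> den (\<Gamma>s ! i) (vs ! i) (args S f ! i) (M i)"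
    by metis
  show ?case
    using den.Node [OF former.Op [OF Op.hyps(1,3)], of \<Gamma>s "map M [0..<length (args S f)]" E] M Op mset_shuffless [OF Op.hyps(4)]
    by auto
next
  case (Var A x)
  then show ?case by (blast intro: den.Var)
next
  case Star
  then show ?case by (blast intro: den_star)
next
  case (To \<Gamma> v \<Delta> w A E)
  then obtain M N where "den \<Gamma> v Unit M" "den \<Delta> w A N" by blast
  with den_node2 [OF former.To this] den_type show ?case
    using To mset_shuffles by fastforce
next
  case (Tens \<Gamma> v A \<Delta> w B E)
  then obtain M N where "den \<Gamma> v A M" "den \<Delta> w B N" by blast
  with den_node2 [OF former.Tens this] den_type show ?case
    using Tens mset_shuffles by fastforce
next
  case (Pm \<Gamma> v A B \<Delta> x y w D E)
  then obtain M N where "den \<Gamma> v (Tensor A B) M" "den (\<Delta> @ [(x, A), (y, B)]) w D N" by blast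
  moreover have "mset E = mset (\<Delta> @ \<Gamma>)"
    using mset_shuffles [OF Pm.hyps(3)] by simp
  ultimately show ?case
    using Pm.hyps(4) by (blast intro: den.Pm)
next
  case (Lam \<Gamma> x A v B)
  then show ?case by (blast intro: den.Lam)
next
  case (App \<Gamma> v A B \<Delta> w E)
  then obtain M N where *: "den \<Gamma> v (Lolli A B) M" "den \<Delta> w A N" by blast
  then have "is_type S A" "is_type S B" using den_type by fastforce+
  with den_node2 [OF former.App *] show ?case
    using App mset_shuffles by fastforce
qed

lemma ctxobs_eob: "ctxobs C gi \<Gamma> = map eob \<Gamma>"
  by (simp add: eob_def)

lemma split_shuffle_eob:
  "split_shuffle C gi E \<Gamma>s = split C (map (map eob) \<Gamma>s) \<cdot> permute C eob E (concat \<Gamma>s)"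
  by (simp add: split_shuffle_def eob_def)

lemma mor_perm [simp]: "mor (perm ob E F) = permute C ob E F"
  by (simp add: perm_def)

lemma permute_arr:
  assumes "mset E = mset F" "obs ob E"
  shows "permute C ob E F \<in> Ar C" "src C (permute C ob E F) = tenss C (map ob E)"
    "tgt C (permute C ob E F) = tenss C (map ob F)"
  using arrD [of "perm ob E F"] arr_perm [OF assms(1), of ob] assms(2) by simp_all

definition strict_of :: "'g ctx \<Rightarrow> 'm \<Rightarrow> 'g ty \<Rightarrow> ('o, 'm) strict_arrow" where
  "strict_of \<Gamma> m A = Strict (map eob \<Gamma>) m [tob A]"

lemma strict_of_simps [simp]:
  "sdom (strict_of \<Gamma> m A) = map eob \<Gamma>" "mor (strict_of \<Gamma> m A) = m" "scod (strict_of \<Gamma> m A) = [tob A]"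
  by (simp_all add: strict_of_def)

text \<open>\<open>To\<close>, \<open>Tens\<close> and \<open>App\<close> differ in how
  \<open>interp\<close> writes the composite. \<open>k\<close> abstracts that expression over the
  splitting map, and its premise compares it with the uniform one; the facts about \<open>s\<close>
  are the typing information available for that comparison.\<close>

lemma den_node2_strict:
  assumes "former t [v, w] [A1, A2] B \<phi>" "den \<Gamma> v A1 (strict_of \<Gamma> m A1)" "den \<Delta> w A2 (strict_of \<Delta> n A2)"
    "E \<in> shuffles \<Gamma> \<Delta>" "is_ctx E"
    and k: "\<And>s. \<lbrakk>m \<in> Ar C; n \<in> Ar C; tgt C m = tob A1; tgt C n = tob A2; s \<in> Ar C;
        src C n = ctxob C gi \<Delta>; ctxob C gi \<Delta> \<in> Ob C; tgt C s = src C m \<odot> src C n\<rbrakk> \<Longrightarrow> k s = mor \<phi> \<cdot> (m \<otimes> n) \<cdot> s"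
  shows "den E t B (strict_of E (k (split_shuffle C gi E [\<Gamma>, \<Delta>])) B)"
proof -
  have mE: "mset E = mset (\<Gamma> @ \<Delta>)"
    using mset_shuffles [OF assms(4)] by simp
  note p = den_arr [OF assms(2)] den_arr [OF assms(3)]
  have ob: "obs eob \<Gamma>" "obs eob \<Delta>"
    using den_objs [OF assms(2)] den_objs [OF assms(3)] .
  then have obE: "obs eob E"
    using mset_eq_setD [OF mE] by auto
  note a = arrD(3-5) [OF p(1)] arrD(3-5) [OF p(2)] permute_arr [OF mE obE]
  have "\<phi> \<bullet> (strict_of \<Gamma> m A1 \<star> strict_of \<Delta> n A2) \<bullet> perm eob E (\<Gamma> @ \<Delta>)
      = strict_of E (mor \<phi> \<cdot> (m \<otimes> n) \<cdot> split_shuffle C gi E [\<Gamma>, \<Delta>]) B"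
    unfolding split_shuffle_eob using p ob obE former_arr(3) [OF assms(1)] a
    by (intro strict_eqI) (simp_all add: mor_ten_cod_single)
  also have "mor \<phi> \<cdot> (m \<otimes> n) \<cdot> split_shuffle C gi E [\<Gamma>, \<Delta>] = k (split_shuffle C gi E [\<Gamma>, \<Delta>])"
    using a ob by (intro k [symmetric]) (simp_all add: split_shuffle_eob ctxob_def ctxobs_eob)
  finally show ?thesis
    using den_node2 [OF assms(1-3) mE assms(5)] by simp
qed

text \<open>A shuffle is a particular permutation, so the derivations correspond at once; the
  content is that both relations spell out the same morphism.\<close>

lemma interp_den: "meaning \<Gamma> v A m \<Longrightarrow> den \<Gamma> v A (strict_of \<Gamma> m A)"
proof (induction rule: interp.induct)
  case (Op f \<Gamma>s vs ms E)
  let ?As = "args S f"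
  let ?Ms = "map (\<lambda>i. strict_of (\<Gamma>s ! i) (ms ! i) (?As ! i)) [0..<length ?As]"
  have mE: "mset E = mset (concat \<Gamma>s)"
    using Op.hyps mset_shuffless by blast
  have fo: "former (Op f vs) vs ?As (res S f) (Strict (map tob ?As) (fi f) [tob (res S f)])"
    using Op.hyps by (intro former.Op) auto
  have dens: "\<forall>i<length ?As. den (\<Gamma>s ! i) (vs ! i) (?As ! i) (?Ms ! i)"
    using Op.IH by simp
  have len: "length \<Gamma>s = length ?As" "length ?Ms = length ?As"
    using Op.hyps by simp_all
  note l = den_list [OF fo len dens]
  have ob: "obs eob E"
    using l(5) mset_eq_setD [OF mE] by simp
  have ms: "map mor ?Ms = ms" "map sdom ?Ms = map (map eob) \<Gamma>s"
    using Op.hyps by (auto intro!: nth_equalityI)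
  have "\<forall>f\<in>set ?Ms. arr f \<and> (\<exists>Y. scod f = [Y])"
    using l(1) by auto
  note mt = mor_tens_list [OF this, unfolded ms]
  have "\<forall>Xs\<in>set (map (map eob) \<Gamma>s). objs Xs"
    using l(5) by auto
  note sp = split_arr [OF this]
  have "den E (Op f vs) (res S f) (Strict (map tob ?As) (fi f) [tob (res S f)] \<bullet> tens_list ?Ms \<bullet> perm eob E (concat \<Gamma>s))"
    by (rule den.Node [OF fo len dens mE]) (fact Op.hyps)
  also have "\<dots> = strict_of E (fi f \<cdot> tensms C ms \<cdot> split_shuffle C gi E \<Gamma>s) (res S f)"
    using mt sp permute_arr [OF mE ob] by (intro strict_eqI) (simp_all add: split_shuffle_eob map_concat)
  finally show ?case .
next
  case (Var A x)
  have "strict_of [(x, A)] (idn C (tob A)) A = ide [tob A]"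
    by (simp add: strict_of_def ide_def)
  then show ?case
    using den.Var [OF Var, of x] by simp
next
  case Star
  have "strict_of [] (idn C \<I>) Unit = unit_intro"
    by (simp add: strict_of_def unit_intro_def)
  then show ?case
    using den_star by simp
next
  case (To \<Gamma> v m \<Delta> w A n E)
  have type: "is_type S A" using den_type [OF To.IH(2)] .
  \<comment> \<open>\<open>split2\<close> with an empty left block is the inverse of
    \<open>lun\<close>, so conjugation leaves exactly \<open>lun\<close> in the clause for
    \<open>To\<close>.\<close>
  have "inv_arrow C (inv_arrow C (lun C (tob A))) = lun C (tob A)"
    using type by (intro is_isoI(2)) auto
  then have u: "mor (unit_elim \<star> ide [tob A]) = lun C (tob A)"
    using type by (simp add: ten_def unit_elim_def split2_simps)
  show ?case
  proof (rule den_node2_strict [OF former.To [OF type] To.IH To.hyps(3,4)], unfold u)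
    fix s assume [simp]: "m \<in> Ar C" "n \<in> Ar C" "tgt C m = tob Unit" "tgt C n = tob A" "s \<in> Ar C"
      "src C n = ctxob C gi \<Delta>" "ctxob C gi \<Delta> \<in> Ob C" "tgt C s = src C m \<odot> src C n"
    have "n \<cdot> lun C (ctxob C gi \<Delta>) \<cdot> (m \<otimes> idn C (ctxob C gi \<Delta>)) \<cdot> s
      = lun C (tob A) \<cdot> (idn C \<I> \<otimes> n) \<cdot> (m \<otimes> idn C (ctxob C gi \<Delta>)) \<cdot> s"
      using type by (intro cmp_eq_cmp lun_nat [symmetric]) auto
    then show "n \<cdot> lun C (ctxob C gi \<Delta>) \<cdot> (m \<otimes> idn C (ctxob C gi \<Delta>)) \<cdot> s = lun C (tob A) \<cdot> (m \<otimes> n) \<cdot> s"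
      by simp
  qed
next
  case (Tens \<Gamma> v A m \<Delta> w B n E)
  have "is_type S A" "is_type S B"
    using den_type Tens.IH by blast+
  then show ?case
    by (intro den_node2_strict [OF former.Tens Tens.IH Tens.hyps(3,4)]) (auto simp: pairing_def)
next
  case (Pm \<Gamma> v A B m \<Delta> x y w D n E)
  have types: "is_type S A" "is_type S B"
    using den_type [OF Pm.IH(1)] by auto
  note p = den_arr [OF Pm.IH(1)] den_arr [OF Pm.IH(2)]
  have ob: "obs eob \<Gamma>" "obs eob \<Delta>"
    using den_objs [OF Pm.IH(1)] den_objs [OF Pm.IH(2)] by auto
  have mE: "mset E = mset (\<Delta> @ \<Gamma>)" "mset E = mset (\<Gamma> @ \<Delta>)"
    using mset_shuffles [OF Pm.hyps(3)] by simp_all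
  have obE: "obs eob E"
    using mset_eq_setD [OF mE(1)] ob by auto
  have dist: "distinct (\<Delta> @ \<Gamma>)" "distinct (\<Gamma> @ \<Delta>)"
    using is_ctx_mset [OF mE(1)] is_ctx_mset [OF mE(2)] Pm.hyps(4) is_ctx_distinct
    by blast+
  have ctxob: "ctxob C gi \<Delta> = tenss C (map eob \<Delta>)"
    by (simp add: ctxob_def ctxobs_eob)
  let ?A = "tob A" and ?B = "tob B" and ?O = "map eob \<Delta>"
  let ?T = "tenss C ?O"
  let ?M = "strict_of \<Gamma> m (Tensor A B)"
  let ?N = "strict_of (\<Delta> @ [(x, A), (y, B)]) n D"
  note a = arrD(3-5) [OF p(1)] arrD(3-5) [OF p(2)] permute_arr [OF mE(2) obE]
  let ?u = "unpairing A B"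
  \<comment> \<open>\<open>den.Pm\<close> puts \<open>\<Delta>\<close> first, whereas
    \<open>interp.Pm\<close> puts \<open>\<Gamma>\<close> first and then applies \<open>sym\<close>.
    The permutation is therefore factored through \<open>\<Gamma> @ \<Delta>\<close>, and its second
    factor is the block symmetry.\<close>
  have "(ide ?O \<star> (?u \<bullet> ?M)) \<bullet> perm eob E (\<Delta> @ \<Gamma>)
      = (ide ?O \<star> (?u \<bullet> ?M)) \<bullet> perm eob (\<Gamma> @ \<Delta>) (\<Delta> @ \<Gamma>) \<bullet> perm eob E (\<Gamma> @ \<Delta>)"
    using mE dist obE by (subst perm_comp) auto
  also have "perm eob (\<Gamma> @ \<Delta>) (\<Delta> @ \<Gamma>) = swap (map eob \<Gamma>) ?O"
    using dist ob by (intro perm_swap) auto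
  also have "(ide ?O \<star> (?u \<bullet> ?M)) \<bullet> swap (map eob \<Gamma>) ?O \<bullet> perm eob E (\<Gamma> @ \<Delta>)
      = (ide ?O \<star> ?u) \<bullet> ((ide ?O \<star> ?M) \<bullet> swap (map eob \<Gamma>) ?O) \<bullet> perm eob E (\<Gamma> @ \<Delta>)"
    using types ob p obE mE by (simp add: ide_ten_comp comp_assoc)
  also have "(ide ?O \<star> ?M) \<bullet> swap (map eob \<Gamma>) ?O = swap [?A \<odot> ?B] ?O \<bullet> (?M \<star> ide ?O)"
    using swap_natural [of ?M "ide ?O"] p ob by simp
  finally have 1: "(ide ?O \<star> (?u \<bullet> ?M)) \<bullet> perm eob E (\<Delta> @ \<Gamma>)
    = (ide ?O \<star> ?u) \<bullet> (swap [?A \<odot> ?B] ?O \<bullet> (?M \<star> ide ?O)) \<bullet> perm eob E (\<Gamma> @ \<Delta>)" .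
  have sp: "is_iso C (split C [?O, [?A], [?B]])" "src C (split C [?O, [?A], [?B]]) = tenss C (?O @ [?A, ?B])"
    "tgt C (split C [?O, [?A], [?B]]) = (?T \<odot> ?A) \<odot> ?B"
    using types ob split_simps(3) [of "[?O, [?A]]" "[?B]"] tenss_simps(3) [of "?O @ [?A]" ?B] by (simp_all add: split2_simps)
  have "inv_arrow C (split2 C ?O [?A, ?B])
      = inv_arrow C (split C [?O, [?A], [?B]]) \<cdot> inv_arrow C (assoc C ?T ?A ?B)"
    unfolding split2_pair [of ?O ?A ?B]
    using types ob sp is_iso_arr [OF sp(1)] by (subst split2_pair) (auto intro!: is_isoI(2))
  then have 2: "mor (ide ?O \<star> ?u) = inv_arrow C (split C [?O, [?A], [?B]]) \<cdot> inv_arrow C (assoc C ?T ?A ?B) \<cdot> split2 C ?O [?A \<odot> ?B]"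
    using types ob sp is_iso_arr [OF sp(1)] by (simp add: ten_def unpairing_def)
  have 3: "mor (?M \<star> ide ?O) = inv_arrow C (split2 C [?A \<odot> ?B] ?O) \<cdot> (m \<otimes> idn C ?T) \<cdot> split2 C (map eob \<Gamma>) ?O"
    by (simp add: ten_def)
  have "den E (Pm v x y w) D (?N \<bullet> (ide ?O \<star> (?u \<bullet> ?M)) \<bullet> perm eob E (\<Delta> @ \<Gamma>))"
    by (rule den.Pm [OF Pm.IH mE(1) Pm.hyps(4)])
  also have "\<dots> = strict_of E (n \<cdot> inv_arrow C (split C [ctxobs C gi \<Delta>, [tyob C gi A], [tyob C gi B]])
                \<cdot> inv_arrow C (assoc C (ctxob C gi \<Delta>) (tyob C gi A) (tyob C gi B))
                \<cdot> sym C (tyob C gi A \<odot> tyob C gi B) (ctxob C gi \<Delta>)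
                \<cdot> (m \<otimes> idn C (ctxob C gi \<Delta>)) \<cdot> split_shuffle C gi E [\<Gamma>, \<Delta>]) D"
    unfolding 1 ctxob ctxobs_eob split_shuffle_eob
    using a types ob sp is_iso_arr [OF sp(1)]
    by (intro strict_eqI) (simp_all add: 2 3 swap_def)
  finally show ?case .
next
  case (Lam \<Gamma> x A v B m)
  have "scurry (map eob \<Gamma>) (tob A) (strict_of (\<Gamma> @ [(x, A)]) m B)
    = strict_of \<Gamma> (curry C (ctxob C gi \<Gamma>) (tob A) (m \<cdot> inv_arrow C (split C [ctxobs C gi \<Gamma>, [tob A]]))) (Lolli A B)"
    using den_objs [OF Lam.IH] by (auto simp: scurry_def strict_of_def ctxob_def ctxobs_eob)
  then show ?case
    using den.Lam [OF Lam.IH] by simp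
next
  case (App \<Gamma> v A B m \<Delta> w n E)
  have "is_type S A" "is_type S B"
    using den_type [OF App.IH(1)] by auto
  then show ?case
    by (intro den_node2_strict [OF former.App App.IH App.hyps(3,4)]) (auto simp: sev_def)
qed

lemma former_interp:
  assumes "former t vs As B \<phi>" "length \<Gamma>s = length As"
    "\<forall>i<length As. \<exists>m. meaning (\<Gamma>s ! i) (vs ! i) (As ! i) m" "E \<in> shuffless \<Gamma>s" "is_ctx E"
  shows "\<exists>m. meaning E t B m"
proof -
  have bin: "\<exists>\<Gamma> \<Delta> m n. meaning \<Gamma> v A1 m \<and> meaning \<Delta> w A2 n \<and> E \<in> shuffles \<Gamma> \<Delta>"
    if eqs: "vs = [v, w]" "As = [A1, A2]" for v w A1 A2
  proof -
    obtain \<Gamma> \<Delta> where "\<Gamma>s = [\<Gamma>, \<Delta>]"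
      using assms(2) unfolding eqs by (auto simp: length_Suc_conv)
    then show ?thesis
      using assms eqs by (auto simp: All_less_Suc)
  qed
  show ?thesis
    using assms(1)
  proof (cases rule: former.cases)
    case (Op f)
    from assms(3) obtain m where "\<forall>i<length As. meaning (\<Gamma>s ! i) (vs ! i) (As ! i) (m i)"
      by metis
    then show ?thesis
      using Op assms interp.Op [of f S \<Gamma>s vs "map m [0..<length As]" C gi fi E] by auto
  next
    case Star
    then show ?thesis
      using assms by (auto intro: interp.Star)
  next
    case (To v w)
    with bin show ?thesis using assms(5) by (blast intro: interp.To)
  next
    case (Tens A1 A2 v w)
    with bin show ?thesis using assms(5) by (blast intro: interp.Tens)
  next
    case (App A1 v w)
    with bin show ?thesis using assms(5) by (blast intro: interp.App)
  qed
qed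

text \<open>Quantified over all reorderings \<open>E'\<close>, since the subcontexts are reordered
  along \<open>E'\<close> to make it a genuine shuffle. Only existence is claimed; the value follows
  from \<open>interp_den\<close> and \<open>den_unique\<close>.\<close>

lemma den_interp: "\<lbrakk>den E t A M; mset E' = mset E\<rbrakk> \<Longrightarrow> \<exists>m. meaning E' t A m"
proof (induction arbitrary: E' rule: den.induct)
  case (Node t vs As B \<phi> \<Gamma>s Ms E)
  let ?G = "map (\<lambda>\<Gamma>. filter (\<lambda>e. e \<in> set \<Gamma>) E') \<Gamma>s"
  have mE': "mset E' = mset (concat \<Gamma>s)" and ctx: "is_ctx E'"
    using Node is_ctx_mset [of E' E] by auto
  show ?case
  proof (rule former_interp [OF Node.hyps(1), of ?G])
    show "E' \<in> shuffless ?G"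
      using filter_in_shuffless [OF is_ctx_distinct [OF ctx] mE'] .
    show "\<forall>i<length As. \<exists>m. meaning (?G ! i) (vs ! i) (As ! i) m"
    proof (intro allI impI)
      fix i assume i: "i < length As"
      then have "mset (?G ! i) = mset (\<Gamma>s ! i)"
        using mset_filter_concat [OF ctx mE'] Node.hyps(2) by simp
      then show "\<exists>m. meaning (?G ! i) (vs ! i) (As ! i) m"
        using Node.IH i by blast
    qed
  qed (use Node.hyps ctx in auto)
next
  case (Var A x)
  then have "E' = [(x, A)]" by auto
  then show ?case
    using interp.Var [OF Var.hyps] by blast
next
  case (Pm \<Gamma> v A B M \<Delta> x y w D N E)
  let ?G = "filter (\<lambda>e. e \<in> set \<Gamma>) E'" and ?D = "filter (\<lambda>e. e \<in> set \<Delta>) E'"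
  have mE': "mset E' = mset (concat [\<Gamma>, \<Delta>])" and ctx: "is_ctx E'"
    using Pm.prems Pm.hyps is_ctx_mset [of E' E] by auto
  have "E' \<in> shuffles ?G ?D"
    using filter_in_shuffless [OF is_ctx_distinct [OF ctx] mE'] by simp
  moreover have "mset ?G = mset \<Gamma>" "mset ?D = mset \<Delta>"
    using mset_filter_concat [OF ctx mE'] by simp_all
  then obtain m n where "meaning ?G v (Tensor A B) m" "meaning (?D @ [(x, A), (y, B)]) w D n"
    using Pm.IH(1) [of ?G] Pm.IH(2) [of "?D @ [(x, A), (y, B)]"] by auto
  ultimately show ?case
    using ctx by (blast intro: interp.Pm)
next
  case (Lam \<Gamma> x A v B M)
  obtain m where "meaning (E' @ [(x, A)]) v B m"
    using Lam.IH [of "E' @ [(x, A)]"] Lam.prems by auto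
  then show ?case by (blast intro: interp.Lam)
qed

text \<open>The definite description in \<open>sem\<close> is justified here: existence by
  \<open>den_interp\<close>, uniqueness by \<open>den_unique\<close>.\<close>

lemma sem_eq:
  assumes "den \<Gamma> v A M"
  shows "sem S C gi fi \<Gamma> v A = mor M"
proof -
  have eq: "m = mor M" if "meaning \<Gamma> v A m" for m
    using den_unique [OF interp_den [OF that] assms] by auto
  obtain m where m: "meaning \<Gamma> v A m"
    using den_interp [OF assms] by auto
  then show ?thesis
    unfolding sem_def using eq by (metis the_equality)
qed

section \<open>Validity of the equations\<close>

lemma den_node2':
  assumes "former t [v, w] [A1, A2] B \<phi>" "den \<Gamma> v A1 M" "den \<Delta> w A2 N" "is_ctx (\<Gamma> @ \<Delta>)"
  shows "den (\<Gamma> @ \<Delta>) t B (\<phi> \<bullet> (M \<star> N))"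
proof -
  have "perm eob (\<Gamma> @ \<Delta>) (\<Gamma> @ \<Delta>) = ide (map eob (\<Gamma> @ \<Delta>))"
    using den_objs [OF assms(2)] den_objs [OF assms(3)] is_ctx_distinct [OF assms(4)]
    by (intro perm_refl) auto
  with den_node2 [OF assms(1-3) HOL.refl assms(4)] show ?thesis
    using den_props [OF assms(2)] den_props [OF assms(3)] by simp
qed

text \<open>With the context of \<open>v\<close> last, the two components land where
  \<open>w\<close> expects its bound variables, and no permutation remains.\<close>

lemma den_Pm:
  assumes "den \<Gamma> v (Tensor A B) M" "den (\<Delta> @ [(x, A), (y, B)]) w D N" "is_ctx (\<Delta> @ \<Gamma>)"
  shows "den (\<Delta> @ \<Gamma>) (Pm v x y w) D (N \<bullet> (ide (map eob \<Delta>) \<star> (unpairing A B \<bullet> M)))"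
proof -
  have "perm eob (\<Delta> @ \<Gamma>) (\<Delta> @ \<Gamma>) = ide (map eob (\<Delta> @ \<Gamma>))"
    using den_objs [OF assms(1)] den_objs [OF assms(2)] is_ctx_distinct [OF assms(3)]
    by (intro perm_refl) auto
  with den.Pm [OF assms(1,2) HOL.refl assms(3)] show ?thesis
    using den_props [OF assms(1)] den_props [OF assms(2)] den_objs [OF assms(2)] by simp
qed

text \<open>
  With the context of \<open>v\<close> moved to the end, \<open>To\<close> is interpreted by the same pattern as \<open>Pm\<close>, so
  that the equations for both eliminators have the same proofs.
\<close>

lemma den_To:
  assumes "den \<Gamma> v Unit M" "den \<Delta> w A N" "is_ctx (\<Delta> @ \<Gamma>)"
  shows "den (\<Delta> @ \<Gamma>) (To v w) A (N \<bullet> (ide (map eob \<Delta>) \<star> (unit_elim \<bullet> M)))"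
proof -
  note p = den_props [OF assms(1)] den_props [OF assms(2)]
  note ob = den_objs [OF assms(1)] den_objs [OF assms(2)]
  have type: "is_type S A" using p by simp
  let ?u = "unit_elim \<star> ide [tob A]"
  have "perm eob (\<Delta> @ \<Gamma>) (\<Gamma> @ \<Delta>) = swap (map eob \<Delta>) (map eob \<Gamma>)"
    using ob is_ctx_distinct [OF assms(3)] by (intro perm_swap) auto
  then have "den (\<Delta> @ \<Gamma>) (To v w) A (?u \<bullet> (M \<star> N) \<bullet> swap (map eob \<Delta>) (map eob \<Gamma>))"
    using den_node2 [OF former.To [OF type] assms(1,2), of "\<Delta> @ \<Gamma>"] assms(3) by simp
  also have "(M \<star> N) \<bullet> swap (map eob \<Delta>) (map eob \<Gamma>) = swap [tob A] [\<I>] \<bullet> (N \<star> M)"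
    using swap_natural [of N M] p by simp
  also have "?u \<bullet> swap [tob A] [\<I>] \<bullet> (N \<star> M) = (?u \<bullet> swap [tob A] [\<I>]) \<bullet> (N \<star> M)"
    using p type by (simp add: comp_assoc)
  also have "?u \<bullet> swap [tob A] [\<I>] = ide [tob A] \<star> unit_elim"
    using swap_natural [of "ide [tob A]" unit_elim] type by simp
  also have "(ide [tob A] \<star> unit_elim) \<bullet> (N \<star> M) = N \<star> (unit_elim \<bullet> M)"
    using p by (simp add: ten_comp)
  also have "\<dots> = N \<bullet> (ide (map eob \<Delta>) \<star> (unit_elim \<bullet> M))"
    using slide(2) [of N "unit_elim \<bullet> M"] p by simp
  finally show ?thesis .
qed

text \<open>Thanks to this, both sides of an equation may be computed in whichever order of the
  context suits them.\<close>

lemma den_both: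
  "\<lbrakk>den F v A M; den F w A M; mset E = mset F\<rbrakk> \<Longrightarrow> \<exists>M. den E v A M \<and> den E w A M"
  using den_exchange by blast

text \<open>With contexts ordered so that substituted terms come last, each equation reduces to one
  identity: \<open>pairing\<close> and \<open>unpairing\<close>, or \<open>unit_intro\<close> and
  \<open>unit_elim\<close>, are mutually inverse; \<open>scurry_beta\<close> and
  \<open>scurry_eta\<close> give the rules for functions; the commuting conversions are
  associativity of composition.\<close>

lemma lameq_den: "lameq S E v w A \<Longrightarrow> \<exists>M. den E v A M \<and> den E w A M"
proof (induction rule: lameq.induct)
  case (pm_beta \<Gamma> v A \<Delta> w B \<Theta> x y u D E)
  obtain M N U where d: "den \<Gamma> v A M" "den \<Delta> w B N" "den (\<Theta> @ [(x, A), (y, B)]) u D U"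
    using typed_den [OF pm_beta(1)] typed_den [OF pm_beta(2)] typed_den [OF pm_beta(3)] by blast
  note p = den_props [OF d(1)] den_props [OF d(2)] den_props [OF d(3)]
  have mE: "mset E = mset (\<Theta> @ \<Gamma> @ \<Delta>)"
    using pm_beta by simp
  have ctx: "is_ctx (\<Theta> @ \<Gamma> @ \<Delta>)"
    using is_ctx_mset [OF mE] pm_beta by simp
  have types: "is_type S A" "is_type S B" using p by auto
  have "den (\<Gamma> @ \<Delta>) (Tens v w) (Tensor A B) (pairing A B \<bullet> (M \<star> N))"
    using ctx types by (intro den_node2' [OF former.Tens d(1,2)]) (auto simp: is_ctx_append)
  note den_Pm [OF this d(3) ctx]
  also have "unpairing A B \<bullet> pairing A B \<bullet> (M \<star> N) = M \<star> N"
    using p types by (intro comp_cancel_left [where Xs = "[tob A, tob B]"]) auto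
  finally show ?case
    using den_subst2 [OF d(3,1,2) ctx] mE by (rule den_both)
next
  case (pm_eta \<Gamma> v A B \<Delta> z u D x y E)
  obtain M U where d: "den \<Gamma> v (Tensor A B) M" "den (\<Delta> @ [(z, Tensor A B)]) u D U"
    using typed_den [OF pm_eta(1)] typed_den [OF pm_eta(2)] by blast
  note p = den_props [OF d(1)] den_props [OF d(2)]
  have mE: "mset E = mset (\<Delta> @ \<Gamma>)"
    using pm_eta by simp
  have ctx: "is_ctx (\<Delta> @ \<Gamma>)"
    using is_ctx_mset [OF mE] pm_eta by simp
  have types: "is_type S A" "is_type S B" using p by auto
  have ob: "obs eob \<Delta>"
    using den_objs [OF d(2)] by auto
  have "is_ctx ([(x, A)] @ [(y, B)])"
    using pm_eta(3) by (auto simp: is_ctx_append)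
  then have "den ([(x, A)] @ [(y, B)]) (Tens (Var x) (Var y)) (Tensor A B) (pairing A B \<bullet> (ide [tob A] \<star> ide [tob B]))"
    using types by (intro den_node2' [OF former.Tens den.Var den.Var]) auto
  then have "den [(x, A), (y, B)] (Tens (Var x) (Var y)) (Tensor A B) (pairing A B)"
    using types by simp
  note den_Pm [OF d(1) den_subst1 [OF d(2) this pm_eta(3)] ctx]
  also have "(U \<bullet> (ide (map eob \<Delta>) \<star> pairing A B)) \<bullet> (ide (map eob \<Delta>) \<star> (unpairing A B \<bullet> M))
     = U \<bullet> (ide (map eob \<Delta>) \<star> (pairing A B \<bullet> unpairing A B \<bullet> M))"
    using p ob types by (simp add: whisker)
  also have "pairing A B \<bullet> unpairing A B \<bullet> M = M"
    using p types by (intro comp_cancel_left [where Xs = "[tob A \<odot> tob B]"]) auto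
  finally show ?case
    using den_subst1 [OF d(2,1) ctx] mE by (rule den_both)
next
  case (to_beta \<Gamma> v A)
  obtain M where d: "den \<Gamma> v A M"
    using typed_den [OF to_beta(1)] by blast
  have "den \<Gamma> (To Star v) A M"
    using den_To [OF den_star d] den_props [OF d] den_objs [OF d] by simp
  with d show ?case by blast
next
  case (to_eta \<Gamma> v \<Delta> z w A E)
  obtain M W where d: "den \<Gamma> v Unit M" "den (\<Delta> @ [(z, Unit)]) w A W"
    using typed_den [OF to_eta(1)] typed_den [OF to_eta(2)] by blast
  note p = den_props [OF d(1)] den_props [OF d(2)]
  have mE: "mset E = mset (\<Delta> @ \<Gamma>)"
    using to_eta by simp
  have ctx: "is_ctx (\<Delta> @ \<Gamma>)"
    using is_ctx_mset [OF mE] to_eta by simp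
  have ob: "obs eob \<Delta>"
    using den_objs [OF d(2)] by auto
  have "den (\<Delta> @ []) (subst1 w Star z) A (W \<bullet> (ide (map eob \<Delta>) \<star> unit_intro))"
    using ctx by (intro den_subst1 [OF d(2) den_star]) (auto simp: is_ctx_append)
  then have "den \<Delta> (subst1 w Star z) A (W \<bullet> (ide (map eob \<Delta>) \<star> unit_intro))" by simp
  note den_To [OF d(1) this ctx]
  also have "(W \<bullet> (ide (map eob \<Delta>) \<star> unit_intro)) \<bullet> (ide (map eob \<Delta>) \<star> (unit_elim \<bullet> M))
     = W \<bullet> (ide (map eob \<Delta>) \<star> (unit_intro \<bullet> unit_elim \<bullet> M))"
    using p ob by (simp add: whisker)
  also have "unit_intro \<bullet> unit_elim \<bullet> M = M"
    using p by (intro comp_cancel_left [where Xs = "[\<I>]"]) auto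
  finally show ?case
    using den_subst1 [OF d(2,1) ctx] mE by (rule den_both)
next
  case (lam_beta \<Gamma> x A v B \<Delta> w E)
  obtain M N where d: "den (\<Gamma> @ [(x, A)]) v B M" "den \<Delta> w A N"
    using typed_den [OF lam_beta(1)] typed_den [OF lam_beta(2)] by blast
  note p = den_props [OF d(1)] den_props [OF d(2)]
  have ctx: "is_ctx (\<Gamma> @ \<Delta>)"
    using is_ctx_mset [OF lam_beta(3)] lam_beta by simp
  have types: "is_type S A" "is_type S B" using p by auto
  have ob: "obs eob \<Gamma>"
    using den_objs [OF d(1)] by auto
  let ?c = "scurry (map eob \<Gamma>) (tob A) M" and ?O = "map eob \<Gamma>"
  have c: "arr ?c" "scod ?c = [tob A \<multimap> tob B]"
    using p by (auto intro!: arr_scurry)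
  have "den (\<Gamma> @ \<Delta>) (App (Lam x A v) w) B (sev (tob A) (tob B) \<bullet> (?c \<star> N))"
    using types by (intro den_node2' [OF former.App den.Lam [OF d(1)] d(2) ctx]) auto
  also have "?c \<star> N = (?c \<star> ide [tob A]) \<bullet> (ide ?O \<star> N)"
    using slide(2) [of ?c N] c p by simp
  also have "sev (tob A) (tob B) \<bullet> (?c \<star> ide [tob A]) \<bullet> (ide ?O \<star> N)
      = (sev (tob A) (tob B) \<bullet> (?c \<star> ide [tob A])) \<bullet> (ide ?O \<star> N)"
    using c p ob types by (simp add: comp_assoc)
  also have "sev (tob A) (tob B) \<bullet> (?c \<star> ide [tob A]) = M"
    using p by (intro scurry_beta) auto
  finally show ?case
    using den_subst1 [OF d ctx] lam_beta(3) by (rule den_both)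
next
  case (lam_eta \<Gamma> v A B x)
  obtain M where d: "den \<Gamma> v (Lolli A B) M"
    using typed_den [OF lam_eta(1)] by blast
  note p = den_props [OF d]
  have types: "is_type S A" "is_type S B" using p by auto
  have "den (\<Gamma> @ [(x, A)]) (App v (Var x)) B (sev (tob A) (tob B) \<bullet> (M \<star> ide [tob A]))"
    using types lam_eta by (intro den_node2' [OF former.App d den.Var]) auto
  from den.Lam [OF this] have "den \<Gamma> (Lam x A (App v (Var x))) (Lolli A B) M"
    using scurry_eta [of M "tob A" "tob B"] p types by simp
  with d show ?case by blast
next
  case (to_comm \<Gamma> v \<Delta> w A \<Theta> z u B E)
  obtain M N U where d: "den \<Gamma> v Unit M" "den \<Delta> w A N" "den (\<Theta> @ [(z, A)]) u B U"
    using typed_den [OF to_comm(1)] typed_den [OF to_comm(2)] typed_den [OF to_comm(3)] by blast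
  note p = den_props [OF d(1)] den_props [OF d(2)] den_props [OF d(3)]
  have mE: "mset E = mset (\<Theta> @ \<Delta> @ \<Gamma>)" using to_comm by simp
  have ctx: "is_ctx (\<Theta> @ \<Delta> @ \<Gamma>)"
    using is_ctx_mset [OF mE] to_comm by simp
  then have ctx': "is_ctx (\<Delta> @ \<Gamma>)" "is_ctx (\<Theta> @ \<Delta>)" "is_ctx ((\<Theta> @ \<Delta>) @ \<Gamma>)"
    by (auto simp: is_ctx_append)
  have ob: "obs eob \<Theta>" "obs eob \<Delta>"
    using den_objs [OF d(2)] den_objs [OF d(3)] by auto
  note den_To [OF d(1) den_subst1 [OF d(3,2) ctx'(2)] ctx'(3)]
  also have "(U \<bullet> (ide (map eob \<Theta>) \<star> N)) \<bullet> (ide (map eob (\<Theta> @ \<Delta>)) \<star> (unit_elim \<bullet> M))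
      = U \<bullet> (ide (map eob \<Theta>) \<star> (N \<bullet> (ide (map eob \<Delta>) \<star> (unit_elim \<bullet> M))))"
    using p ob by (simp add: whisker)
  finally show ?case
    unfolding append_assoc by (rule den_both [OF den_subst1 [OF d(3) den_To [OF d(1,2) ctx'(1)] ctx] _ mE])
next
  case (pm_comm \<Gamma> v A B \<Delta> x y w D \<Theta> z u F E)
  obtain M N U where d: "den \<Gamma> v (Tensor A B) M" "den (\<Delta> @ [(x, A), (y, B)]) w D N" "den (\<Theta> @ [(z, D)]) u F U"
    using typed_den [OF pm_comm(1)] typed_den [OF pm_comm(2)] typed_den [OF pm_comm(3)] by blast
  note p = den_props [OF d(1)] den_props [OF d(2)] den_props [OF d(3)]
  have mE: "mset E = mset (\<Theta> @ \<Delta> @ \<Gamma>)" using pm_comm by simp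
  have ctx: "is_ctx (\<Theta> @ \<Delta> @ \<Gamma>)"
    using is_ctx_mset [OF mE] pm_comm by simp
  then have ctx': "is_ctx (\<Delta> @ \<Gamma>)" "is_ctx ((\<Theta> @ \<Delta>) @ \<Gamma>)"
    by (auto simp: is_ctx_append)
  \<comment> \<open>The side condition on \<open>\<Theta>\<close> enters here: \<open>x\<close> and
    \<open>y\<close> must not clash with the variables of \<open>u\<close> once \<open>u\<close>
    moves under the binder.\<close>
  have "is_ctx (\<Theta> @ \<Delta> @ [(x, A), (y, B)])"
    using ctx pm_comm(4) den_ctx [OF d(2)] by (simp add: is_ctx_append image_Un Int_Un_distrib)
  from den_subst1 [OF d(3,2) this]
  have u: "den ((\<Theta> @ \<Delta>) @ [(x, A), (y, B)]) (subst1 u w z) F (U \<bullet> (ide (map eob \<Theta>) \<star> N))"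
    unfolding append_assoc .
  have types: "is_type S A" "is_type S B" using p by auto
  have ob: "obs eob \<Theta>" "obs eob \<Delta>"
    using den_objs [OF d(2)] den_objs [OF d(3)] by auto
  note den_Pm [OF d(1) u ctx'(2)]
  also have "(U \<bullet> (ide (map eob \<Theta>) \<star> N)) \<bullet> (ide (map eob (\<Theta> @ \<Delta>)) \<star> (unpairing A B \<bullet> M))
      = U \<bullet> (ide (map eob \<Theta>) \<star> (N \<bullet> (ide (map eob \<Delta>) \<star> (unpairing A B \<bullet> M))))"
    using p ob types by (simp add: whisker)
  finally show ?case
    unfolding append_assoc by (rule den_both [OF den_subst1 [OF d(3) den_Pm [OF d(1,2) ctx'(1)] ctx] _ mE])
qed

end

section \<open>Enrichment and soundness\<close>

text \<open>Monotonicity is not an axiom of the class; it is distributivity over the join of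
  \<open>{y, z}\<close>, which is \<open>z\<close> when \<open>y \<le> z\<close>.\<close>

lemma quantale_mult_mono:
  fixes a b c d :: "'v::quantale"
  assumes "a \<le> b" "c \<le> d"
  shows "a * c \<le> b * d"
proof -
  have mono: "x * y \<le> x * z" if "y \<le> z" for x y z :: 'v
  proof -
    have "x * y \<le> Sup ((*) x ` {y, z})"
      by (rule Sup_upper) simp
    also have "\<dots> = x * z"
      using that mult_Sup [of x "{y, z}"] by (simp add: sup.absorb2)
    finally show ?thesis .
  qed
  have "a * c \<le> a * d" by (rule mono) fact
  also have "\<dots> = d * a" by (rule mult.commute)
  also have "\<dots> \<le> d * b" by (rule mono) fact
  finally show ?thesis by (simp add: mult.commute)
qed

section \<open>Distances of strict arrows\<close>

context vcat_enriched_autonomous_category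
begin

lemma dist_refl:
  assumes "f \<in> Ar C"
  shows "1 \<le> dist C f f"
  using hom_vcategory [of "src C f" "tgt C f"] assms by (auto simp: vcategory_def hom_def)

lemma dist_trans:
  assumes "f \<in> Ar C" "g \<in> Ar C" "h \<in> Ar C" "src C g = src C f" "src C h = src C f"
    "tgt C g = tgt C f" "tgt C h = tgt C f"
  shows "dist C f g * dist C g h \<le> dist C f h"
  using hom_vcategory [of "src C f" "tgt C f"] assms by (auto simp: vcategory_def hom_def)

lemma dist_cmp:
  assumes "f \<in> Ar C" "f' \<in> Ar C" "g \<in> Ar C" "g' \<in> Ar C" "src C f' = src C f" "tgt C f' = tgt C f"
    "src C g = tgt C f" "src C g' = src C g" "tgt C g' = tgt C g"
  shows "dist C f f' * dist C g g' \<le> dist C (g \<cdot> f) (g' \<cdot> f')"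
  using cmp_vfunctor [of "src C f" "tgt C f" "tgt C g"] assms
  by (auto simp: vfunctor_def vtensor_def hom_def)

lemma dist_tensm:
  assumes "f \<in> Ar C" "f' \<in> Ar C" "g \<in> Ar C" "g' \<in> Ar C" "src C f' = src C f" "tgt C f' = tgt C f"
    "src C g' = src C g" "tgt C g' = tgt C g"
  shows "dist C f f' * dist C g g' \<le> dist C (f \<otimes> g) (f' \<otimes> g')"
  using tensm_vfunctor [of "src C f" "tgt C f" "src C g" "tgt C g"] assms
  by (auto simp: vfunctor_def vtensor_def hom_def)

lemma dist_curry:
  assumes "f \<in> Ar C" "f' \<in> Ar C" "src C f = Y \<odot> X" "src C f' = Y \<odot> X" "tgt C f' = tgt C f"
    "X \<in> Ob C" "Y \<in> Ob C"
  shows "dist C f f' \<le> dist C (curry C Y X f) (curry C Y X f')"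
  using curry_visomorphism [of X Y "tgt C f"] assms
  by (auto simp: visomorphism_def vfunctor_def hom_def)

text \<open>The fixed factor contributes its self-distance, which is at least the unit.\<close>

lemma dist_cmp_right:
  assumes "f \<in> Ar C" "g \<in> Ar C" "g' \<in> Ar C" "src C g = tgt C f" "src C g' = src C g" "tgt C g' = tgt C g"
  shows "dist C g g' \<le> dist C (g \<cdot> f) (g' \<cdot> f)"
proof -
  have "dist C g g' = 1 * dist C g g'" by simp
  also have "\<dots> \<le> dist C f f * dist C g g'"
    using assms by (intro quantale_mult_mono dist_refl) auto
  also have "\<dots> \<le> dist C (g \<cdot> f) (g' \<cdot> f)"
    using assms by (intro dist_cmp) auto
  finally show ?thesis .
qed

lemma dist_cmp_left:
  assumes "f \<in> Ar C" "f' \<in> Ar C" "g \<in> Ar C" "src C f' = src C f" "tgt C f' = tgt C f" "src C g = tgt C f"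
  shows "dist C f f' \<le> dist C (g \<cdot> f) (g \<cdot> f')"
proof -
  have "dist C f f' = dist C f f' * 1" by simp
  also have "\<dots> \<le> dist C f f' * dist C g g"
    using assms by (intro quantale_mult_mono dist_refl) auto
  also have "\<dots> \<le> dist C (g \<cdot> f) (g \<cdot> f')"
    using assms by (intro dist_cmp) auto
  finally show ?thesis .
qed

definition sdist :: "('o, 'm) strict_arrow \<Rightarrow> ('o, 'm) strict_arrow \<Rightarrow> 'v" where
  "sdist f g = dist C (mor f) (mor g)"

text \<open>\<open>sdist\<close> only sees the underlying morphisms, and the enrichment bounds them
  within one hom-set; this predicate supplies the common source and target.\<close>

definition parallel :: "('o, 'm) strict_arrow \<Rightarrow> ('o, 'm) strict_arrow \<Rightarrow> bool" where
  "parallel f g \<longleftrightarrow> arr f \<and> arr g \<and> sdom f = sdom g \<and> scod f = scod g"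

lemma sdist_refl: "arr f \<Longrightarrow> 1 \<le> sdist f f"
  by (simp add: sdist_def dist_refl)

lemma sdist_trans: "\<lbrakk>parallel f g; parallel g h\<rbrakk> \<Longrightarrow> sdist f g * sdist g h \<le> sdist f h"
  unfolding sdist_def parallel_def by (intro dist_trans) auto

lemma sdist_comp:
  "\<lbrakk>parallel f f'; parallel g g'; scod f = sdom g\<rbrakk> \<Longrightarrow> sdist f f' * sdist g g' \<le> sdist (g \<bullet> f) (g' \<bullet> f')"
  unfolding sdist_def parallel_def by (simp, intro dist_cmp) auto

lemma sdist_comp_right: "\<lbrakk>arr f; parallel g g'; scod f = sdom g\<rbrakk> \<Longrightarrow> sdist g g' \<le> sdist (g \<bullet> f) (g' \<bullet> f)"
  unfolding sdist_def parallel_def by (simp, intro dist_cmp_right) auto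

lemma sdist_comp_left: "\<lbrakk>parallel f f'; arr g; scod f = sdom g\<rbrakk> \<Longrightarrow> sdist f f' \<le> sdist (g \<bullet> f) (g \<bullet> f')"
  unfolding sdist_def parallel_def by (simp, intro dist_cmp_left) auto

text \<open>Conjugation by the fixed splitting maps costs nothing, by the two estimates for
  composition with a fixed arrow.\<close>

lemma sdist_ten:
  assumes "parallel f f'" "parallel g g'"
  shows "sdist f f' * sdist g g' \<le> sdist (f \<star> g) (f' \<star> g')"
proof -
  have *: "arr f" "arr f'" "arr g" "arr g'" "sdom f' = sdom f" "scod f' = scod f" "sdom g' = sdom g" "scod g' = scod g"
    using assms by (auto simp: parallel_def)
  let ?i = "inv_arrow C (split2 C (scod f) (scod g))" and ?s = "split2 C (sdom f) (sdom g)"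
  have "sdist f f' * sdist g g' \<le> dist C (mor f \<otimes> mor g) (mor f' \<otimes> mor g')"
    unfolding sdist_def using * arrD [OF *(1)] arrD [OF *(2)] arrD [OF *(3)] arrD [OF *(4)] by (intro dist_tensm) simp_all
  also have "\<dots> \<le> dist C ((mor f \<otimes> mor g) \<cdot> ?s) ((mor f' \<otimes> mor g') \<cdot> ?s)"
    using * arrD [OF *(1)] arrD [OF *(2)] arrD [OF *(3)] arrD [OF *(4)] by (intro dist_cmp_right) simp_all
  also have "\<dots> \<le> dist C (?i \<cdot> (mor f \<otimes> mor g) \<cdot> ?s) (?i \<cdot> (mor f' \<otimes> mor g') \<cdot> ?s)"
    using * arrD [OF *(1)] arrD [OF *(2)] arrD [OF *(3)] arrD [OF *(4)] by (intro dist_cmp_left) simp_all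
  finally show ?thesis
    using * by (simp add: sdist_def ten_def)
qed

lemma sdist_ide_ten:
  assumes "objs Xs" "parallel f f'"
  shows "sdist f f' \<le> sdist (ide Xs \<star> f) (ide Xs \<star> f')"
proof -
  have "sdist f f' = 1 * sdist f f'" by simp
  also have "\<dots> \<le> sdist (ide Xs) (ide Xs) * sdist f f'"
    using assms by (intro quantale_mult_mono sdist_refl) auto
  also have "\<dots> \<le> sdist (ide Xs \<star> f) (ide Xs \<star> f')"
    using assms by (intro sdist_ten) (auto simp: parallel_def)
  finally show ?thesis .
qed

lemma sdist_tens_list:
  "\<lbrakk>list_all2 parallel fs gs; length qs = length fs; \<forall>i<length fs. qs ! i \<le> sdist (fs ! i) (gs ! i)\<rbrakk> \<Longrightarrow>
    parallel (tens_list fs) (tens_list gs) \<and> prod_list qs \<le> sdist (tens_list fs) (tens_list gs)"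
proof (induction fs gs arbitrary: qs rule: list_all2_induct)
  case Nil
  then show ?case
    using sdist_refl [of "ide []"] by (simp add: parallel_def)
next
  case (Cons f fs g gs)
  then obtain q qs' where qs: "qs = q # qs'" by (cases qs) auto
  have "\<forall>i<length fs. qs' ! i \<le> sdist (fs ! i) (gs ! i)"
    using Cons.prems(2) unfolding qs by (metis Suc_less_eq length_Cons nth_Cons_Suc)
  then have IH: "parallel (tens_list fs) (tens_list gs)" "prod_list qs' \<le> sdist (tens_list fs) (tens_list gs)"
    using Cons.IH [of qs'] Cons.prems(1) qs by auto
  have "q \<le> sdist f g"
    using Cons.prems(2) qs by force
  then have "q * prod_list qs' \<le> sdist f g * sdist (tens_list fs) (tens_list gs)"
    using IH by (intro quantale_mult_mono)
  also have "\<dots> \<le> sdist (f \<star> tens_list fs) (g \<star> tens_list gs)"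
    using Cons.hyps(1) IH by (intro sdist_ten)
  finally show ?case
    using Cons.hyps(1) IH qs by (auto simp: parallel_def simp del: tens_list_dom_cod)
qed

lemma sdist_scurry:
  assumes "parallel f f'" "sdom f = Ys @ [X]" "scod f = [Z]"
  shows "sdist f f' \<le> sdist (scurry Ys X f) (scurry Ys X f')"
proof -
  have *: "arr f" "arr f'" "sdom f' = Ys @ [X]" "scod f' = [Z]"
    using assms by (auto simp: parallel_def)
  have ob: "objs Ys" "X \<in> Ob C"
    using arrD(1) [OF *(1)] assms(2) by auto
  let ?i = "inv_arrow C (split2 C Ys [X])"
  have "sdist f f' \<le> dist C (mor f \<cdot> ?i) (mor f' \<cdot> ?i)"
    unfolding sdist_def using * assms ob arrD(3-5) [OF *(1)] arrD(3-5) [OF *(2)] by (intro dist_cmp_right) simp_all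
  also have "\<dots> \<le> dist C (curry C (tenss C Ys) X (mor f \<cdot> ?i)) (curry C (tenss C Ys) X (mor f' \<cdot> ?i))"
    using * assms ob arrD(3-5) [OF *(1)] arrD(3-5) [OF *(2)] by (intro dist_curry) simp_all
  finally show ?thesis
    by (simp add: sdist_def scurry_def)
qed

end

section \<open>The congruence rules\<close>

locale enriched_linear_model =
  vcat_enriched_autonomous_category C + linear_model C S gi fi
  for C :: "('o, 'm, 'v::quantale, 'x) vautonomous_category_scheme" (structure)
    and S :: "('g, 'f) signature" and gi :: "'g \<Rightarrow> 'o" and fi :: "'f \<Rightarrow> 'm"
begin

lemma den_parallel: "\<lbrakk>den E t A M; den E u A N\<rbrakk> \<Longrightarrow> parallel M N"
  unfolding parallel_def using den_props by metis

text \<open>Stated with denotations rather than with \<open>sem\<close>, because the congruence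
  rules are proved by composing denotations; uniqueness makes the two readings agree.\<close>

definition close_in :: "'g ctx \<Rightarrow> ('g, 'f) tm \<Rightarrow> 'v \<Rightarrow> ('g, 'f) tm \<Rightarrow> 'g ty \<Rightarrow> bool" where
  "close_in E t q u A \<longleftrightarrow> (\<exists>M N. den E t A M \<and> den E u A N \<and> q \<le> sdist M N)"

lemma close_inI: "\<lbrakk>den E t A M; den E u A N; q \<le> sdist M N\<rbrakk> \<Longrightarrow> close_in E t q u A"
  by (auto simp: close_in_def)

text \<open>Integrality enters here: a self-distance lies above the unit, which is
  \<open>top\<close>, hence above every \<open>q\<close>.\<close>

lemma close_in_refl: "\<lbrakk>(1::'v) = top; den E t A M; den E u A M\<rbrakk> \<Longrightarrow> close_in E t q u A"
  by (rule close_inI) (auto intro: order_trans [OF top_greatest] simp: sdist_refl [OF den_arr])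

text \<open>Both terms share \<open>\<phi>\<close> and the contexts, so only the tensor of the
  subterms varies; the permutation before it and \<open>\<phi>\<close> after it are fixed
  arrows.\<close>

lemma close_in_node:
  assumes "former t vs As A \<phi>" "former u ws As A \<phi>" "length \<Gamma>s = length As" "length qs = length As"
    "\<forall>i<length As. close_in (\<Gamma>s ! i) (vs ! i) (qs ! i) (ws ! i) (As ! i)"
    "mset E = mset (concat \<Gamma>s)" "is_ctx E"
  shows "close_in E t (prod_list qs) u A"
proof -
  have "\<exists>M N. \<forall>i<length As. den (\<Gamma>s ! i) (vs ! i) (As ! i) (M i) \<and> den (\<Gamma>s ! i) (ws ! i) (As ! i) (N i)
      \<and> qs ! i \<le> sdist (M i) (N i)"
    using assms(5) unfolding close_in_def by metis
  then obtain M N where MN: "\<And>i. i < length As \<Longrightarrow> den (\<Gamma>s ! i) (vs ! i) (As ! i) (M i)"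
    "\<And>i. i < length As \<Longrightarrow> den (\<Gamma>s ! i) (ws ! i) (As ! i) (N i)"
    "\<And>i. i < length As \<Longrightarrow> qs ! i \<le> sdist (M i) (N i)"
    by blast
  let ?M = "map M [0..<length As]" and ?N = "map N [0..<length As]"
  have M: "\<forall>i<length As. den (\<Gamma>s ! i) (vs ! i) (As ! i) (?M ! i)" "\<forall>i<length As. den (\<Gamma>s ! i) (ws ! i) (As ! i) (?N ! i)"
    using MN by simp_all
  have len: "length ?M = length As" "length ?N = length As" by simp_all
  note l = den_list [OF assms(1,3) len(1) M(1)] den_list [OF assms(2,3) len(2) M(2)]
  have "list_all2 parallel ?M ?N"
    using den_parallel [OF MN(1,2)] by (simp add: list_all2_conv_all_nth)
  from sdist_tens_list [OF this, of qs]
  have T: "parallel (tens_list ?M) (tens_list ?N)" "prod_list qs \<le> sdist (tens_list ?M) (tens_list ?N)"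
    using assms(4) MN by auto
  let ?P = "perm eob E (concat \<Gamma>s)"
  have P: "arr ?P" "scod ?P = sdom (tens_list ?M)"
    using l(5) mset_eq_setD [OF assms(6)] assms(6) l(2) by (simp_all add: image_UN map_concat)
  have phi: "arr \<phi>" "scod (tens_list ?M) = sdom \<phi>"
    using former_arr(1,2) [OF assms(1)] l(3) by simp_all
  note T(2)
  also have "sdist (tens_list ?M) (tens_list ?N) \<le> sdist (tens_list ?M \<bullet> ?P) (tens_list ?N \<bullet> ?P)"
    using T P by (intro sdist_comp_right) auto
  also have "\<dots> \<le> sdist (\<phi> \<bullet> tens_list ?M \<bullet> ?P) (\<phi> \<bullet> tens_list ?N \<bullet> ?P)"
    using T P phi by (intro sdist_comp_left) (auto simp: parallel_def simp del: tens_list_dom_cod perm_dom_cod)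
  finally show ?thesis
    by (rule close_inI [OF den.Node [OF assms(1,3) len(1) M(1) assms(6,7)] den.Node [OF assms(2,3) len(2) M(2) assms(6,7)]])
qed

lemma close_in_node2:
  assumes "former t [v, v'] [A1, A2] A \<phi>" "former u [w, w'] [A1, A2] A \<phi>"
    "close_in \<Gamma> v q w A1" "close_in \<Delta> v' r w' A2" "E \<in> shuffles \<Gamma> \<Delta>" "is_ctx E"
  shows "close_in E t (q * r) u A"
  using close_in_node [OF assms(1,2), of "[\<Gamma>, \<Delta>]" "[q, r]" E] assms mset_shuffles [OF assms(5)]
  by (simp add: All_less_Suc)

lemma close_in_type: "close_in E t q u A \<Longrightarrow> is_type S A"
  by (auto simp: close_in_def den_type)

lemma close_in_Pm:
  assumes "close_in \<Gamma> v q w (Tensor A A')" "close_in (\<Delta> @ [(x, A), (y, A')]) v' r w' D"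
    "mset E = mset (\<Delta> @ \<Gamma>)" "is_ctx E"
  shows "close_in E (Pm v x y v') (q * r) (Pm w x y w') D"
proof -
  obtain M M' N N' where d: "den \<Gamma> v (Tensor A A') M" "den \<Gamma> w (Tensor A A') M'" "q \<le> sdist M M'"
    "den (\<Delta> @ [(x, A), (y, A')]) v' D N" "den (\<Delta> @ [(x, A), (y, A')]) w' D N'" "r \<le> sdist N N'"
    using assms(1,2) by (auto simp: close_in_def)
  note p = den_props [OF d(1)] den_props [OF d(2)] den_props [OF d(4)] den_props [OF d(5)]
  have types: "is_type S A" "is_type S A'" using p by auto
  have ob: "obs eob \<Delta>" "obs eob E"
    using den_objs [OF d(1)] den_objs [OF d(4)] mset_eq_setD [OF assms(3)] by auto
  let ?u = "unpairing A A'" and ?O = "map eob \<Delta>" and ?P = "perm eob E (\<Delta> @ \<Gamma>)"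
  have P: "arr ?P" using ob assms(3) by (intro arr_perm) auto
  have "q \<le> sdist M M'" by fact
  also have "\<dots> \<le> sdist (?u \<bullet> M) (?u \<bullet> M')"
    using p types by (intro sdist_comp_left) (auto simp: parallel_def)
  also have "\<dots> \<le> sdist (ide ?O \<star> (?u \<bullet> M)) (ide ?O \<star> (?u \<bullet> M'))"
    using p types ob by (intro sdist_ide_ten) (auto simp: parallel_def)
  also have "\<dots> \<le> sdist ((ide ?O \<star> (?u \<bullet> M)) \<bullet> ?P) ((ide ?O \<star> (?u \<bullet> M')) \<bullet> ?P)"
    using p types ob P by (intro sdist_comp_right) (auto simp: parallel_def)
  finally have "q * r \<le> sdist ((ide ?O \<star> (?u \<bullet> M)) \<bullet> ?P) ((ide ?O \<star> (?u \<bullet> M')) \<bullet> ?P) * sdist N N'"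
    using d(6) by (rule quantale_mult_mono)
  also have "\<dots> \<le> sdist (N \<bullet> (ide ?O \<star> (?u \<bullet> M)) \<bullet> ?P) (N' \<bullet> (ide ?O \<star> (?u \<bullet> M')) \<bullet> ?P)"
    using p types ob P by (intro sdist_comp) (auto simp: parallel_def)
  finally show ?thesis
    by (rule close_inI [OF den.Pm [OF d(1,4) assms(3,4)] den.Pm [OF d(2,5) assms(3,4)]])
qed

lemma close_in_exchange:
  assumes "close_in E t q u A" "mset E' = mset E"
  shows "close_in E' t q u A"
proof -
  obtain M N where d: "den E t A M" "den E u A N" "q \<le> sdist M N"
    using assms(1) by (auto simp: close_in_def)
  have "obs eob E'"
    using den_objs [OF d(1)] mset_eq_setD [OF assms(2)] by simp
  then have "arr (perm eob E' E)"
    using assms(2) by (intro arr_perm) auto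
  then have "sdist M N \<le> sdist (M \<bullet> perm eob E' E) (N \<bullet> perm eob E' E)"
    using den_parallel [OF d(1,2)] den_dom [OF d(1)] by (intro sdist_comp_right) auto
  with d(3) show ?thesis
    by (intro close_inI [OF den_exchange [OF d(1) assms(2)] den_exchange [OF d(2) assms(2)]]) simp
qed

lemma close_in_subst:
  assumes "close_in (\<Gamma> @ [(x, A)]) v q w A'" "close_in \<Delta> v' r w' A" "is_ctx (\<Gamma> @ \<Delta>)"
  shows "close_in (\<Gamma> @ \<Delta>) (subst1 v v' x) (q * r) (subst1 w w' x) A'"
proof -
  obtain M M' N N' where d: "den (\<Gamma> @ [(x, A)]) v A' M" "den (\<Gamma> @ [(x, A)]) w A' M'" "q \<le> sdist M M'"
    "den \<Delta> v' A N" "den \<Delta> w' A N'" "r \<le> sdist N N'"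
    using assms(1,2) by (auto simp: close_in_def)
  note p = den_props [OF d(1)] den_props [OF d(2)] den_props [OF d(4)] den_props [OF d(5)]
  have ob: "obs eob \<Gamma>"
    using den_objs [OF d(1)] by auto
  let ?O = "map eob \<Gamma>"
  have "r \<le> sdist N N'" by fact
  also have "\<dots> \<le> sdist (ide ?O \<star> N) (ide ?O \<star> N')"
    using p ob by (intro sdist_ide_ten) (auto simp: parallel_def)
  \<comment> \<open>\<open>sdist_comp\<close> lists the inner arrow first, which here comes from the
    substituted term; commutativity restores the order \<open>q * r\<close> at the end.\<close>
  finally have "r * q \<le> sdist (ide ?O \<star> N) (ide ?O \<star> N') * sdist M M'"
    using d(3) by (rule quantale_mult_mono)
  also have "\<dots> \<le> sdist (M \<bullet> (ide ?O \<star> N)) (M' \<bullet> (ide ?O \<star> N'))"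
    using p ob by (intro sdist_comp) (auto simp: parallel_def)
  finally show ?thesis
    by (intro close_inI [OF den_subst1 [OF d(1,4) assms(3)] den_subst1 [OF d(2,5) assms(3)]]) (simp add: mult.commute)
qed

lemma close_in_Lam:
  assumes "close_in (\<Gamma> @ [(x, A)]) v q w A'"
  shows "close_in \<Gamma> (Lam x A v) q (Lam x A w) (Lolli A A')"
proof -
  obtain M N where d: "den (\<Gamma> @ [(x, A)]) v A' M" "den (\<Gamma> @ [(x, A)]) w A' N" "q \<le> sdist M N"
    using assms by (auto simp: close_in_def)
  note d(3)
  also have "sdist M N \<le> sdist (scurry (map eob \<Gamma>) (tob A) M) (scurry (map eob \<Gamma>) (tob A) N)"
    using den_parallel [OF d(1,2)] den_dom [OF d(1)] den_cod [OF d(1)] by (intro sdist_scurry) auto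
  finally show ?thesis
    by (rule close_inI [OF den.Lam [OF d(1)] den.Lam [OF d(2)]])
qed

lemma close_in_trans:
  assumes "close_in E t q u A" "close_in E u r w A"
  shows "close_in E t (q * r) w A"
proof -
  obtain M N N' P where d: "den E t A M" "den E u A N" "q \<le> sdist M N" "den E u A N'" "den E w A P" "r \<le> sdist N' P"
    using assms by (auto simp: close_in_def)
  \<comment> \<open>The two premises may come with different denotations of the middle term;
    uniqueness identifies them.\<close>
  have "N' = N"
    using den_unique [OF d(4,2)] by simp
  have "q * r \<le> sdist M N * sdist N P"
    using d(3,6) \<open>N' = N\<close> by (intro quantale_mult_mono) auto
  also have "\<dots> \<le> sdist M P"
    using den_parallel d(1,2,5) by (intro sdist_trans)
  finally show ?thesis
    using d(1,5) by (intro close_inI)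
qed

lemma close_inD:
  assumes "close_in E t q u A"
  shows "q \<le> dist C (sem S C gi fi E t A) (sem S C gi fi E u A)"
  using assms by (auto simp: close_in_def sem_eq sdist_def)

text \<open>The passage back from \<open>sem\<close> serves the rules \<open>arch\<close> and
  \<open>join\<close>, whose premises must all bound one pair of morphisms fixed in advance.\<close>

lemma close_inI_sem:
  assumes "typed S E t A" "typed S E u A" "q \<le> dist C (sem S C gi fi E t A) (sem S C gi fi E u A)"
  shows "close_in E t q u A"
proof -
  obtain M N where "den E t A M" "den E u A N"
    using typed_den [OF assms(1)] typed_den [OF assms(2)] by blast
  with assms(3) show ?thesis
    by (intro close_inI) (auto simp: sem_eq sdist_def)
qed

lemma veq_close_in:
  assumes integral: "(1::'v) = top" and basis: "is_basis B"
  shows "veq S B \<Gamma> v q w A \<Longrightarrow> close_in \<Gamma> v q w A"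
proof (induction rule: veq.induct)
  case (ax \<Gamma> v w A)
  then show ?case
    using lameq_den close_in_refl [OF integral] by blast
next
  case (ax_sym \<Gamma> v w A)
  then show ?case
    using lameq_den close_in_refl [OF integral] by blast
next
  case (refl \<Gamma> v A)
  then show ?case
    using typed_den close_in_refl [OF integral] by blast
next
  case (trans \<Gamma> v q w A r u)
  then show ?case by (blast intro: close_in_trans)
next
  case (weak \<Gamma> v q w A r)
  then show ?case by (auto simp: close_in_def intro: order_trans)
next
  case (arch \<Gamma> v A w q)
  \<comment> \<open>The premises only concern basis elements way below \<open>q\<close>, and by the
    basis property their join is already \<open>q\<close>.\<close>
  have "q = Sup (B \<inter> {y. y \<lless> q})"
    using basis by (simp add: is_basis_def)
  also have "\<dots> \<le> dist C (sem S C gi fi \<Gamma> v A) (sem S C gi fi \<Gamma> w A)"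
    using arch by (intro Sup_least) (auto intro: close_inD)
  finally show ?case
    using arch.hyps by (intro close_inI_sem) auto
next
  case (join \<Gamma> v A w Q)
  \<comment> \<open>An empty \<open>Q\<close> is covered: the typing premises alone provide the
    denotations.\<close>
  then show ?case
    by (intro close_inI_sem Sup_least) (auto intro: close_inD)
next
  case (Op f \<Gamma>s vs ws qs E)
  then show ?case
    using mset_shuffless by (intro close_in_node [OF former.Op former.Op]) auto
next
  case (Tens \<Gamma> v q w A \<Delta> v' r w' A' E)
  then show ?case
    using close_in_type by (intro close_in_node2 [OF former.Tens former.Tens]) auto
next
  case (Pm \<Gamma> v q w A A' \<Delta> x y v' r w' D E)
  then show ?case
    using mset_shuffles by (intro close_in_Pm) fastforce+
next
  case (To \<Gamma> v q w \<Delta> v' r w' A E)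
  then show ?case
    using close_in_type by (intro close_in_node2 [OF former.To former.To]) auto
next
  case (App \<Gamma> v q w A A' \<Delta> v' r w' E)
  have "is_type S A" "is_type S A'"
    using close_in_type [OF App.IH(1)] by auto
  with App show ?case
    by (intro close_in_node2 [OF former.App former.App]) auto
next
  case (Subst \<Gamma> x A v q w A' \<Delta> v' r w' E)
  have "close_in (\<Gamma> @ \<Delta>) (subst1 v v' x) (q * r) (subst1 w w' x) A'"
    using Subst is_ctx_mset [of E "\<Gamma> @ \<Delta>"] by (intro close_in_subst) auto
  then show ?case
    by (rule close_in_exchange) fact
next
  case (Lam \<Gamma> x A v q w A')
  then show ?case by (intro close_in_Lam)
next
  case (Perm \<Gamma> v q w A \<Delta>)
  then show ?case by (blast intro: close_in_exchange)
qed

end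

theorem theorem3p13:
  fixes B :: "'v::quantale set"
    and C :: "('o, 'm, 'v) vautonomous_category"
    and S :: "('g, 'f) signature"
    and gi :: "'g \<Rightarrow> 'o" and fi :: "'f \<Rightarrow> 'm"
    and \<Gamma> :: "'g ctx" and v w :: "('g, 'f) tm" and A :: "'g ty" and q :: 'v
  assumes integral: "(1::'v) = top"
    and continuous: "\<forall>x::'v. x = Sup {y. y \<lless> x}"
    and basis: "is_basis B"
    and basis_join: "\<forall>Q. Q \<subseteq> B \<and> finite Q \<longrightarrow> Sup Q \<in> B"
    and basis_mult: "\<forall>x\<in>B. \<forall>y\<in>B. x * y \<in> B"
    and basis_one: "1 \<in> B"
    and enriched: "vcat_enriched_autonomous_category C"
    and sig: "is_signature S"
    and interpr: "is_interpretation C S gi fi"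
    and derivable: "veq S B \<Gamma> v q w A"
  shows "dist C (sem S C gi fi \<Gamma> v A) (sem S C gi fi \<Gamma> w A) \<ge> q"
proof -
  interpret vcat_enriched_autonomous_category C by (fact enriched)
  interpret enriched_linear_model C S gi fi
    by unfold_locales (fact sig interpr)+
  show ?thesis
    by (rule close_inD [OF veq_close_in [OF integral basis derivable]])
qed

end
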